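(* There is an algorithm which, given a matrix $A\in\mathbb{R}^{m\times n}$, decides whether the factor rank of $A$ is greater than $3$, and which requires at most $O\left((m+n)^3mn\log(mn)+m^3n^3\right)$ arithmetic operations in the worst case.
   Context: The tropical semiring is $\mathbb{R}$ with $a\oplus b=\min\{a,b\}$ and $a\otimes b=a+b$; $(B\otimes C)_{ij}=\min_{\tau}\{B_{i\tau}+C_{\tau j}\}$. The factor rank of $A\in\mathbb{R}^{m\times n}$ is the smallest $k$ such that $A=B\otimes C$ for some $B\in\mathbb{R}^{m\times k}$, $C\in\mathbb{R}^{k\times n}$. *)

theory Defs
  imports Complex_Main "Jordan_Normal_Form.Matrix"
begin

section \<open>Tropical matrices\<close>

definition trop_mult :: "real mat \<Rightarrow> real mat \<Rightarrow> real mat" where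
  "trop_mult B C = mat (dim_row B) (dim_col C)
     (\<lambda>(i, j). Min ((\<lambda>t. B $$ (i, t) + C $$ (t, j)) ` {0..<dim_col B}))"

text \<open>Without an infinite element there is no empty tropical sum, so the inner dimension \<open>k\<close> is
  required to be positive. For a matrix with at least one row and one column such a \<open>k\<close> exists:
  multiply \<open>A\<close> by a square matrix with zeros on the diagonal and a large number elsewhere.\<close>

definition factor_rank :: "real mat \<Rightarrow> nat" where
  "factor_rank A = (LEAST k. k > 0 \<and>
     (\<exists>B \<in> carrier_mat (dim_row A) k. \<exists>C \<in> carrier_mat k (dim_col A). A = trop_mult B C))"


section \<open>Algorithms on real inputs\<close>

text \<open>Algorithms are programs of a while-language for the real random access machine. A program
  uses finitely many named two-dimensional arrays, of natural numbers (for loop counters, indices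
  and flags) and of real numbers; a scalar variable is an array used at one position only.
  Natural numbers can be added, subtracted and compared; real numbers can be added, subtracted,
  multiplied, divided and compared. The only real constants are 0 and 1, and a real number
  influences the control flow and the natural numbers only through comparisons; in particular
  there is no rounding.\<close>

type_synonym vname = string

text \<open>\<open>ISub\<close> is truncated subtraction, and \<open>RDiv\<close> by 0 yields 0.\<close>

datatype iexp =
    IConst nat
  | IGet vname iexp iexp
  | IAdd iexp iexp
  | ISub iexp iexp

datatype rexp =
    RZero
  | ROne
  | RGet vname iexp iexp
  | RAdd rexp rexp
  | RSub rexp rexp
  | RMul rexp rexp
  | RDiv rexp rexp

datatype bexp =
    ILess iexp iexp
  | RLess rexp rexp
  | BNot bexp
  | BAnd bexp bexp

datatype com =
    Skip
  | ISet vname iexp iexp iexp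
  | RSet vname iexp iexp rexp
  | Seq com com
  | Cond bexp com com
  | While bexp com

type_synonym istore = "vname \<Rightarrow> nat \<Rightarrow> nat \<Rightarrow> nat"
type_synonym rstore = "vname \<Rightarrow> nat \<Rightarrow> nat \<Rightarrow> real"
type_synonym state = "istore \<times> rstore"

definition upd :: "(vname \<Rightarrow> nat \<Rightarrow> nat \<Rightarrow> 'v) \<Rightarrow> vname \<Rightarrow> nat \<Rightarrow> nat \<Rightarrow> 'v \<Rightarrow> vname \<Rightarrow> nat \<Rightarrow> nat \<Rightarrow> 'v"
  where "upd f x i j v = f(x := (f x)(i := (f x i)(j := v)))"

fun ival :: "iexp \<Rightarrow> state \<Rightarrow> nat" where
  "ival (IConst k) s = k"
| "ival (IGet x e f) s = fst s x (ival e s) (ival f s)"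
| "ival (IAdd e f) s = ival e s + ival f s"
| "ival (ISub e f) s = ival e s - ival f s"

fun rval :: "rexp \<Rightarrow> state \<Rightarrow> real" where
  "rval RZero s = 0"
| "rval ROne s = 1"
| "rval (RGet x e f) s = snd s x (ival e s) (ival f s)"
| "rval (RAdd a b) s = rval a s + rval b s"
| "rval (RSub a b) s = rval a s - rval b s"
| "rval (RMul a b) s = rval a s * rval b s"
| "rval (RDiv a b) s = rval a s / rval b s"

fun bval :: "bexp \<Rightarrow> state \<Rightarrow> bool" where
  "bval (ILess e f) s \<longleftrightarrow> ival e s < ival f s"
| "bval (RLess a b) s \<longleftrightarrow> rval a s < rval b s"
| "bval (BNot p) s \<longleftrightarrow> \<not> bval p s"
| "bval (BAnd p q) s \<longleftrightarrow> bval p s \<and> bval q s"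

text \<open>The cost of an expression is the number of arithmetic operations and comparisons in it.
  Operations on natural numbers are charged like those on real numbers: otherwise an exhaustive
  search over combinatorial data would be free. Array accesses and assignments are not charged,
  but every conditional and every loop iteration evaluates at least one comparison. Hence the
  number of charged operations agrees with the number of all elementary steps up to a factor
  and an additive constant which depend only on the program.\<close>

fun iops :: "iexp \<Rightarrow> nat" where
  "iops (IConst k) = 0"
| "iops (IGet x e f) = iops e + iops f"
| "iops (IAdd e f) = iops e + iops f + 1"
| "iops (ISub e f) = iops e + iops f + 1"

fun rops :: "rexp \<Rightarrow> nat" where
  "rops RZero = 0"
| "rops ROne = 0"
| "rops (RGet x e f) = iops e + iops f"
| "rops (RAdd a b) = rops a + rops b + 1"
| "rops (RSub a b) = rops a + rops b + 1"
| "rops (RMul a b) = rops a + rops b + 1"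
| "rops (RDiv a b) = rops a + rops b + 1"

fun bops :: "bexp \<Rightarrow> nat" where
  "bops (ILess e f) = iops e + iops f + 1"
| "bops (RLess a b) = rops a + rops b + 1"
| "bops (BNot p) = bops p"
| "bops (BAnd p q) = bops p + bops q"

text \<open>\<open>exec c s t s'\<close>: started in state \<open>s\<close>, the program \<open>c\<close> terminates in state \<open>s'\<close> after
  exactly \<open>t\<close> arithmetic operations and comparisons.\<close>

inductive exec :: "com \<Rightarrow> state \<Rightarrow> nat \<Rightarrow> state \<Rightarrow> bool" where
  Skip: "exec Skip s 0 s"
| ISet: "exec (ISet x e f g) s (iops e + iops f + iops g)
           (upd (fst s) x (ival e s) (ival f s) (ival g s), snd s)"
| RSet: "exec (RSet x e f a) s (iops e + iops f + rops a)
           (fst s, upd (snd s) x (ival e s) (ival f s) (rval a s))"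
| Seq: "exec c s t s' \<Longrightarrow> exec d s' u s'' \<Longrightarrow> exec (Seq c d) s (t + u) s''"
| CondTrue: "bval p s \<Longrightarrow> exec c s t s' \<Longrightarrow> exec (Cond p c d) s (bops p + t) s'"
| CondFalse: "\<not> bval p s \<Longrightarrow> exec d s t s' \<Longrightarrow> exec (Cond p c d) s (bops p + t) s'"
| WhileFalse: "\<not> bval p s \<Longrightarrow> exec (While p c) s (bops p) s"
| WhileTrue: "bval p s \<Longrightarrow> exec c s t s' \<Longrightarrow> exec (While p c) s' u s'' \<Longrightarrow>
                exec (While p c) s (bops p + t + u) s''"

inductive_cases SkipE: "exec Skip s t s'"
inductive_cases ISetE: "exec (ISet x e f g) s t s'"
inductive_cases RSetE: "exec (RSet x e f a) s t s'"
inductive_cases SeqE: "exec (Seq c d) s t s'"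
inductive_cases CondE: "exec (Cond p c d) s t s'"
inductive_cases WhileE: "exec (While p c) s t s'"

lemma exec_deterministic:
  assumes "exec c s t s'" and "exec c s u s''"
  shows "u = t \<and> s'' = s'"
  using assms
proof (induction arbitrary: u s'' rule: exec.induct)
  case (Seq c s t s' d v r)
  from Seq.prems show ?case by (rule SeqE) (use Seq.IH in blast)
next
  case (WhileTrue p s c t s' v r)
  from WhileTrue.prems show ?case by (rule WhileE) (use WhileTrue.hyps WhileTrue.IH in blast)+
qed (blast elim: SkipE ISetE RSetE CondE WhileE)+

text \<open>The input \<open>A\<close> is stored in the real array \<open>A\<close> (rows and columns counted from 0), its
  dimensions in the scalars \<open>m\<close> and \<open>n\<close>; everything else is 0. The answer of a decision
  procedure is read off the scalar \<open>out\<close>.\<close>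

definition input :: "real mat \<Rightarrow> state" where
  "input A =
    (\<lambda>x i j. if i = 0 \<and> j = 0 then
               (if x = ''m'' then dim_row A else if x = ''n'' then dim_col A else 0)
             else 0,
     \<lambda>x i j. if x = ''A'' \<and> i < dim_row A \<and> j < dim_col A then A $$ (i, j) else 0)"

definition accepting :: "state \<Rightarrow> bool" where
  "accepting s \<longleftrightarrow> fst s ''out'' 0 0 \<noteq> 0"

end

theory Submission imports Defs begin

text \<open>Call two entries \<open>(i, j)\<close>, \<open>(k, l)\<close> of \<open>A\<close> in conflict if \<open>A i j + A k l < A i l + A k j\<close>; then they
  cannot both be attained by the same rank-one term. Conversely, a proper 3-colouring of the conflict
  graph yields a factorization with three terms: each colour class needs a system of potentials, and
  a shortest cycle obstructing it would force an odd cycle in the other two colours.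

  If the neighbourhood of a vertex is contained in that of another one, it can copy the colour of the
  latter, so only the set \<open>U\<close> of vertices with maximal neighbourhood has to be coloured. Take a
  factorization in which no entry of the factors can be decreased. If some column (or row) of \<open>A\<close> is
  attained by the same term throughout, then the vertices without neighbour in this column can form
  one colour class and the remaining ones are bipartite. Otherwise the conflict graph on \<open>U\<close>
  is complete multipartite, and the non-neighbours of any vertex of \<open>U\<close> are a colour class. Hence it
  suffices to test bipartiteness, in time \<open>O(m\<^sup>2 n\<^sup>2)\<close>, for \<open>O(m n)\<close> candidates for the first class.\<close>

section \<open>Conflict colourings and factorizations with three terms\<close>

text \<open>Three-colouring is hard for general graphs; this graph is tractable because the first
  colour class can be read off the matrix as the non-neighbours of a column, a row or one vertex.
  For a single vertex this requires that each vertex of \<open>U\<close> is attained by one term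
  only and that vertices of different terms are always adjacent. Both fail for arbitrary entries,
  and maximality repairs this: if (i, j) had no conflict in row k, then (k, j) would inherit all its
  conflicts. So a maximal vertex has a conflict in every row and every column that is not a copy of
  its own up to a constant, and each such conflict gives a strict inequality between the potentials
  of a factorization. Applied to rows and columns in extreme position, these inequalities order the
  points of the tropical plane. Suitable extreme points are missing only if a column or row of
  constant colour sits in a corner, which is why these are guessed separately. Wrong guesses do no
  harm, because the colouring that is finally computed is checked.\<close>

definition conflict :: "(nat \<Rightarrow> nat \<Rightarrow> real) \<Rightarrow> nat \<Rightarrow> nat \<Rightarrow> nat \<Rightarrow> nat \<Rightarrow> bool" where
  "conflict a i j k l \<longleftrightarrow> a i j + a k l < a i l + a k j"

lemma conflict_sym: "conflict a i j k l \<longleftrightarrow> conflict a k l i j"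
  by (auto simp: conflict_def)

text \<open>The sequence of entries \<open>(I 0, J 0), \<dots>, (I e, J e)\<close> of one colour forces the potential of
  column \<open>l\<close> to exceed that of column \<open>J 0\<close> by at least this amount.\<close>

definition walk :: "(nat \<Rightarrow> nat \<Rightarrow> real) \<Rightarrow> (nat \<Rightarrow> nat) \<Rightarrow> (nat \<Rightarrow> nat) \<Rightarrow> nat \<Rightarrow> nat \<Rightarrow> real" where
  "walk a I J e l = (\<Sum>p<e. a (I p) (J (Suc p)) - a (I p) (J p)) + (a (I e) l - a (I e) (J e))"

lemma walk_cong:
  assumes "\<And>p. p \<le> e \<Longrightarrow> I p = I' p" "\<And>p. p \<le> e \<Longrightarrow> J p = J' p"
  shows "walk a I J e l = walk a I' J' e l"
  unfolding walk_def using assms by (auto intro!: arg_cong2[where f = "(+)"] sum.cong)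

lemma walk_extend:
  "walk a (I(Suc e := i)) (J(Suc e := j)) (Suc e) l = walk a I J e j + (a i l - a i j)"
proof -
  have "(\<Sum>p<e. a ((I(Suc e := i)) p) ((J(Suc e := j)) (Suc p)) - a ((I(Suc e := i)) p) ((J(Suc e := j)) p))
      = (\<Sum>p<e. a (I p) (J (Suc p)) - a (I p) (J p))"
    by (intro sum.cong) auto
  then show ?thesis by (simp add: walk_def)
qed

text \<open>Longest-path potentials: an entry (i, j) of \<open>S\<close> gives an edge from column j
  to every column l with weight a i l - a i j, and \<open>closed\<close> forbids closed walks of
  positive weight. The supremum over all walks from one fixed column then satisfies every edge
  inequality.\<close>

lemma potential_exists:
  assumes fin: "finite S"
    and closed: "\<And>I J e. (\<And>p. p \<le> e \<Longrightarrow> (I p, J p) \<in> S) \<Longrightarrow> walk a I J e (J 0) \<le> 0"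
  shows "\<exists>c. \<forall>(i, j) \<in> S. \<forall>l. a i l - c l \<le> a i j - c j"
proof (cases "S = {}")
  case False
  then obtain i0 j0 where S0: "(i0, j0) \<in> S" by auto
  define X where "X l = {walk a I J e l |I J e. (\<forall>p\<le>e. (I p, J p) \<in> S) \<and> J 0 = j0}" for l
  \<comment> \<open>The edges at \<open>(i0, j0)\<close> lead to every column, so each column is
    reached in one step.\<close>
  have ne: "X l \<noteq> {}" for l
  proof -
    have "walk a (\<lambda>_. i0) (\<lambda>_. j0) 0 l \<in> X l" unfolding X_def using S0 by blast
    then show ?thesis by blast
  qed
  \<comment> \<open>Redirecting the last edge of a walk to \<open>j0\<close> closes it up. Its
    weight therefore exceeds a nonpositive number by at most one edge difference, and
    \<open>S\<close> is finite.\<close>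
  have bdd: "bdd_above (X l)" for l
  proof (rule bdd_aboveI[of _ "Max ((\<lambda>(i, j). a i l - a i j0) ` S)"])
    fix x assume "x \<in> X l"
    then obtain I J e where x: "x = walk a I J e l" "\<And>p. p \<le> e \<Longrightarrow> (I p, J p) \<in> S" "J 0 = j0"
      by (auto simp: X_def)
    have "x = walk a I J e (J 0) + (a (I e) l - a (I e) j0)"
      using x by (simp add: walk_def)
    also have "\<dots> \<le> a (I e) l - a (I e) j0" using closed[of e I J] x(2) by simp
    also have "\<dots> \<le> Max ((\<lambda>(i, j). a i l - a i j0) ` S)"
      using fin x(2)[of e] by (intro Max_ge) (auto intro: rev_image_eqI)
    finally show "x \<le> Max ((\<lambda>(i, j). a i l - a i j0) ` S)" .
  qed
  define c where "c l = Sup (X l)" for l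
  have "c j \<le> c l - (a i l - a i j)" if ij: "(i, j) \<in> S" for i j l
    unfolding c_def[of j]
  proof (rule cSup_least[OF ne])
    fix x assume "x \<in> X j"
    then obtain I J e where x: "x = walk a I J e j" "\<And>p. p \<le> e \<Longrightarrow> (I p, J p) \<in> S" "J 0 = j0"
      by (auto simp: X_def)
    have "walk a (I(Suc e := i)) (J(Suc e := j)) (Suc e) l \<in> X l"
      unfolding X_def mem_Collect_eq
      by (rule exI[of _ "I(Suc e := i)"], rule exI[of _ "J(Suc e := j)"], rule exI[of _ "Suc e"])
        (use x ij in \<open>auto simp: le_Suc_eq\<close>)
    then have "x + (a i l - a i j) \<le> c l"
      unfolding c_def walk_extend x(1) using bdd by (rule cSup_upper)
    then show "x \<le> c l - (a i l - a i j)" by simp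
  qed
  then show ?thesis by (intro exI[of _ c]) (fastforce simp: algebra_simps)
qed auto

text \<open>A shortest violating cycle has length at least 3. By minimality, all entries in its rows and
  columns that are not on the cycle itself carry one of the two other colours, and conflicts among
  them form an odd cycle up to the equalities \<open>row\<close>.\<close>

lemma no_violating_cycle:
  fixes \<chi> :: "nat \<Rightarrow> nat \<Rightarrow> nat"
  assumes proper: "\<And>i j k l. i < m \<Longrightarrow> j < n \<Longrightarrow> k < m \<Longrightarrow> l < n \<Longrightarrow> conflict a i j k l \<Longrightarrow> \<chi> i j \<noteq> \<chi> k l"
    and three: "\<And>i j. i < m \<Longrightarrow> j < n \<Longrightarrow> \<chi> i j < 3" and t: "t < 3"
    and S: "S = {(i, j). i < m \<and> j < n \<and> \<chi> i j = t}"
  shows "(\<And>p. p \<le> e \<Longrightarrow> (I p, J p) \<in> S) \<Longrightarrow> walk a I J e (J 0) \<le> 0"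
proof (induction e arbitrary: I J rule: less_induct)
  case (less e I0 J0)
  have short: "walk a I J d (J 0) \<le> 0" if "d < e" "\<And>p. p \<le> d \<Longrightarrow> (I p, J p) \<in> S" for I J d
    using less.IH that by blast
  show ?case
  proof (rule ccontr)
    assume viol: "\<not> walk a I0 J0 e (J0 0) \<le> 0"
    \<comment> \<open>The cycle of \<open>k\<close> entries is continued periodically to all
      indices, so that its rotations become shifts.\<close>
    define k where "k = Suc e"
    define I where "I p = I0 (p mod k)" for p
    define J where "J p = J0 (p mod k)" for p
    have per: "I (p + k) = I p" "J (p + k) = J p" for p by (auto simp: I_def J_def)
    have inS: "(I p, J p) \<in> S" for p
      using less.prems[of "p mod k"] by (simp add: I_def J_def k_def less_Suc_eq_le[symmetric])
    have lt: "I p < m" "J p < n" for p using inS[of p] by (auto simp: S)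
    define w where "w p = a (I p) (J (Suc p)) - a (I p) (J p)" for p
    define s where "s p = (\<Sum>x<p. w x)" for p
    define W where "W = s k"
    have W: "W > 0"
    proof -
      have "walk a I0 J0 e (J0 0) = walk a I J e (J 0)"
        by (subst walk_cong[of e I0 I J0 J]) (auto simp: I_def J_def k_def)
      also have "\<dots> = W"
        using per(2)[of 0] by (simp add: walk_def W_def s_def w_def k_def)
      finally show ?thesis using viol by simp
    qed
    have sper: "s (p + k) = s p + W" for p
    proof (induction p)
      case (Suc p)
      have "w (p + k) = w p" using per[of p] per(2)[of "Suc p"] by (simp add: w_def)
      then show ?case using Suc by (simp add: s_def)
    qed (simp add: W_def s_def)
    \<comment> \<open>normalized so that both \<open>(p, p)\<close> and \<open>(p, p + 1)\<close> are 0, at the price of quasi-periodicity\<close>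
    define B where "B p q = a (I p) (J q) - a (I p) (J p) + s p - s q" for p q
    have B0: "B p p = 0" "B p (Suc p) = 0" for p by (auto simp: B_def s_def w_def)
    have Bper: "B (p + k) q = B p q + W" "B p (q + k) = B p q - W" for p q
      by (auto simp: B_def per sper)
    have confB: "conflict a (I p) (J q) (I p') (J q') \<longleftrightarrow> B p q + B p' q' < B p q' + B p' q" for p q p' q'
      by (auto simp: conflict_def B_def)
    have tel: "(\<Sum>p<d. w (q + p)) = s (q + d) - s q" for q d
      by (induction d) (auto simp: s_def)
    \<comment> \<open>\<open>B (q + d) q\<close> is the weight of the closed walk through the
      entries q, ..., q + d only, which is shorter than the violating one.\<close>
    have neg: "B (q + d) q \<le> 0" if "d + 2 \<le> k" for q d
    proof -
      have "walk a (\<lambda>p. I (q + p)) (\<lambda>p. J (q + p)) d (J (q + 0)) \<le> 0"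
        by (rule short) (use that inS in \<open>auto simp: k_def\<close>)
      then show ?thesis using tel[where q = q and d = d] by (simp add: walk_def w_def B_def)
    qed
    \<comment> \<open>An entry (I i, J l) of colour \<open>t\<close> could replace the cycle entries
      l, ..., i. The resulting cycle is shorter and has weight W - B i l, which is positive by
      \<open>neg\<close>.\<close>
    have notS: "\<chi> (I i) (J l) \<noteq> t" if "l < i" "i + 2 \<le> l + k" for i l
    proof
      assume "\<chi> (I i) (J l) = t"
      define d where "d = l + k - i - 1"
      have d: "Suc (i + d) = l + k" "d > 0" using that by (auto simp: d_def)
      define J' where "J' p = (if p = 0 then J l else J (i + p))" for p
      have "walk a (\<lambda>p. I (i + p)) J' d (J' 0) \<le> 0"
      proof (rule short)
        show "d < e" using that by (auto simp: d_def k_def)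
        show "(I (i + p), J' p) \<in> S" if "p \<le> d" for p
          using inS \<open>\<chi> (I i) (J l) = t\<close> lt by (auto simp: J'_def S)
      qed
      moreover have "walk a (\<lambda>p. I (i + p)) J' d (J' 0)
        = (\<Sum>p<d. w (i + p)) + (a (I i) (J i) - a (I i) (J l)) + w (i + d)"
      proof -
        obtain d' where d': "d = Suc d'" using d by (cases d) auto
        have "J (i + Suc d) = J l" using d per(2)[of l] by simp
        then show ?thesis
          unfolding walk_def d' by (simp add: sum.lessThan_Suc_shift w_def J'_def del: sum.lessThan_Suc)
      qed
      ultimately have "s (Suc (i + d)) - s i + (a (I i) (J i) - a (I i) (J l)) \<le> 0"
        using tel[where q = i and d = d] by (simp add: s_def)
      then have "W \<le> B i l" unfolding d(1) sper by (simp add: B_def)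
      moreover have "B i l \<le> 0" using neg[of "i - l" l] that by simp
      ultimately show False using W by simp
    qed
    \<comment> \<open>The two entries of \<open>B\<close> on the larger side of the conflict are the
      zeros of \<open>B0\<close>. On the smaller side, shifting row l by the period shows that one
      entry is at most -W.\<close>
    have F1: "conflict a (I i) (J l) (I l) (J (Suc i))" if "l < i" "i + 2 \<le> l + k" for i l
    proof -
      have "B i l \<le> 0" using neg[of "i - l" l] that by simp
      moreover have "B (l + k) (Suc i) \<le> 0" using neg[of "l + k - Suc i" "Suc i"] that by simp
      ultimately show ?thesis using W by (simp add: confB B0 Bper)
    qed
    have F2: "conflict a (I i) (J l) (I l) (J i)" if "l + 2 \<le> i" "i + 2 \<le> l + k" for i l
    proof -
      have "B i l \<le> 0" using neg[of "i - l" l] that by simp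
      moreover have "B (l + k) i \<le> 0" using neg[of "l + k - i" i] that by simp
      ultimately show ?thesis using W by (simp add: confB B0 Bper)
    qed
    define f where "f p q = \<chi> (I p) (J q)" for p q
    have fper: "f (p + k) q = f p q" "f p (q + k) = f p q" for p q by (simp_all add: f_def per)
    have f3: "f p q < 3" for p q by (simp add: f_def three lt)
    have fconf: "f p q \<noteq> f p' q'" if "conflict a (I p) (J q) (I p') (J q')" for p q p' q'
      unfolding f_def using that by (intro proper lt)
    have fnot: "f i l \<noteq> t" if "l < i" "i + 2 \<le> l + k" for i l
      unfolding f_def using notS that by blast
    consider "k = 1" | "k = 2" | "k \<ge> 3" using k_def by linarith
    then show False
    proof cases
      case 1
      then show False using W per(2)[of 0] by (simp add: W_def s_def w_def)

    next
      case 2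
      have "J 2 = J 0" using per(2)[of 0] 2 by (simp add: numeral_2_eq_2)
      then have "conflict a (I 0) (J 0) (I 1) (J 1)"
        using W by (simp add: W_def s_def w_def conflict_def 2 numeral_2_eq_2)
      then have "f 0 0 \<noteq> f 1 1" by (rule fconf)
      then show False using inS[of 0] inS[of 1] by (auto simp: S f_def)
    next
      case 3
      \<comment> \<open>f i 1 differs from f 1 i and from f 1 (i + 1), by \<open>F2\<close> and
        \<open>F1\<close>. None of the three is t, so with two colours left the last two
        coincide.\<close>
      have row: "f 1 i = f 1 3" if "3 \<le> i" "i \<le> k" for i
        using that
      proof (induction i rule: dec_induct)
        case (step i)
        have "f i 1 \<noteq> f 1 (Suc i)" by (rule fconf, rule F1) (use step in auto)
        moreover have "f i 1 \<noteq> f 1 i" by (rule fconf, rule F2) (use step in auto)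
        moreover have "f i 1 \<noteq> t" using fnot[of 1 i] step by simp
        moreover have "f 1 i \<noteq> t" using fnot[of i "1 + k"] fper(1)[of 1] step by simp
        moreover have "f 1 (Suc i) \<noteq> t" using fnot[of "Suc i" "1 + k"] fper(1)[of 1] step by simp
        ultimately have "f 1 (Suc i) = f 1 i"
          using f3[of i 1] f3[of 1 i] f3[of 1 "Suc i"] t by linarith
        then show ?case using step by simp
      qed simp
      \<comment> \<open>The chain of equalities closes up by periodicity. It makes the colours at
        (1, 0), (0, 2) and (2, 1) pairwise distinct, although only two colours other than t
        exist.\<close>
      have k: "f 1 3 = f 1 0" using row[of k] fper(2)[of 1 0] 3 by simp
      have c1: "f 1 0 \<noteq> f 0 2" using F1[of 0 1] 3 by (auto intro!: fconf simp: numeral_2_eq_2)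
      have c2: "f k 2 \<noteq> f 2 (Suc k)" using F1[of 2 k] 3 by (auto intro!: fconf)
      have c3: "f 2 1 \<noteq> f 1 3" using F1[of 1 2] 3 by (auto intro!: fconf simp: numeral_3_eq_3)
      have e: "f k 2 = f 0 2" "f 2 (Suc k) = f 2 1" using fper(1)[of 0 2] fper(2)[of 2 1] by auto
      have "f 1 0 \<noteq> t" "f k 2 \<noteq> t" "f 2 1 \<noteq> t"
        using fnot[of 0 1] fnot[of 2 k] fnot[of 1 2] 3 by auto
      then show False
        using k c1 c2 c3 e f3[of 1 0] f3[of 0 2] f3[of 2 1] t by simp
    qed
  qed
qed


text \<open>The tropical minimum is split into a lower bound and its attainment, because the
  arguments use the two separately. Functions replace matrices so that transposition just swaps
  arguments.\<close>

definition rank3 :: "(nat \<Rightarrow> nat \<Rightarrow> real) \<Rightarrow> nat \<Rightarrow> nat \<Rightarrow> bool" where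
  "rank3 a m n \<longleftrightarrow> (\<exists>(b :: nat \<Rightarrow> nat \<Rightarrow> real) (c :: nat \<Rightarrow> nat \<Rightarrow> real). \<forall>i<m. \<forall>j<n. (\<forall>t<(3::nat). a i j \<le> b i t + c t j) \<and> (\<exists>t<3. a i j = b i t + c t j))"

text \<open>Each colour yields one term: its column potentials come from the absence of violating
  cycles, and the row values are chosen as small as the lower bound permits. At an entry of that
  colour the maximum defining the row value is attained.\<close>

lemma coloring_imp_rank3:
  fixes \<chi> :: "nat \<Rightarrow> nat \<Rightarrow> nat"
  assumes "n > 0"
    and proper: "\<And>i j k l. i < m \<Longrightarrow> j < n \<Longrightarrow> k < m \<Longrightarrow> l < n \<Longrightarrow> conflict a i j k l \<Longrightarrow> \<chi> i j \<noteq> \<chi> k l"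
    and three: "\<And>i j. i < m \<Longrightarrow> j < n \<Longrightarrow> \<chi> i j < 3"
  shows "rank3 a m n"
proof -
  have "\<exists>c. \<forall>i j l. i < m \<longrightarrow> j < n \<longrightarrow> \<chi> i j = t \<longrightarrow> a i l - c l \<le> a i j - c j" if t: "t < 3" for t
  proof -
    define S where "S = {(i, j). i < m \<and> j < n \<and> \<chi> i j = t}"
    have "finite S" by (rule finite_subset[of _ "{..<m} \<times> {..<n}"]) (auto simp: S_def)
    moreover have "walk a I J e (J 0) \<le> 0" if "\<And>p. p \<le> e \<Longrightarrow> (I p, J p) \<in> S" for I J e
      by (rule no_violating_cycle[OF proper three t S_def that])
    ultimately obtain c where "\<forall>(i, j) \<in> S. \<forall>l. a i l - c l \<le> a i j - c j"
      using potential_exists[of S a] by blast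
    then show ?thesis by (intro exI[of _ c]) (auto simp: S_def)
  qed
  then obtain c where c: "\<And>t i j l. t < 3 \<Longrightarrow> i < m \<Longrightarrow> j < n \<Longrightarrow> \<chi> i j = t \<Longrightarrow> a i l - c t l \<le> a i j - c t j"
    by metis
  define b where "b i t = Max ((\<lambda>l. a i l - c t l) ` {..<n})" for i t
  have up: "a i j \<le> b i t + c t j" if "j < n" for i j t
  proof -
    have "a i j - c t j \<le> b i t" unfolding b_def using that by (intro Max_ge) auto
    then show ?thesis by simp
  qed
  have "b i t + c t j \<le> a i j" if "i < m" "j < n" "t < 3" "\<chi> i j = t" for i j t
  proof -
    have "b i t \<le> a i j - c t j" unfolding b_def
      using \<open>n > 0\<close> that by (intro Max.boundedI) (auto intro!: c)
    then show ?thesis by simp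
  qed
  then have eq: "a i j = b i (\<chi> i j) + c (\<chi> i j) j" if "i < m" "j < n" for i j
    using up[OF that(2), of i] three[OF that] that by (intro order_antisym) auto
  show ?thesis unfolding rank3_def
    by (rule exI[of _ b], rule exI[of _ c]) (use up three eq in blast)
qed

section \<open>Tight factorizations\<close>

text \<open>If row k contains no conflict with (i, j), then a i l - a k l is largest at l = j, and
  (k, j) conflicts with everything (i, j) conflicts with. This is tolerated only when row k is row i
  up to a constant.\<close>

definition row_undominated :: "(nat \<Rightarrow> nat \<Rightarrow> real) \<Rightarrow> nat \<Rightarrow> nat \<Rightarrow> nat \<Rightarrow> nat \<Rightarrow> bool" where
  "row_undominated a m n i j \<longleftrightarrow>
     (\<forall>k<m. (\<exists>l<n. conflict a i j k l) \<or> (\<forall>l<n. a i l - a k l = a i j - a k j))"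

text \<open>\<open>row\<close> and \<open>col\<close> express that no entry of either factor can be
  decreased. Together with \<open>le\<close>, they make b i t the maximum of a i j - c t j over j,
  and symmetrically for c.\<close>

locale tight =
  fixes a :: "nat \<Rightarrow> nat \<Rightarrow> real" and b c :: "nat \<Rightarrow> nat \<Rightarrow> real" and m n :: nat
  assumes m: "m > 0" and n: "n > 0"
    and le: "\<And>i j t. i < m \<Longrightarrow> j < n \<Longrightarrow> t < 3 \<Longrightarrow> a i j \<le> b i t + c t j"
    and ex: "\<And>i j. i < m \<Longrightarrow> j < n \<Longrightarrow> \<exists>t<3. a i j = b i t + c t j"
    and row: "\<And>i t. i < m \<Longrightarrow> t < 3 \<Longrightarrow> \<exists>j<n. a i j = b i t + c t j"
    and col: "\<And>j t. j < n \<Longrightarrow> t < 3 \<Longrightarrow> \<exists>i<m. a i j = b i t + c t j"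
begin

section \<open>Positions of rows and columns in the tropical plane\<close>

definition T :: "nat \<Rightarrow> nat \<Rightarrow> nat \<Rightarrow> bool" where
  "T i j t \<longleftrightarrow> a i j = b i t + c t j"

lemma T_le: "i < m \<Longrightarrow> j < n \<Longrightarrow> t < 3 \<Longrightarrow> b i t + c t j \<le> a i j \<Longrightarrow> T i j t"
  using le[of i j t] by (simp add: T_def)

lemma conflict_T:
  assumes "conflict a i j k l" "i < m" "j < n" "k < m" "l < n" "t < 3" "T i j t"
  shows "\<not> T k l t"
  using assms le[of i l t] le[of k j t] by (auto simp: T_def conflict_def)

text \<open>Equality of points of the tropical plane, whose vectors are taken modulo adding a
  constant to all coordinates.\<close>

definition same_place :: "nat \<Rightarrow> nat \<Rightarrow> bool" where
  "same_place i k \<longleftrightarrow> (\<forall>x<3. \<forall>y<3. b i x - b i y = b k x - b k y)"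

text \<open>Tightness determines each b i t as a maximum over row i, so rows of \<open>a\<close>
  that differ by a constant have the same position.\<close>

lemma row_undominatedD:
  assumes "row_undominated a m n i j" "i < m" "j < n" "k < m"
  shows "(\<exists>l<n. conflict a i j k l) \<or> same_place i k"
proof (cases "\<exists>l<n. conflict a i j k l")
  case False
  then have eq: "a i l - a k l = a i j - a k j" if "l < n" for l
    using assms that unfolding row_undominated_def by blast
  have "b i t = b k t + (a i j - a k j)" if t: "t < 3" for t
  proof -
    obtain l where "l < n" "T i l t" using row[OF \<open>i < m\<close> t] by (auto simp: T_def)
    moreover obtain l' where "l' < n" "T k l' t" using row[OF \<open>k < m\<close> t] by (auto simp: T_def)
    ultimately show ?thesis
      using le[of k l t] le[of i l' t] eq[of l] eq[of l'] assms t by (auto simp: T_def)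
  qed
  then show ?thesis by (auto simp: same_place_def)
qed simp

text \<open>The conflicting entry (u, l) cannot be attained by s, and \<open>lacks\<close> lets t be
  exchanged for p there. Evaluating the conflict inequality with terms s and p cancels all column
  values and leaves a strict comparison of rows u and i.\<close>

lemma level:
  assumes "row_undominated a m n i j" "i < m" "j < n" "u < m"
    and spt: "{s, p, t} = {..<3::nat}"
    and T: "\<And>x. x < 3 \<Longrightarrow> T i j x \<Longrightarrow> x = s"
    and lacks: "\<And>l. l < n \<Longrightarrow> T u l t \<Longrightarrow> T u l p \<or> T u l s"
  shows "b u p - b u s < b i p - b i s \<or> same_place i u"
proof (cases "same_place i u")
  case False
  then obtain l where l: "l < n" "conflict a i j u l" using row_undominatedD[OF assms(1-4)] by blast
  have lt: "s < 3" "p < 3" "t < 3" using spt by auto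
  have s: "T i j s" using ex[of i j] T assms(2,3) by (auto simp: T_def)
  then have ns: "\<not> T u l s" using conflict_T[OF l(2) assms(2-4) l(1) lt(1)] by simp
  obtain x where "x < 3" "T u l x" using ex[OF assms(4) l(1)] by (auto simp: T_def)
  moreover have "x = s \<or> x = p \<or> x = t" using \<open>x < 3\<close> spt by auto
  ultimately have "T u l p" using lacks[of l] ns l by auto
  then have "b u p - b u s < b i p - b i s"
    using l(2) le[OF assms(2) l(1) lt(2)] le[OF assms(4,3) lt(1)] s by (simp add: T_def conflict_def)
  then show ?thesis ..
qed simp

text \<open>View rows and columns as points of the tropical plane: on each of the six sides of their common
  bounding hexagon there are both a row and a column.\<close>

lemma side:
  assumes "s < 3" "t < 3"
  obtains u v where "u < m" "v < n" "\<And>i. i < m \<Longrightarrow> b i t - b i s \<le> b u t - b u s"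
    "T u v s" "T u v t"
    "\<And>l. l < n \<Longrightarrow> T u l t \<Longrightarrow> T u l s" "\<And>k. k < m \<Longrightarrow> T k v s \<Longrightarrow> T k v t"
proof -
  let ?D = "(\<lambda>i. b i t - b i s) ` {..<m}"
  have "Max ?D \<in> ?D" using m by (intro Max_in) auto
  then obtain u where u: "u < m" "Max ?D = b u t - b u s" by auto
  have umax: "b i t - b i s \<le> b u t - b u s" if "i < m" for i
    using Max_ge[of ?D "b i t - b i s"] that u by auto
  obtain v where v: "v < n" "T u v t" using row[of u t] u assms by (auto simp: T_def)
  \<comment> \<open>By \<open>col\<close>, column j attains s in some row i; row i is not beyond the
    extreme row u, hence neither is column j.\<close>
  have cmax: "c s j - c t j \<le> b u t - b u s" if j: "j < n" for j
  proof -
    obtain i where "i < m" "T i j s" using col[of j s] j assms by (auto simp: T_def)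
    then show ?thesis using le[of i j t] umax[of i] j assms by (auto simp: T_def)
  qed
  have veq: "c s v - c t v = b u t - b u s"
    using cmax[of v] v le[of u v s] u assms by (auto simp: T_def)
  show ?thesis
  proof
    show "T u v s" using v veq by (simp add: T_def)
    show "T u l s" if "l < n" "T u l t" for l
      using that cmax[of l] u assms by (intro T_le) (auto simp: T_def)
    show "T k v t" if "k < m" "T k v s" for k
      using that umax[of k] veq v assms by (intro T_le) (auto simp: T_def)
  qed (use u v umax in auto)
qed

text \<open>Two sides of the hexagon consist of rows that can avoid colour \<open>t\<close>. If row \<open>i\<close> is at the position of
  both, then the corner between these sides is occupied by a column of constant colour \<open>t\<close>.\<close>

lemma row_lacking_color:
  assumes corner: "\<not> (\<exists>j<n. \<forall>i<m. T i j t)" and i: "i < m" and spt: "{s, p, t} = {..<3}"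
  obtains u where "u < m" "\<not> same_place i u" "\<And>l. l < n \<Longrightarrow> T u l t \<Longrightarrow> T u l p \<or> T u l s"
proof -
  have lt: "s < 3" "p < 3" "t < 3" using spt by auto
  obtain u v where u: "u < m" "\<And>i. i < m \<Longrightarrow> b i t - b i s \<le> b u t - b u s"
    "\<And>l. l < n \<Longrightarrow> T u l t \<Longrightarrow> T u l s" using side[of s t] lt by metis
  obtain u' v' where u': "u' < m" "\<And>i. i < m \<Longrightarrow> b i t - b i p \<le> b u' t - b u' p"
    "\<And>l. l < n \<Longrightarrow> T u' l t \<Longrightarrow> T u' l p" using side[of p t] lt by metis
  have "\<not> (same_place i u \<and> same_place i u')"
  proof
    assume same: "same_place i u \<and> same_place i u'"
    obtain j where j: "j < n" "T i j t" using row[of i t] i lt by (auto simp: T_def)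
    \<comment> \<open>Row i maximizes both b t - b s and b t - b p and attains t in column j. So
      whichever term attains (k, j), term t is no larger there.\<close>
    have "T k j t" if k: "k < m" for k
    proof -
      obtain x where x: "x < 3" "T k j x" using ex[of k j] k j by (auto simp: T_def)
      then have "x = s \<or> x = p \<or> x = t" using spt by auto
      then show ?thesis
      proof (elim disjE)
        assume "x = s"
        moreover have "b k t - b k s \<le> b i t - b i s"
          using same lt u(2)[OF k] by (auto simp: same_place_def)
        ultimately show ?thesis using x j le[of i j s] i k lt by (intro T_le) (auto simp: T_def)
      next
        assume "x = p"
        moreover have "b k t - b k p \<le> b i t - b i p"
          using same lt u'(2)[OF k] by (auto simp: same_place_def)
        ultimately show ?thesis using x j le[of i j p] i k lt by (intro T_le) (auto simp: T_def)
      qed (use x in simp)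
    qed
    then show False using corner j by blast
  qed
  then show ?thesis using that u u' by blast
qed

text \<open>If x and y both attained (i, j), any entry in conflict with it would be attained by the
  third term only. A row at another position that never attains the third term alone contains no
  such entry, yet undominatedness demands one.\<close>

lemma unique_color:
  assumes corner: "\<And>t. t < 3 \<Longrightarrow> \<not> (\<exists>j<n. \<forall>i<m. T i j t)"
    and und: "row_undominated a m n i j" and ij: "i < m" "j < n"
    and xy: "x < 3" "y < 3" "T i j x" "T i j y"
  shows "x = y"
proof (rule ccontr)
  assume "x \<noteq> y"
  then have "{x, y, 3 - x - y} = {..<3}" using xy(1,2) by (auto simp: less_Suc_eq numeral_3_eq_3)
  then obtain t where spt: "{x, y, t} = {..<3}" by blast
  then have t: "t < 3" by auto
  obtain u where u: "u < m" "\<not> same_place i u" "\<And>l. l < n \<Longrightarrow> T u l t \<Longrightarrow> T u l y \<or> T u l x"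
    using row_lacking_color[OF corner[OF t] ij(1) spt] by metis
  then obtain l where l: "l < n" "conflict a i j u l" using row_undominatedD[OF und ij] by blast
  then have "\<not> T u l x" "\<not> T u l y" using conflict_T ij xy u by blast+
  moreover obtain z where z: "z < 3" "T u l z" using ex[of u l] u l by (auto simp: T_def)
  moreover have "z = x \<or> z = y \<or> z = t" using z(1) spt by auto
  ultimately show False using u(3)[OF l(1)] by auto
qed

lemma tight_transposed: "tight (\<lambda>j i. a i j) (\<lambda>j t. c t j) (\<lambda>t i. b i t) n m"
  by unfold_locales (use m n le ex row col in \<open>simp_all add: add.commute\<close>)

text \<open>The side where b p - b s is maximal supplies a row u and a column v meeting in an entry
  attained by both s and p. \<open>level\<close> compares u with i and v with l in coordinate t. If
  t alone attained (i, l), row i would lie beyond that side.\<close>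

lemma not_third_color:
  assumes row: "row_undominated a m n i j" "i < m" "j < n" "\<And>x. x < 3 \<Longrightarrow> T i j x \<Longrightarrow> x = s"
    and col: "row_undominated (\<lambda>j i. a i j) n m l k" "k < m" "l < n" "\<And>x. x < 3 \<Longrightarrow> T k l x \<Longrightarrow> x = p"
    and spt: "{s, p, t} = {..<3}"
  shows "T i l s \<or> T i l p"
proof (rule ccontr)
  interpret tr: tight "\<lambda>j i. a i j" "\<lambda>j t. c t j" "\<lambda>t i. b i t" n m by (rule tight_transposed)
  have tr_T [simp]: "tr.T j i t \<longleftrightarrow> T i j t" for i j t
    by (simp add: T_def tr.T_def add.commute)
  assume neg: "\<not> (T i l s \<or> T i l p)"
  have lt: "s < 3" "p < 3" "t < 3" using spt by auto
  obtain x where x: "x < 3" "T i l x" using ex[of i l] row col by (auto simp: T_def)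
  then have "x = s \<or> x = p \<or> x = t" using spt by auto
  then have "T i l t" using neg x by auto
  then have neg': "b i t + c t l < b i s + c s l" "b i t + c t l < b i p + c p l"
    using neg le[of i l s] le[of i l p] row(2) col(3) lt by (auto simp: T_def)
  obtain u v where uv: "u < m" "v < n" "\<And>i. i < m \<Longrightarrow> b i p - b i s \<le> b u p - b u s"
    "T u v s" "T u v p"
    "\<And>l. l < n \<Longrightarrow> T u l p \<Longrightarrow> T u l s" "\<And>k. k < m \<Longrightarrow> T k v s \<Longrightarrow> T k v p"
    using side[of s p] lt by metis
  \<comment> \<open>Terms p and t have exchanged roles in \<open>level\<close>, because row u can
    always replace p by s.\<close>
  have "b u t - b u s < b i t - b i s \<or> same_place i u"
    by (rule level[OF row(1-3) uv(1), of s t p]) (use spt row(4) uv(6) in auto)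
  then have 1: "b u t - b u s \<le> b i t - b i s" using lt by (auto simp: same_place_def)
  have "c t v - c p v < c t l - c p l \<or> tr.same_place l v"
    by (rule tr.level[OF col(1,3,2) uv(2), of p t s]) (use spt col(4) uv(7) in auto)
  then have 2: "c t v - c p v \<le> c t l - c p l" using lt by (auto simp: tr.same_place_def)
  show False
    using neg' 1 2 uv(3)[OF row(2)] uv(4,5) le[of u v t] uv(1,2) lt by (auto simp: T_def)
qed

text \<open>A row that can do without the third term t serves as a pivot: \<open>level\<close> at
  (i, j) and at (k, l) places it between rows i and k in the direction of p and s. Columns are
  ordered the same way, and \<open>not_third_color\<close> evaluates the two mixed entries by s or
  p.\<close>

lemma distinct_color_conflict:
  assumes corner: "\<And>t. t < 3 \<Longrightarrow> \<not> (\<exists>j<n. \<forall>i<m. T i j t)" "\<And>t. t < 3 \<Longrightarrow> \<not> (\<exists>i<m. \<forall>j<n. T i j t)"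
    and ij: "row_undominated a m n i j" "row_undominated (\<lambda>j i. a i j) n m j i" "i < m" "j < n"
    and kl: "row_undominated a m n k l" "row_undominated (\<lambda>j i. a i j) n m l k" "k < m" "l < n"
    and sp: "s < 3" "p < 3" "T i j s" "T k l p" "s \<noteq> p"
  shows "conflict a i j k l"
proof -
  interpret tr: tight "\<lambda>j i. a i j" "\<lambda>j t. c t j" "\<lambda>t i. b i t" n m by (rule tight_transposed)
  have tr_T [simp]: "tr.T j i t \<longleftrightarrow> T i j t" for i j t
    by (simp add: T_def tr.T_def add.commute)
  have "{s, p, 3 - s - p} = {..<3}" using sp(1,2,5) by (auto simp: less_Suc_eq numeral_3_eq_3)
  then obtain t where spt: "{s, p, t} = {..<3}" by blast
  then have pst: "{p, s, t} = {..<3}" by (simp add: insert_commute)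
  have t: "t < 3" using spt by auto
  have Ti: "\<And>x. x < 3 \<Longrightarrow> T i j x \<Longrightarrow> x = s" using unique_color[OF corner(1) ij(1,3,4)] sp by blast
  have Tk: "\<And>x. x < 3 \<Longrightarrow> T k l x \<Longrightarrow> x = p" using unique_color[OF corner(1) kl(1,3,4)] sp by blast
  obtain u where u: "u < m" "\<not> same_place i u" "\<And>l. l < n \<Longrightarrow> T u l t \<Longrightarrow> T u l p \<or> T u l s"
    using row_lacking_color[OF corner(1)[OF t] ij(3) spt] by metis
  have "b u p - b u s < b i p - b i s"
    using level[OF ij(1,3,4) u(1) spt Ti] u by blast
  moreover have "b u s - b u p < b k s - b k p \<or> same_place k u"
    using level[OF kl(1,3,4) u(1) pst Tk] u by blast
  ultimately have d: "b k p - b k s < b i p - b i s" using sp by (auto simp: same_place_def)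
  obtain v where v: "v < n" "\<not> tr.same_place j v" "\<And>k. k < m \<Longrightarrow> T k v t \<Longrightarrow> T k v p \<or> T k v s"
    using tr.row_lacking_color[OF _ ij(4) spt] corner(2)[OF t] by (metis tr_T)
  have "c p v - c s v < c p j - c s j"
    using tr.level[OF ij(2,4,3) v(1) spt] Ti v by auto
  moreover have "c s v - c p v < c s l - c p l \<or> tr.same_place l v"
    using tr.level[OF kl(2,4,3) v(1) pst] Tk v by auto
  ultimately have e: "c p l - c s l < c p j - c s j" using sp by (auto simp: tr.same_place_def)
  have "T i l s \<or> T i l p" using not_third_color[OF ij(1,3,4) Ti kl(2-4) Tk spt] .
  moreover have "T k j p \<or> T k j s" using not_third_color[OF kl(1,3,4) Tk ij(2-4) Ti pst] .
  moreover have "a i j < b i p + c p j" "a k l < b k s + c s l"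
    using le[OF ij(3,4) sp(2)] le[OF kl(3,4) sp(1)] Ti[OF sp(2)] Tk[OF sp(1)] sp(5)
    by (auto simp: T_def less_le)
  \<comment> \<open>If the mixed entries are attained by different terms, the order \<open>e\<close>
    of columns or \<open>d\<close> of rows gives the strict inequality. If they share a term, one of
    the two strict bounds just obtained does.\<close>
  ultimately show ?thesis
    using d e sp(3,4) unfolding conflict_def T_def by (elim disjE; linarith)
qed

end

text \<open>Lower b as far as \<open>c0\<close> permits, then c as far as the new b permits. One
  round suffices: where a sum with \<open>c0\<close> equals the entry of \<open>a\<close>, lowering
  c cannot break the equality because the sum stays above \<open>a\<close>.\<close>

lemma rank3_tight:
  assumes "rank3 a m n" "m > 0" "n > 0"
  shows "\<exists>b c. tight a b c m n"
proof -
  obtain b0 c0 :: "nat \<Rightarrow> nat \<Rightarrow> real" where bc0: "\<And>i j t. i < m \<Longrightarrow> j < n \<Longrightarrow> t < 3 \<Longrightarrow> a i j \<le> b0 i t + c0 t j"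
    "\<And>i j. i < m \<Longrightarrow> j < n \<Longrightarrow> \<exists>t<3. a i j = b0 i t + c0 t j"
    using assms(1) unfolding rank3_def by blast
  define b where "b i t = Max ((\<lambda>j. a i j - c0 t j) ` {..<n})" for i t
  define c where "c t j = Max ((\<lambda>i. a i j - b i t) ` {..<m})" for t j
  have b_ge: "a i j \<le> b i t + c0 t j" if "j < n" for i j t
  proof -
    have "a i j - c0 t j \<le> b i t" unfolding b_def using that by (intro Max_ge) auto
    then show ?thesis by simp
  qed
  have c_ge: "a i j \<le> b i t + c t j" if "i < m" for i j t
  proof -
    have "a i j - b i t \<le> c t j" unfolding c_def using that by (intro Max_ge) auto
    then show ?thesis by simp
  qed
  have b_le: "b i t \<le> b0 i t" if "i < m" "t < 3" for i t
    unfolding b_def using bc0(1)[OF that(1) _ that(2)] assms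
    by (intro Max.boundedI) (auto simp: algebra_simps)
  have c_le: "c t j \<le> c0 t j" if "j < n" for t j
    unfolding c_def using b_ge[OF that] assms by (intro Max.boundedI) (auto simp: algebra_simps)
  have b_ex: "\<exists>j<n. a i j = b i t + c0 t j" for i t
  proof -
    have "b i t \<in> (\<lambda>j. a i j - c0 t j) ` {..<n}" unfolding b_def using assms by (intro Max_in) auto
    then show ?thesis by fastforce
  qed
  have c_ex: "\<exists>i<m. a i j = b i t + c t j" for j t
  proof -
    have "c t j \<in> (\<lambda>i. a i j - b i t) ` {..<m}" unfolding c_def using assms by (intro Max_in) auto
    then show ?thesis by fastforce
  qed
  have "tight a b c m n"
  proof
    fix i j assume ij: "i < m" "j < n"
    obtain t where t: "t < 3" "a i j = b0 i t + c0 t j" using bc0(2)[OF ij] by blast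
    then have "a i j = b i t + c t j" using b_le[OF ij(1) t(1)] c_le[OF ij(2), of t] c_ge[OF ij(1), of j t] by simp
    with t show "\<exists>t<3. a i j = b i t + c t j" by blast
  next
    fix i t assume it: "i < m" "t < (3::nat)"
    obtain j where j: "j < n" "a i j = b i t + c0 t j" using b_ex by blast
    then have "a i j = b i t + c t j" using c_le[OF j(1), of t] c_ge[OF it(1), of j t] by simp
    with j show "\<exists>j<n. a i j = b i t + c t j" by blast
  qed (use assms c_ge c_ex in auto)
  then show ?thesis by blast
qed

section \<open>The conflict graph\<close>

definition maximal_nbhd :: "nat \<Rightarrow> (nat \<Rightarrow> nat \<Rightarrow> bool) \<Rightarrow> nat \<Rightarrow> bool" where
  "maximal_nbhd N adj v \<longleftrightarrow>
     \<not> (\<exists>w<N. (\<forall>x<N. adj v x \<longrightarrow> adj w x) \<and> (\<exists>x<N. adj w x \<and> \<not> adj v x))"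

definition colorable3 :: "nat \<Rightarrow> (nat \<Rightarrow> nat \<Rightarrow> bool) \<Rightarrow> (nat \<Rightarrow> bool) \<Rightarrow> bool" where
  "colorable3 N adj U \<longleftrightarrow> (\<exists>\<kappa> :: nat \<Rightarrow> nat. \<forall>v<N. U v \<longrightarrow>
     \<kappa> v < 3 \<and> (\<forall>w<N. U w \<longrightarrow> adj v w \<longrightarrow> \<kappa> v \<noteq> \<kappa> w))"

definition far :: "nat \<Rightarrow> (nat \<Rightarrow> nat \<Rightarrow> bool) \<Rightarrow> (nat \<Rightarrow> bool) \<Rightarrow> nat \<Rightarrow> bool" where
  "far N adj L w \<longleftrightarrow> (\<forall>x<N. L x \<longrightarrow> \<not> adj w x)"

text \<open>The first colour class is guessed through a set \<open>L\<close> of vertices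
  all of which, for a right guess, belong to it.\<close>

definition splits :: "nat \<Rightarrow> (nat \<Rightarrow> nat \<Rightarrow> bool) \<Rightarrow> (nat \<Rightarrow> bool) \<Rightarrow> (nat \<Rightarrow> bool) \<Rightarrow> bool" where
  "splits N adj U L \<longleftrightarrow>
     (\<forall>v<N. \<forall>w<N. U v \<and> far N adj L v \<and> U w \<and> far N adj L w \<longrightarrow> \<not> adj v w) \<and>
     (\<exists>\<chi> :: nat \<Rightarrow> bool. \<forall>v<N. \<forall>w<N.
        U v \<and> \<not> far N adj L v \<and> U w \<and> \<not> far N adj L w \<and> adj v w \<longrightarrow> \<chi> v \<noteq> \<chi> w)"

text \<open>Each passage to a strictly larger neighbourhood decreases the number of
  non-neighbours.\<close>

lemma ex_maximal_nbhd:
  assumes "v < N"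
  shows "\<exists>w<N. maximal_nbhd N adj w \<and> (\<forall>x<N. adj v x \<longrightarrow> adj w x)"
  using assms
proof (induction "card {x. x < N \<and> \<not> adj v x}" arbitrary: v rule: less_induct)
  case less
  show ?case
  proof (cases "maximal_nbhd N adj v")
    case False
    then obtain w where w: "w < N" "\<forall>x<N. adj v x \<longrightarrow> adj w x" "\<exists>x<N. adj w x \<and> \<not> adj v x"
      unfolding maximal_nbhd_def by blast
    then have "card {x. x < N \<and> \<not> adj w x} < card {x. x < N \<and> \<not> adj v x}"
      by (intro psubset_card_mono) auto
    then show ?thesis using less.hyps[of w] w by blast
  qed (use less.prems in blast)
qed

text \<open>The numbering is kept abstract so that transposing the matrix only swaps
  \<open>r\<close> and \<open>c\<close>: the vertex numbers, and with them the graph, stay the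
  same.\<close>

locale indexed_matrix =
  fixes a :: "nat \<Rightarrow> nat \<Rightarrow> real" and m n N :: nat and r c :: "nat \<Rightarrow> nat"
  assumes mn: "m > 0" "n > 0"
    and rc: "\<And>v. v < N \<Longrightarrow> r v < m \<and> c v < n"
    and index: "\<And>i j. i < m \<Longrightarrow> j < n \<Longrightarrow> \<exists>v<N. r v = i \<and> c v = j"
begin

section \<open>Colourings of the conflict graph versus factorizations\<close>

definition adj :: "nat \<Rightarrow> nat \<Rightarrow> bool" where
  "adj v w \<longleftrightarrow> conflict a (r v) (c v) (r w) (c w)"

lemma adj_sym: "adj v w \<longleftrightarrow> adj w v"
  unfolding adj_def by (rule conflict_sym)

lemma colorable3_imp_rank3:
  assumes "colorable3 N adj (maximal_nbhd N adj)"
  shows "rank3 a m n"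
proof -
  obtain \<kappa> :: "nat \<Rightarrow> nat" where \<kappa>: "\<And>v. v < N \<Longrightarrow> maximal_nbhd N adj v \<Longrightarrow> \<kappa> v < 3"
    "\<And>v w. v < N \<Longrightarrow> w < N \<Longrightarrow> maximal_nbhd N adj v \<Longrightarrow> maximal_nbhd N adj w \<Longrightarrow> adj v w \<Longrightarrow> \<kappa> v \<noteq> \<kappa> w"
    using assms unfolding colorable3_def by blast
  define top where "top v = (SOME w. w < N \<and> maximal_nbhd N adj w \<and> (\<forall>x<N. adj v x \<longrightarrow> adj w x))" for v
  have top: "top v < N \<and> maximal_nbhd N adj (top v) \<and> (\<forall>x<N. adj v x \<longrightarrow> adj (top v) x)" if "v < N" for v
    unfolding top_def by (rule someI_ex) (use ex_maximal_nbhd[OF that] in blast)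
  define idx where "idx i j = (SOME v. v < N \<and> r v = i \<and> c v = j)" for i j
  have idx: "idx i j < N \<and> r (idx i j) = i \<and> c (idx i j) = j" if "i < m" "j < n" for i j
    unfolding idx_def by (rule someI_ex) (use index[OF that] in blast)
  show ?thesis
  proof (rule coloring_imp_rank3)
    fix i j k l assume ijkl: "i < m" "j < n" "k < m" "l < n" and "conflict a i j k l"
    then have "adj (idx i j) (idx k l)" by (simp add: adj_def idx)
    \<comment> \<open>Neighbourhood inclusion is used at one end of the edge and then, by symmetry,
      at the other.\<close>
    then have "adj (top (idx i j)) (top (idx k l))"
      using top idx ijkl adj_sym by meson
    then show "\<kappa> (top (idx i j)) \<noteq> \<kappa> (top (idx k l))"
      using \<kappa>(2) top idx ijkl by blast
  next
    fix i j assume "i < m" "j < n"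
    then show "\<kappa> (top (idx i j)) < 3" using \<kappa>(1) top idx by blast
  qed (rule mn)
qed

text \<open>Suppose row k has no conflict with v and is no shift of row \<open>r v\<close>. At a
  column l where the difference of the rows drops, the entry (r v, l) conflicts with (k, c v) but
  not with v, which lies in its own row. So (k, c v) has a strictly larger neighbourhood.\<close>

lemma maximal_nbhd_row_undominated:
  assumes max: "maximal_nbhd N adj v" and v: "v < N"
  shows "row_undominated a m n (r v) (c v)"
  unfolding row_undominated_def
proof (intro allI impI, rule ccontr)
  fix k assume k: "k < m"
    and neg: "\<not> ((\<exists>l<n. conflict a (r v) (c v) k l) \<or> (\<forall>l<n. a (r v) l - a k l = a (r v) (c v) - a k (c v)))"
  then obtain l where l: "l < n" "a (r v) l - a k l \<noteq> a (r v) (c v) - a k (c v)" by blast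
  have dom: "a (r v) l - a k l \<le> a (r v) (c v) - a k (c v)" if "l < n" for l
    using neg that by (force simp: conflict_def)
  obtain w where w: "w < N" "r w = k" "c w = c v" using index k rc[OF v] by blast
  obtain x where x: "x < N" "r x = r v" "c x = l" using index l rc[OF v] by blast
  have "adj w y" if "y < N" "adj v y" for y
    using dom[of "c y"] rc[OF that(1)] that(2) w by (simp add: adj_def conflict_def)
  moreover have "adj w x" using dom[OF l(1)] l(2) w x by (simp add: adj_def conflict_def)
  moreover have "\<not> adj v x" using x by (simp add: adj_def conflict_def)
  ultimately show False using max w x unfolding maximal_nbhd_def by blast
qed

lemma indexed_transposed: "indexed_matrix n m N c r"
  using mn rc index by unfold_locales (auto, metis)

lemma maximal_nbhd_col_undominated:
  assumes "maximal_nbhd N adj v" "v < N"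
  shows "row_undominated (\<lambda>j i. a i j) n m (c v) (r v)"
proof -
  interpret tr: indexed_matrix "\<lambda>j i. a i j" n m N c r by (rule indexed_transposed)
  have "tr.adj = adj" by (intro ext) (simp add: adj_def tr.adj_def conflict_def add.commute)
  then show ?thesis using tr.maximal_nbhd_row_undominated assms by simp
qed

text \<open>An entry (k, l) far from column j maximizes a i l - a i j over all rows i; adding this
  for two far entries rules out a conflict between them. Entries attained by t are far, since column
  j is attained by t throughout, so the other two terms two-colour the rest.\<close>

lemma splits_if_const_color_col:
  assumes "tight a b cc m n" and t: "t < 3" and j: "j < n" and const: "\<And>i. i < m \<Longrightarrow> tight.T a b cc i j t"
  shows "\<exists>e<N. splits N adj U (\<lambda>x. c x = c e)"
proof -
  interpret tight a b cc m n by fact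
  obtain e where e: "e < N" "c e = j" using index[OF m j] by blast
  have far: "a k l - a k j \<ge> a i l - a i j"
    if v: "far N adj (\<lambda>x. c x = c e) v" "i < m" "r v = k" "c v = l" for v i k l
  proof -
    obtain x where x: "x < N" "r x = i" "c x = j" using index[OF v(2) j] by blast
    then have "\<not> adj v x" using v e by (auto simp: far_def)
    then show ?thesis using x v by (auto simp: adj_def conflict_def)
  qed
  have far_if: "far N adj (\<lambda>x. c x = c e) v" if "v < N" "T (r v) (c v) t" for v
    unfolding far_def
  proof (intro allI impI)
    fix x assume "x < N" "c x = c e"
    then show "\<not> adj v x"
      using conflict_T[of "r v" "c v" "r x" "c x" t] that rc e t const[of "r x"] by (auto simp: adj_def)
  qed
  define \<chi> where "\<chi> v \<longleftrightarrow> T (r v) (c v) (if t = 0 then 1 else 0)" for v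
  have "\<chi> v \<noteq> \<chi> w"
    if vw: "v < N" "w < N" "\<not> far N adj (\<lambda>x. c x = c e) v" "\<not> far N adj (\<lambda>x. c x = c e) w" "adj v w" for v w
  proof
    assume eq: "\<chi> v = \<chi> w"
    have nt: "\<not> T (r v) (c v) t" "\<not> T (r w) (c w) t" using far_if vw by blast+
    define p where "p = (if t = 0 then 1 else 0 :: nat)"
    define q where "q = 3 - p - t"
    have pq: "p < 3" "q < 3" "\<And>x. x < 3 \<Longrightarrow> x = t \<or> x = p \<or> x = q"
      using t by (auto simp: p_def q_def)
    have "T (r v) (c v) p \<or> T (r v) (c v) q" "T (r w) (c w) p \<or> T (r w) (c w) q"
      using ex[of "r v" "c v"] ex[of "r w" "c w"] nt pq(3) rc vw by (fastforce simp: T_def)+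
    moreover have "\<not> (T (r v) (c v) x \<and> T (r w) (c w) x)" if "x < 3" for x
      using conflict_T[of "r v" "c v" "r w" "c w" x] that vw rc by (auto simp: adj_def)
    ultimately show False using eq pq unfolding \<chi>_def p_def[symmetric] by blast
  qed
  moreover have "\<not> adj v w"
    if vw: "v < N" "w < N" "far N adj (\<lambda>x. c x = c e) v" "far N adj (\<lambda>x. c x = c e) w" for v w
    using far[OF vw(3) _ refl refl, of "r w"] far[OF vw(4) _ refl refl, of "r v"] rc[OF vw(1)] rc[OF vw(2)]
    by (simp add: adj_def conflict_def)
  ultimately show ?thesis unfolding splits_def using e by blast
qed

lemma rank3_imp_splits:
  assumes "rank3 a m n"
  shows "\<exists>e<N. splits N adj (maximal_nbhd N adj) (\<lambda>x. c x = c e) \<or>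
    splits N adj (maximal_nbhd N adj) (\<lambda>x. r x = r e) \<or> splits N adj (maximal_nbhd N adj) (\<lambda>x. x = e)"
proof -
  obtain b cc where tight: "tight a b cc m n" using rank3_tight assms mn by blast
  interpret tight a b cc m n by fact
  interpret tr: indexed_matrix "\<lambda>j i. a i j" n m N c r by (rule indexed_transposed)
  have tr_adj: "tr.adj = adj" by (intro ext) (simp add: adj_def tr.adj_def conflict_def add.commute)
  consider t j where "t < 3" "j < n" "\<forall>i<m. T i j t" | t i where "t < 3" "i < m" "\<forall>j<n. T i j t"
    | "\<And>t. t < 3 \<Longrightarrow> \<not> (\<exists>j<n. \<forall>i<m. T i j t)" "\<And>t. t < 3 \<Longrightarrow> \<not> (\<exists>i<m. \<forall>j<n. T i j t)"
    by blast
  then show ?thesis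
  proof cases
    case 1
    then show ?thesis using splits_if_const_color_col[OF tight] by blast
  next
    case 2
    interpret tt: tight "\<lambda>j i. a i j" "\<lambda>j t. cc t j" "\<lambda>t i. b i t" n m by (rule tight.tight_transposed[OF tight])
    have "tt.T j i t = T i j t" for i j t by (simp add: T_def tt.T_def add.commute)
    then show ?thesis
      using tr.splits_if_const_color_col[OF tt.tight_axioms 2(1,2)] 2(3) unfolding tr_adj by blast
  next
    case 3
    let ?U = "maximal_nbhd N adj"
    have conflict: "adj v w" if "v < N" "w < N" "?U v" "?U w" "s < 3" "p < 3"
      "T (r v) (c v) s" "T (r w) (c w) p" "s \<noteq> p" for v w s p
      unfolding adj_def
      by (rule distinct_color_conflict[OF 3 maximal_nbhd_row_undominated[OF that(3,1)]
            maximal_nbhd_col_undominated[OF that(3,1)] _ _ maximal_nbhd_row_undominated[OF that(4,2)]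
            maximal_nbhd_col_undominated[OF that(4,2)]])
        (use that rc in auto)
    have noconf: "\<not> adj v w" if "v < N" "w < N" "s < 3" "T (r v) (c v) s" "T (r w) (c w) s" for v w s
      using conflict_T[of "r v" "c v" "r w" "c w" s] that rc by (auto simp: adj_def)
    have "\<forall>v. \<exists>t. v < N \<longrightarrow> t < 3 \<and> T (r v) (c v) t" using ex rc unfolding T_def by blast
    then obtain k where k: "\<And>v. v < N \<Longrightarrow> k v < 3" "\<And>v. v < N \<Longrightarrow> T (r v) (c v) (k v)"
      by metis
    have adj_iff: "adj v w \<longleftrightarrow> k v \<noteq> k w" if "v < N" "w < N" "?U v" "?U w" for v w
      using conflict[of v w "k v" "k w"] noconf[of v w "k v"] k that by metis
    have "\<exists>v<N. True" using index[OF m n] by blast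
    then obtain e where e: "e < N" "?U e" using ex_maximal_nbhd[of _ N adj] by blast
    have far_iff: "far N adj (\<lambda>x. x = e) v \<longleftrightarrow> k v = k e" if "v < N" "?U v" for v
      using adj_iff[of v e] that e by (auto simp: far_def)
    \<comment> \<open>\<open>p\<close> is some colour different from that of \<open>e\<close>; among
      the two colours left, being equal to \<open>p\<close> is a two-colouring.\<close>
    define p where "p = (if k e = 0 then 1 else 0 :: nat)"
    have part: "(k v = p) \<noteq> (k w = p)"
      if "v < N" "w < N" "?U v" "?U w" "k v \<noteq> k e" "k w \<noteq> k e" "k v \<noteq> k w" for v w
      using k(1)[OF that(1)] k(1)[OF that(2)] k(1)[OF e(1)] that(5-7) unfolding p_def
      by (simp split: if_split) linarith
    have bip: "\<forall>v<N. \<forall>w<N. ?U v \<and> \<not> far N adj (\<lambda>x. x = e) v \<and> ?U w \<and> \<not> far N adj (\<lambda>x. x = e) w \<and> adj v w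
        \<longrightarrow> (k v = p) \<noteq> (k w = p)"
    proof (intro allI impI, elim conjE)
      fix v w assume vw: "v < N" "w < N" "?U v" "?U w" "adj v w"
        "\<not> far N adj (\<lambda>x. x = e) v" "\<not> far N adj (\<lambda>x. x = e) w"
      then show "(k v = p) \<noteq> (k w = p)"
        using part[OF vw(1-4)] adj_iff[OF vw(1-4)] far_iff[OF vw(1,3)] far_iff[OF vw(2,4)] by simp
    qed
    have "\<forall>v<N. \<forall>w<N. ?U v \<and> far N adj (\<lambda>x. x = e) v \<and> ?U w \<and> far N adj (\<lambda>x. x = e) w \<longrightarrow> \<not> adj v w"
    proof (intro allI impI, elim conjE)
      fix v w assume vw: "v < N" "w < N" "?U v" "?U w"
        "far N adj (\<lambda>x. x = e) v" "far N adj (\<lambda>x. x = e) w"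
      then show "\<not> adj v w"
        using adj_iff[OF vw(1-4)] far_iff[OF vw(1,3)] far_iff[OF vw(2,4)] by simp
    qed
    then have "splits N adj ?U (\<lambda>x. x = e)"
      unfolding splits_def
      by - (rule conjI, assumption, rule exI[of _ "\<lambda>v. k v = p"], rule bip)
    then show ?thesis using e by blast
  qed
qed

end

section \<open>Running times of loop programs\<close>

text \<open>The real store reappears unchanged in the final state: the program only reads the
  matrix, so \<rho> is a parameter and assertions concern the integer store alone.\<close>

definition wp :: "rstore \<Rightarrow> nat \<Rightarrow> com \<Rightarrow> (istore \<Rightarrow> bool) \<Rightarrow> istore \<Rightarrow> bool" where
  "wp \<rho> T c Q \<sigma> \<longleftrightarrow> (\<exists>t \<sigma>'. exec c (\<sigma>, \<rho>) t (\<sigma>', \<rho>) \<and> t \<le> T \<and> Q \<sigma>')"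

lemma wp_mono: "wp \<rho> T c Q \<sigma> \<Longrightarrow> T \<le> T' \<Longrightarrow> (\<And>\<sigma>'. Q \<sigma>' \<Longrightarrow> Q' \<sigma>') \<Longrightarrow> wp \<rho> T' c Q' \<sigma>"
  unfolding wp_def by (meson order_trans)

lemma wp_Seq:
  assumes "wp \<rho> T c (wp \<rho> U d Q) \<sigma>" "T + U \<le> V"
  shows "wp \<rho> V (Seq c d) Q \<sigma>"
proof -
  obtain t \<sigma>' where 1: "exec c (\<sigma>, \<rho>) t (\<sigma>', \<rho>)" "t \<le> T" "wp \<rho> U d Q \<sigma>'"
    using assms(1) unfolding wp_def by blast
  then obtain u \<sigma>'' where 2: "exec d (\<sigma>', \<rho>) u (\<sigma>'', \<rho>)" "u \<le> U" "Q \<sigma>''"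
    unfolding wp_def by blast
  show ?thesis unfolding wp_def using exec.Seq[OF 1(1) 2(1)] 1(2) 2(2,3) assms(2)
    by (meson add_mono order_trans)
qed

lemma wp_Cond:
  assumes "bval p (\<sigma>, \<rho>) \<Longrightarrow> wp \<rho> T c Q \<sigma>" "\<not> bval p (\<sigma>, \<rho>) \<Longrightarrow> wp \<rho> T d Q \<sigma>" "bops p + T \<le> U"
  shows "wp \<rho> U (Cond p c d) Q \<sigma>"
proof (cases "bval p (\<sigma>, \<rho>)")
  case True
  then obtain t \<sigma>' where "exec c (\<sigma>, \<rho>) t (\<sigma>', \<rho>)" "t \<le> T" "Q \<sigma>'"
    using assms(1) unfolding wp_def by blast
  then show ?thesis unfolding wp_def
    using exec.CondTrue[OF True, of c] assms(3) by (meson add_mono order_trans order_refl)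
next
  case False
  then obtain t \<sigma>' where "exec d (\<sigma>, \<rho>) t (\<sigma>', \<rho>)" "t \<le> T" "Q \<sigma>'"
    using assms(2) unfolding wp_def by blast
  then show ?thesis unfolding wp_def
    using exec.CondFalse[OF False, of d] assms(3) by (meson add_mono order_trans order_refl)
qed

fun loop_free :: "com \<Rightarrow> bool" where
  "loop_free Skip = True"
| "loop_free (ISet x e f g) = True"
| "loop_free (Seq c d) = (loop_free c \<and> loop_free d)"
| "loop_free (Cond p c d) = (loop_free c \<and> loop_free d)"
| "loop_free c = False"

fun steps :: "com \<Rightarrow> rstore \<Rightarrow> istore \<Rightarrow> istore" where
  "steps (ISet x e f g) \<rho> \<sigma> = upd \<sigma> x (ival e (\<sigma>, \<rho>)) (ival f (\<sigma>, \<rho>)) (ival g (\<sigma>, \<rho>))"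
| "steps (Seq c d) \<rho> \<sigma> = steps d \<rho> (steps c \<rho> \<sigma>)"
| "steps (Cond p c d) \<rho> \<sigma> = (if bval p (\<sigma>, \<rho>) then steps c \<rho> \<sigma> else steps d \<rho> \<sigma>)"
| "steps c \<rho> \<sigma> = \<sigma>"

fun max_ops :: "com \<Rightarrow> nat" where
  "max_ops (ISet x e f g) = iops e + iops f + iops g"
| "max_ops (Seq c d) = max_ops c + max_ops d"
| "max_ops (Cond p c d) = bops p + max (max_ops c) (max_ops d)"
| "max_ops c = 0"

text \<open>Reduces loop-free code to simplification: the final store is computed by
  \<open>steps\<close>, and the cost is bounded by the more expensive branch of each
  conditional.\<close>

lemma wp_steps: "loop_free c \<Longrightarrow> max_ops c \<le> T \<Longrightarrow> Q (steps c \<rho> \<sigma>) \<Longrightarrow> wp \<rho> T c Q \<sigma>"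
proof (induction c arbitrary: T Q \<sigma>)
  case Skip
  then show ?case unfolding wp_def by (auto intro: exec.Skip)
next
  case (ISet x e f g)
  then show ?case unfolding wp_def using exec.ISet[of x e f g "(\<sigma>, \<rho>)"] by auto
next
  case (Seq c d)
  then show ?case by (intro wp_Seq[where T = "max_ops c" and U = "max_ops d"]) auto
next
  case (Cond p c d)
  then show ?case by (intro wp_Cond[where T = "max (max_ops c) (max_ops d)"]) auto
qed auto

section \<open>Loops and frame conditions\<close>

abbreviation var :: "vname \<Rightarrow> iexp" where
  "var x \<equiv> IGet x (IConst 0) (IConst 0)"

abbreviation elt :: "vname \<Rightarrow> iexp \<Rightarrow> iexp" where
  "elt x e \<equiv> IGet x e (IConst 0)"

abbreviation set_var :: "vname \<Rightarrow> iexp \<Rightarrow> com" where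
  "set_var x e \<equiv> ISet x (IConst 0) (IConst 0) e"

abbreviation set_elt :: "vname \<Rightarrow> iexp \<Rightarrow> iexp \<Rightarrow> com" where
  "set_elt x e f \<equiv> ISet x e (IConst 0) f"

definition for_loop :: "vname \<Rightarrow> vname \<Rightarrow> com \<Rightarrow> com" where
  "for_loop x h c = Seq (set_var x (IConst 0))
     (While (ILess (var x) (var h)) (Seq c (set_var x (IAdd (var x) (IConst 1)))))"

lemma upd_apply: "upd f x i j v y k l = (if y = x \<and> k = i \<and> l = j then v else f y k l)"
  by (simp add: upd_def)

lemma upd_other: "y \<noteq> x \<Longrightarrow> upd f x i j v y = f y"
  by (simp add: upd_def)

text \<open>Frames speak of whole arrays, so that facts about an array are carried over by a single
  equation.\<close>

definition unchanged :: "vname set \<Rightarrow> istore \<Rightarrow> istore \<Rightarrow> bool" where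
  "unchanged X \<sigma> \<sigma>' \<longleftrightarrow> (\<forall>y. y \<notin> X \<longrightarrow> \<sigma>' y = \<sigma> y)"

lemma unchangedD: "unchanged X \<sigma> \<sigma>' \<Longrightarrow> y \<notin> X \<Longrightarrow> \<sigma>' y = \<sigma> y"
  by (simp add: unchanged_def)

lemma unchanged_refl: "unchanged X \<sigma> \<sigma>"
  by (simp add: unchanged_def)

lemma unchanged_trans: "unchanged X \<sigma> \<sigma>' \<Longrightarrow> unchanged Y \<sigma>' \<sigma>'' \<Longrightarrow> X \<union> Y \<subseteq> Z \<Longrightarrow> unchanged Z \<sigma> \<sigma>''"
  unfolding unchanged_def by (metis UnCI subsetD)

lemma unchanged_upd: "unchanged X \<sigma> \<sigma>' \<Longrightarrow> x \<in> X \<Longrightarrow> unchanged X \<sigma> (upd \<sigma>' x i j v)"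
  by (auto simp: unchanged_def upd_def)

text \<open>The body may not touch the counter, hence iteration k starts with counter k;
  \<open>stable\<close> carries the invariant over the increment. An iteration pays for the body,
  one comparison and one addition, and the last failing comparison adds 1.\<close>

lemma wp_for_loop:
  assumes h: "\<sigma> h 0 0 = N" "h \<notin> X" "x \<in> X"
    and init: "I 0 \<sigma>"
    and stable: "\<And>k \<sigma>' v. I k \<sigma>' \<Longrightarrow> I k (upd \<sigma>' x 0 0 v)"
    and body: "\<And>k \<sigma>'. k < N \<Longrightarrow> unchanged X \<sigma> \<sigma>' \<Longrightarrow> I k \<sigma>' \<Longrightarrow> \<sigma>' x 0 0 = k \<Longrightarrow>
      wp \<rho> T c (\<lambda>\<sigma>''. unchanged (X - {x}) \<sigma>' \<sigma>'' \<and> I (Suc k) \<sigma>'') \<sigma>'"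
    and post: "\<And>\<sigma>'. unchanged X \<sigma> \<sigma>' \<Longrightarrow> I N \<sigma>' \<Longrightarrow> Q \<sigma>'"
    and T: "N * (T + 2) + 1 \<le> U"
  shows "wp \<rho> U (for_loop x h c) Q \<sigma>"
proof -
  let ?b = "ILess (var x) (var h)" and ?c = "Seq c (set_var x (IAdd (var x) (IConst 1)))"
  have loop: "\<exists>t \<sigma>''. exec (While ?b ?c) (\<sigma>', \<rho>) t (\<sigma>'', \<rho>) \<and> t \<le> (N - k) * (T + 2) + 1 \<and>
      unchanged X \<sigma> \<sigma>'' \<and> I N \<sigma>''"
    if "k \<le> N" "unchanged X \<sigma> \<sigma>'" "I k \<sigma>'" "\<sigma>' x 0 0 = k" for k \<sigma>'
    using that
  proof (induction "N - k" arbitrary: k \<sigma>')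
    case 0
    then have "exec (While ?b ?c) (\<sigma>', \<rho>) (bops ?b) (\<sigma>', \<rho>)"
      using h by (intro exec.WhileFalse) (auto dest: unchangedD)
    then show ?case using 0 by (auto intro!: exI)
  next
    case (Suc d)
    then have "k < N" by simp
    obtain t \<sigma>1 where 1: "exec c (\<sigma>', \<rho>) t (\<sigma>1, \<rho>)" "t \<le> T"
      "unchanged (X - {x}) \<sigma>' \<sigma>1" "I (Suc k) \<sigma>1"
      using body[OF \<open>k < N\<close> Suc.prems(2-4)] unfolding wp_def by blast
    define \<sigma>2 where "\<sigma>2 = upd \<sigma>1 x 0 0 (Suc k)"
    have x1: "\<sigma>1 x 0 0 = k" using 1(3) Suc.prems(4) by (simp add: unchanged_def)
    have "exec ?c (\<sigma>', \<rho>) (t + 1) (\<sigma>2, \<rho>)"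
      using exec.Seq[OF 1(1) exec.ISet[of x "IConst 0" "IConst 0" "IAdd (var x) (IConst 1)"]]
      by (simp add: x1 \<sigma>2_def)
    moreover have "unchanged X \<sigma> \<sigma>2"
      unfolding \<sigma>2_def using unchanged_trans[OF Suc.prems(2) 1(3)] h(3) by (intro unchanged_upd) auto
    moreover have "I (Suc k) \<sigma>2" unfolding \<sigma>2_def by (intro stable 1)
    moreover have "\<sigma>2 x 0 0 = Suc k" by (simp add: \<sigma>2_def upd_apply)
    moreover have d: "d = N - Suc k" using Suc.hyps(2) by simp
    ultimately obtain u \<sigma>3 where 3: "exec (While ?b ?c) (\<sigma>2, \<rho>) u (\<sigma>3, \<rho>)"
      "u \<le> (N - Suc k) * (T + 2) + 1" "unchanged X \<sigma> \<sigma>3" "I N \<sigma>3"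
      using Suc.hyps(1)[OF d, of \<sigma>2] Suc_leI[OF \<open>k < N\<close>] by blast
    have "bval ?b (\<sigma>', \<rho>)"
      using \<open>k < N\<close> Suc.prems(2,4) h by (auto dest: unchangedD)
    from exec.WhileTrue[OF this \<open>exec ?c (\<sigma>', \<rho>) (t + 1) (\<sigma>2, \<rho>)\<close> 3(1)]
    have "exec (While ?b ?c) (\<sigma>', \<rho>) (1 + (t + 1) + u) (\<sigma>3, \<rho>)" by simp
    moreover have "N - k = Suc (N - Suc k)" using \<open>k < N\<close> by simp
    then have "1 + (t + 1) + u \<le> (N - k) * (T + 2) + 1"
      using 1(2) 3(2) by simp
    ultimately show ?case using 3 by blast
  qed
  have "unchanged X \<sigma> (upd \<sigma> x 0 0 0)" using h(3) by (intro unchanged_upd unchanged_refl)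
  then obtain t \<sigma>' where "exec (While ?b ?c) (upd \<sigma> x 0 0 0, \<rho>) t (\<sigma>', \<rho>)" "t \<le> N * (T + 2) + 1"
    "unchanged X \<sigma> \<sigma>'" "I N \<sigma>'"
    using loop[of 0 "upd \<sigma> x 0 0 0"] stable[OF init, of 0] by (auto simp: upd_apply)
  then show ?thesis unfolding wp_def for_loop_def
    using exec.Seq[OF exec.ISet[of x "IConst 0" "IConst 0" "IConst 0"]] T post
    by (intro exI[of _ t] exI[of _ \<sigma>']) fastforce
qed

section \<open>Building the conflict graph\<close>

lemma cost_mono: "c \<le> C \<Longrightarrow> e \<le> d \<Longrightarrow> 1 \<le> N \<Longrightarrow> c * N ^ e \<le> C * N ^ d" for c C N d :: nat
  by (intro mult_le_mono power_increasing)

text \<open>A loop raises the exponent of N by one and the constant by 3: two operations of loop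
  control per iteration, and one final comparison absorbed by N \<ge> 1.\<close>

lemma wp_for:
  assumes "\<sigma> h 0 0 = N" "1 \<le> N" "h \<notin> X" "x \<in> X" "I 0 \<sigma>"
    and "\<And>k \<sigma>' v. I k \<sigma>' \<Longrightarrow> I k (upd \<sigma>' x 0 0 v)"
    and "\<And>k \<sigma>'. k < N \<Longrightarrow> unchanged X \<sigma> \<sigma>' \<Longrightarrow> I k \<sigma>' \<Longrightarrow> \<sigma>' x 0 0 = k \<Longrightarrow>
      wp \<rho> (C * N ^ d) c (\<lambda>\<sigma>''. unchanged (X - {x}) \<sigma>' \<sigma>'' \<and> I (Suc k) \<sigma>'') \<sigma>'"
    and "\<And>\<sigma>'. unchanged X \<sigma> \<sigma>' \<Longrightarrow> I N \<sigma>' \<Longrightarrow> Q \<sigma>'"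
    and "C + 3 \<le> D"
  shows "wp \<rho> (D * N ^ Suc d) (for_loop x h c) Q \<sigma>"
proof (rule wp_for_loop[OF assms(1,3-8)])
  define P where "P = N * N ^ d"
  have "1 \<le> N ^ d" using assms(2) by simp
  then have "N \<le> P" unfolding P_def by simp
  have "N * (C * N ^ d + 2) + 1 = C * P + 2 * N + 1" by (simp add: P_def algebra_simps)
  also have "\<dots> \<le> (C + 3) * P" using \<open>N \<le> P\<close> assms(2) by (simp add: algebra_simps)
  also have "\<dots> \<le> D * P" using assms(9) by (rule mult_le_mono1)
  finally show "N * (C * N ^ d + 2) + 1 \<le> D * N ^ Suc d" by (simp add: P_def)
qed

text \<open>Arrays: \<open>r\<close>, \<open>c\<close> row and column of the vertex \<open>v < N\<close>; \<open>G\<close> adjacency matrix; \<open>U\<close> vertices with maximal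
  neighbourhood; \<open>M\<close> the splitting of \<open>U\<close> under test; \<open>k\<close> colours; \<open>d\<close> vertices whose neighbours have
  been coloured; \<open>f\<close> set to 1 once a 3-colouring is found.\<close>

definition index_prog :: com where
  "index_prog = Seq (set_var ''N'' (IConst 0))
     (for_loop ''i'' ''m'' (for_loop ''j'' ''n''
       (Seq (set_elt ''r'' (var ''N'') (var ''i''))
       (Seq (set_elt ''c'' (var ''N'') (var ''j''))
            (set_var ''N'' (IAdd (var ''N'') (IConst 1)))))))"

lemma wp_index_prog:
  assumes "\<sigma> ''m'' 0 0 = m" "\<sigma> ''n'' 0 0 = n" "1 \<le> m" "1 \<le> n"
  shows "wp \<rho> (7 * (m * n)) index_prog (\<lambda>\<sigma>'. unchanged {''N'', ''i'', ''j'', ''r'', ''c''} \<sigma> \<sigma>' \<and>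
    \<sigma>' ''N'' 0 0 = m * n \<and> (\<forall>v < m * n. \<sigma>' ''r'' v 0 = v div n \<and> \<sigma>' ''c'' v 0 = v mod n)) \<sigma>"
proof -
  define I where "I k \<sigma>' \<longleftrightarrow> \<sigma>' ''N'' 0 0 = k \<and>
    (\<forall>v<k. \<sigma>' ''r'' v 0 = v div n \<and> \<sigma>' ''c'' v 0 = v mod n)" for k and \<sigma>' :: istore
  let ?loop = "for_loop ''i'' ''m'' (for_loop ''j'' ''n''
       (Seq (set_elt ''r'' (var ''N'') (var ''i''))
       (Seq (set_elt ''c'' (var ''N'') (var ''j''))
            (set_var ''N'' (IAdd (var ''N'') (IConst 1))))))"
  have cost: "m \<le> m * n" "1 \<le> m * n" using assms by simp_all
  have "wp \<rho> (7 * (m * n)) ?loop (\<lambda>\<sigma>'. unchanged {''N'', ''i'', ''j'', ''r'', ''c''} \<sigma> \<sigma>' \<and> I (m * n) \<sigma>')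
      (upd \<sigma> ''N'' 0 0 0)"
  proof (rule wp_for_loop[where N = m and X = "{''N'', ''i'', ''j'', ''r'', ''c''}" and I = "\<lambda>i. I (i * n)" and T = "n * 3 + 1"])
    fix i and \<sigma>1 :: istore
    assume i: "i < m" "unchanged {''N'', ''i'', ''j'', ''r'', ''c''} (upd \<sigma> ''N'' 0 0 0) \<sigma>1"
      "I (i * n) \<sigma>1" "\<sigma>1 ''i'' 0 0 = i"
    show "wp \<rho> (n * 3 + 1) (for_loop ''j'' ''n''
       (Seq (set_elt ''r'' (var ''N'') (var ''i''))
       (Seq (set_elt ''c'' (var ''N'') (var ''j''))
            (set_var ''N'' (IAdd (var ''N'') (IConst 1))))))
       (\<lambda>\<sigma>'. unchanged ({''N'', ''i'', ''j'', ''r'', ''c''} - {''i''}) \<sigma>1 \<sigma>' \<and> I (Suc i * n) \<sigma>') \<sigma>1"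
    proof (rule wp_for_loop[where N = n and X = "{''N'', ''j'', ''r'', ''c''}" and I = "\<lambda>j. I (i * n + j)" and T = 1])
      show "\<sigma>1 ''n'' 0 0 = n" using i(2) assms by (simp add: unchanged_def upd_def)
      fix j and \<sigma>2 :: istore
      assume j: "j < n" "unchanged {''N'', ''j'', ''r'', ''c''} \<sigma>1 \<sigma>2" "I (i * n + j) \<sigma>2" "\<sigma>2 ''j'' 0 0 = j"
      have "\<sigma>2 ''i'' 0 0 = i" using i j by (simp add: unchanged_def)
      moreover have "(i * n + j) div n = i" "(i * n + j) mod n = j" using j(1) by auto
      ultimately show "wp \<rho> 1 (Seq (set_elt ''r'' (var ''N'') (var ''i''))
       (Seq (set_elt ''c'' (var ''N'') (var ''j''))
            (set_var ''N'' (IAdd (var ''N'') (IConst 1)))))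
         (\<lambda>\<sigma>'. unchanged ({''N'', ''j'', ''r'', ''c''} - {''j''}) \<sigma>2 \<sigma>' \<and> I (i * n + Suc j) \<sigma>') \<sigma>2"
        using j by (intro wp_steps) (auto simp: I_def upd_def unchanged_def less_Suc_eq)
    qed (use i in \<open>auto simp: I_def upd_def unchanged_def add.commute\<close>)
  next
    have "m * (n * 3 + 1 + 2) + 1 = 3 * (m * n) + 3 * m + 1" by (simp add: algebra_simps)
    then show "m * (n * 3 + 1 + 2) + 1 \<le> 7 * (m * n)" using cost by linarith
  qed (use assms in \<open>auto simp: I_def upd_def unchanged_def\<close>)
  then have loop: "wp \<rho> (7 * (m * n)) ?loop (\<lambda>\<sigma>'. unchanged {''N'', ''i'', ''j'', ''r'', ''c''} \<sigma> \<sigma>' \<and>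
    \<sigma>' ''N'' 0 0 = m * n \<and> (\<forall>v < m * n. \<sigma>' ''r'' v 0 = v div n \<and> \<sigma>' ''c'' v 0 = v mod n)) (upd \<sigma> ''N'' 0 0 0)"
    unfolding I_def .
  show ?thesis unfolding index_prog_def
    by (rule wp_Seq[where T = 0, OF wp_steps]) (use loop in auto)
qed

section \<open>The adjacency matrix\<close>

definition adjacency_body :: com where
  "adjacency_body =
     Cond (RLess (RAdd (RGet ''A'' (elt ''r'' (var ''v'')) (elt ''c'' (var ''v'')))
                       (RGet ''A'' (elt ''r'' (var ''w'')) (elt ''c'' (var ''w''))))
                 (RAdd (RGet ''A'' (elt ''r'' (var ''v'')) (elt ''c'' (var ''w'')))
                       (RGet ''A'' (elt ''r'' (var ''w'')) (elt ''c'' (var ''v'')))))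
       (ISet ''G'' (var ''v'') (var ''w'') (IConst 1))
       (ISet ''G'' (var ''v'') (var ''w'') (IConst 0))"

definition adjacency_prog :: com where
  "adjacency_prog = for_loop ''v'' ''N'' (for_loop ''w'' ''N'' adjacency_body)"

lemma wp_adjacency_prog:
  assumes N: "\<sigma> ''N'' 0 0 = N" "1 \<le> N" and rc: "\<And>v. v < N \<Longrightarrow> \<sigma> ''r'' v 0 = r v \<and> \<sigma> ''c'' v 0 = c v"
  shows "wp \<rho> (9 * N ^ Suc (Suc 0)) adjacency_prog (\<lambda>\<sigma>'. unchanged {''v'', ''w'', ''G''} \<sigma> \<sigma>' \<and>
    (\<forall>v<N. \<forall>w<N. \<sigma>' ''G'' v w = of_bool (conflict (\<rho> ''A'') (r v) (c v) (r w) (c w)))) \<sigma>"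
proof -
  define g :: "nat \<Rightarrow> nat \<Rightarrow> nat" where "g v w = of_bool (conflict (\<rho> ''A'') (r v) (c v) (r w) (c w))" for v w
  have "wp \<rho> (9 * N ^ Suc (Suc 0)) adjacency_prog (\<lambda>\<sigma>'. unchanged {''v'', ''w'', ''G''} \<sigma> \<sigma>' \<and>
    (\<forall>v<N. \<forall>w<N. \<sigma>' ''G'' v w = g v w)) \<sigma>"
    unfolding adjacency_prog_def
  proof (rule wp_for[where N = N and X = "{''v'', ''w'', ''G''}" and C = 6
        and I = "\<lambda>k \<sigma>'. \<forall>x<k. \<forall>y<N. \<sigma>' ''G'' x y = g x y"])
    fix v and \<sigma>1 :: istore
    assume v: "v < N" "unchanged {''v'', ''w'', ''G''} \<sigma> \<sigma>1" "\<sigma>1 ''v'' 0 0 = v"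
      "\<forall>x<v. \<forall>y<N. \<sigma>1 ''G'' x y = g x y"
    show "wp \<rho> (6 * N ^ Suc 0) (for_loop ''w'' ''N'' adjacency_body)
       (\<lambda>\<sigma>'. unchanged ({''v'', ''w'', ''G''} - {''v''}) \<sigma>1 \<sigma>' \<and>
         (\<forall>x<Suc v. \<forall>y<N. \<sigma>' ''G'' x y = g x y)) \<sigma>1"
    proof (rule wp_for[where N = N and X = "{''w'', ''G''}" and C = 3
          and I = "\<lambda>k \<sigma>'. (\<forall>x<v. \<forall>y<N. \<sigma>' ''G'' x y = g x y) \<and> (\<forall>y<k. \<sigma>' ''G'' v y = g v y)"])
      fix w and \<sigma>2 :: istore
      assume w: "w < N" "unchanged {''w'', ''G''} \<sigma>1 \<sigma>2" "\<sigma>2 ''w'' 0 0 = w"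
        "(\<forall>x<v. \<forall>y<N. \<sigma>2 ''G'' x y = g x y) \<and> (\<forall>y<w. \<sigma>2 ''G'' v y = g v y)"
      have "\<sigma>2 ''v'' 0 0 = v" "\<sigma>2 ''r'' = \<sigma> ''r''" "\<sigma>2 ''c'' = \<sigma> ''c''"
        using v w by (simp_all add: unchanged_def)
      then have "steps adjacency_body \<rho> \<sigma>2 = upd \<sigma>2 ''G'' v w (g v w)"
        using rc[OF v(1)] rc[OF w(1)] w(3) by (simp add: adjacency_body_def g_def conflict_def)
      moreover have "loop_free adjacency_body" "max_ops adjacency_body \<le> 3 * N ^ 0"
        by (simp_all add: adjacency_body_def)
      ultimately show "wp \<rho> (3 * N ^ 0) adjacency_body
          (\<lambda>\<sigma>'. unchanged ({''w'', ''G''} - {''w''}) \<sigma>2 \<sigma>' \<and>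
            (\<forall>x<v. \<forall>y<N. \<sigma>' ''G'' x y = g x y) \<and> (\<forall>y<Suc w. \<sigma>' ''G'' v y = g v y)) \<sigma>2"
        using w(4) by (intro wp_steps) (auto simp: upd_apply less_Suc_eq intro!: unchanged_upd unchanged_refl)
    qed (use v N in \<open>auto simp: upd_apply unchanged_def less_Suc_eq\<close>)
  qed (use N in \<open>auto simp: upd_apply\<close>)
  then show ?thesis by (simp add: g_def)
qed

section \<open>Vertices with maximal neighbourhood\<close>

lemma wp_steps_Seq:
  "loop_free c \<Longrightarrow> max_ops c = 0 \<Longrightarrow> wp \<rho> T d Q (steps c \<rho> \<sigma>) \<Longrightarrow> wp \<rho> T (Seq c d) Q \<sigma>"
  by (rule wp_Seq[where T = 0, OF wp_steps]) auto

text \<open>\<open>s\<close> flags a neighbour of v that w lacks, \<open>p\<close> a neighbour of w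
  that v lacks. As both are 0 or 1, the later test s < p detects exactly a strict inclusion of the
  neighbourhood of v.\<close>

definition compare_body :: com where
  "compare_body = Seq
     (Cond (BAnd (ILess (IConst 0) (IGet ''G'' (var ''v'') (var ''x'')))
                 (ILess (IGet ''G'' (var ''w'') (var ''x'')) (IConst 1)))
       (set_var ''s'' (IConst 1)) Skip)
     (Cond (BAnd (ILess (IConst 0) (IGet ''G'' (var ''w'') (var ''x'')))
                 (ILess (IGet ''G'' (var ''v'') (var ''x'')) (IConst 1)))
       (set_var ''p'' (IConst 1)) Skip)"

definition maximal_body :: com where
  "maximal_body = Seq (Seq (set_var ''s'' (IConst 0)) (set_var ''p'' (IConst 0)))
     (Seq (for_loop ''x'' ''N'' compare_body)
       (Cond (ILess (var ''s'') (var ''p'')) (set_elt ''U'' (var ''v'') (IConst 0)) Skip))"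

definition maximal_prog :: com where
  "maximal_prog = for_loop ''v'' ''N''
     (Seq (set_elt ''U'' (var ''v'') (IConst 1)) (for_loop ''w'' ''N'' maximal_body))"

definition dominates :: "nat \<Rightarrow> (nat \<Rightarrow> nat \<Rightarrow> bool) \<Rightarrow> nat \<Rightarrow> nat \<Rightarrow> bool" where
  "dominates N adj w v \<longleftrightarrow> (\<forall>x<N. adj v x \<longrightarrow> adj w x) \<and> (\<exists>x<N. adj w x \<and> \<not> adj v x)"

lemma of_bool_Ex_less_Suc: "of_bool (\<exists>y<Suc k. R y) = (if R k then 1 else of_bool (\<exists>y<k. R y) :: nat)"
  unfolding Ex_less_Suc by simp

lemma wp_maximal_body:
  assumes N: "\<sigma> ''N'' 0 0 = N" "1 \<le> N" and G: "\<And>v w. v < N \<Longrightarrow> w < N \<Longrightarrow> \<sigma> ''G'' v w = of_bool (adj v w)"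
    and v: "\<sigma> ''v'' 0 0 = v" "v < N" and w: "\<sigma> ''w'' 0 0 = w" "w < N"
  shows "wp \<rho> (8 * N ^ Suc 0) maximal_body (\<lambda>\<sigma>'. unchanged {''x'', ''s'', ''p'', ''U''} \<sigma> \<sigma>' \<and>
    \<sigma>' ''U'' = (if dominates N adj w v then upd \<sigma> ''U'' v 0 0 ''U'' else \<sigma> ''U'')) \<sigma>"
proof -
  let ?\<sigma> = "upd (upd \<sigma> ''s'' 0 0 0) ''p'' 0 0 0"
  define I where "I k \<sigma>' \<longleftrightarrow> \<sigma>' ''s'' 0 0 = of_bool (\<exists>x<k. adj v x \<and> \<not> adj w x) \<and>
      \<sigma>' ''p'' 0 0 = of_bool (\<exists>x<k. adj w x \<and> \<not> adj v x)" for k and \<sigma>' :: istore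
  have loop: "wp \<rho> (7 * N ^ Suc 0) (for_loop ''x'' ''N'' compare_body)
    (\<lambda>\<sigma>'. unchanged {''x'', ''s'', ''p''} ?\<sigma> \<sigma>' \<and> I N \<sigma>') ?\<sigma>"
  proof (rule wp_for[where N = N and X = "{''x'', ''s'', ''p''}" and C = 4 and I = I])
    fix x and \<sigma>1 :: istore
    assume x: "x < N" "unchanged {''x'', ''s'', ''p''} ?\<sigma> \<sigma>1" "\<sigma>1 ''x'' 0 0 = x" "I x \<sigma>1"
    have "\<sigma>1 ''v'' 0 0 = v" "\<sigma>1 ''w'' 0 0 = w" "\<sigma>1 ''G'' = \<sigma> ''G''"
      using x(2) v w by (simp_all add: unchanged_def upd_other)
    then have step: "unchanged {''s'', ''p''} \<sigma>1 (steps compare_body \<rho> \<sigma>1)"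
      "steps compare_body \<rho> \<sigma>1 ''s'' 0 0 = (if adj v x \<and> \<not> adj w x then 1 else \<sigma>1 ''s'' 0 0)"
      "steps compare_body \<rho> \<sigma>1 ''p'' 0 0 = (if adj w x \<and> \<not> adj v x then 1 else \<sigma>1 ''p'' 0 0)"
      using G v(2) w(2) x(1,3) by (simp_all add: compare_body_def upd_apply upd_other unchanged_def)
    have "unchanged ({''x'', ''s'', ''p''} - {''x''}) \<sigma>1 (steps compare_body \<rho> \<sigma>1)"
      using step(1) by (simp add: unchanged_def)
    moreover have "I (Suc x) (steps compare_body \<rho> \<sigma>1)"
      using x(4) unfolding I_def of_bool_Ex_less_Suc step(2,3) by (simp only: simp_thms)
    moreover have "loop_free compare_body" "max_ops compare_body \<le> 4 * N ^ 0"
      by (simp_all add: compare_body_def)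
    ultimately show "wp \<rho> (4 * N ^ 0) compare_body
        (\<lambda>\<sigma>'. unchanged ({''x'', ''s'', ''p''} - {''x''}) \<sigma>1 \<sigma>' \<and> I (Suc x) \<sigma>') \<sigma>1"
      by (intro wp_steps conjI)
  qed (use N in \<open>auto simp: I_def upd_apply\<close>)
  let ?c = "Cond (ILess (var ''s'') (var ''p'')) (set_elt ''U'' (var ''v'') (IConst 0)) Skip"
  have fin: "wp \<rho> 1 ?c (\<lambda>\<sigma>'. unchanged {''x'', ''s'', ''p'', ''U''} \<sigma> \<sigma>' \<and>
    \<sigma>' ''U'' = (if dominates N adj w v then upd \<sigma> ''U'' v 0 0 ''U'' else \<sigma> ''U'')) \<sigma>1"
    if "unchanged {''x'', ''s'', ''p''} ?\<sigma> \<sigma>1 \<and> I N \<sigma>1" for \<sigma>1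
  proof -
    have "\<sigma>1 ''v'' 0 0 = v" "\<sigma>1 ''U'' = \<sigma> ''U''"
      using that v by (simp_all add: unchanged_def upd_other)
    moreover have "\<sigma>1 ''s'' 0 0 < \<sigma>1 ''p'' 0 0 \<longleftrightarrow> dominates N adj w v"
      using that by (auto simp: I_def dominates_def)
    moreover have "unchanged {''x'', ''s'', ''p'', ''U''} \<sigma> \<sigma>1"
      using that by (simp add: unchanged_def upd_other)
    ultimately show ?thesis by (intro wp_steps) (simp_all add: upd_def unchanged_def)
  qed
  have "wp \<rho> (8 * N ^ Suc 0) (Seq (for_loop ''x'' ''N'' compare_body) ?c)
    (\<lambda>\<sigma>'. unchanged {''x'', ''s'', ''p'', ''U''} \<sigma> \<sigma>' \<and>
    \<sigma>' ''U'' = (if dominates N adj w v then upd \<sigma> ''U'' v 0 0 ''U'' else \<sigma> ''U'')) ?\<sigma>"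
    by (rule wp_Seq[OF wp_mono[OF loop order_refl fin]]) (use N in auto)
  then show ?thesis unfolding maximal_body_def by - (rule wp_steps_Seq, simp_all)
qed

lemma wp_maximal_prog:
  assumes N: "\<sigma> ''N'' 0 0 = N" "1 \<le> N" and G: "\<And>v w. v < N \<Longrightarrow> w < N \<Longrightarrow> \<sigma> ''G'' v w = of_bool (adj v w)"
  shows "wp \<rho> (14 * N ^ Suc (Suc (Suc 0))) maximal_prog (\<lambda>\<sigma>'.
    unchanged {''v'', ''w'', ''x'', ''s'', ''p'', ''U''} \<sigma> \<sigma>' \<and>
    (\<forall>v<N. \<sigma>' ''U'' v 0 = of_bool (maximal_nbhd N adj v))) \<sigma>"
  unfolding maximal_prog_def
proof (rule wp_for[where N = N and X = "{''v'', ''w'', ''x'', ''s'', ''p'', ''U''}" and C = 11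
      and I = "\<lambda>k \<sigma>'. \<forall>v<k. \<sigma>' ''U'' v 0 = of_bool (maximal_nbhd N adj v)"])
  fix v and \<sigma>1 :: istore
  assume v: "v < N" "unchanged {''v'', ''w'', ''x'', ''s'', ''p'', ''U''} \<sigma> \<sigma>1" "\<sigma>1 ''v'' 0 0 = v"
    "\<forall>x<v. \<sigma>1 ''U'' x 0 = of_bool (maximal_nbhd N adj x)"
  let ?\<sigma>1 = "upd \<sigma>1 ''U'' v 0 1"
  let ?X = "{''w'', ''x'', ''s'', ''p'', ''U''}"
  have "wp \<rho> (11 * N ^ Suc (Suc 0)) (for_loop ''w'' ''N'' maximal_body)
    (\<lambda>\<sigma>'. unchanged ({''v'', ''w'', ''x'', ''s'', ''p'', ''U''} - {''v''}) \<sigma>1 \<sigma>' \<and>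
       (\<forall>y<Suc v. \<sigma>' ''U'' y 0 = of_bool (maximal_nbhd N adj y))) ?\<sigma>1"
  proof (rule wp_for[where N = N and X = ?X and C = 8
        and I = "\<lambda>k \<sigma>'. (\<forall>x<v. \<sigma>' ''U'' x 0 = of_bool (maximal_nbhd N adj x)) \<and>
          \<sigma>' ''U'' v 0 = of_bool (\<not> (\<exists>y<k. dominates N adj y v))"])
    fix w and \<sigma>2 :: istore
    assume w: "w < N" "unchanged ?X ?\<sigma>1 \<sigma>2" "\<sigma>2 ''w'' 0 0 = w"
      "(\<forall>x<v. \<sigma>2 ''U'' x 0 = of_bool (maximal_nbhd N adj x)) \<and>
          \<sigma>2 ''U'' v 0 = of_bool (\<not> (\<exists>y<w. dominates N adj y v))"
    show "wp \<rho> (8 * N ^ Suc 0) maximal_body (\<lambda>\<sigma>'. unchanged (?X - {''w''}) \<sigma>2 \<sigma>' \<and>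
       (\<forall>x<v. \<sigma>' ''U'' x 0 = of_bool (maximal_nbhd N adj x)) \<and>
          \<sigma>' ''U'' v 0 = of_bool (\<not> (\<exists>y<Suc w. dominates N adj y v))) \<sigma>2"
    proof (rule wp_mono[OF wp_maximal_body[where N = N and adj = adj and v = v and w = w]])
      show "\<sigma>2 ''N'' 0 0 = N" "\<And>v w. v < N \<Longrightarrow> w < N \<Longrightarrow> \<sigma>2 ''G'' v w = of_bool (adj v w)" "\<sigma>2 ''v'' 0 0 = v"
        using w(2) v N(1) G by (simp_all add: unchanged_def upd_other)
      fix \<sigma>'
      assume "unchanged {''x'', ''s'', ''p'', ''U''} \<sigma>2 \<sigma>' \<and>
         \<sigma>' ''U'' = (if dominates N adj w v then upd \<sigma>2 ''U'' v 0 0 ''U'' else \<sigma>2 ''U'')"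
      then show "unchanged (?X - {''w''}) \<sigma>2 \<sigma>' \<and>
       (\<forall>x<v. \<sigma>' ''U'' x 0 = of_bool (maximal_nbhd N adj x)) \<and>
          \<sigma>' ''U'' v 0 = of_bool (\<not> (\<exists>y<Suc w. dominates N adj y v))"
        using w(4) by (simp add: unchanged_def Ex_less_Suc upd_apply)
    qed (use w N v in auto)
  next
    fix \<sigma>' assume u: "unchanged ?X ?\<sigma>1 \<sigma>'" and I: "(\<forall>x<v. \<sigma>' ''U'' x 0 = of_bool (maximal_nbhd N adj x)) \<and>
          \<sigma>' ''U'' v 0 = of_bool (\<not> (\<exists>w<N. dominates N adj w v))"
    have "(\<not> (\<exists>w<N. dominates N adj w v)) \<longleftrightarrow> maximal_nbhd N adj v"
      by (simp add: maximal_nbhd_def dominates_def)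
    with u I show "unchanged ({''v'', ''w'', ''x'', ''s'', ''p'', ''U''} - {''v''}) \<sigma>1 \<sigma>' \<and>
       (\<forall>y<Suc v. \<sigma>' ''U'' y 0 = of_bool (maximal_nbhd N adj y))"
      by (simp add: unchanged_def upd_other All_less_Suc)
  qed (use v N in \<open>auto simp: unchanged_def upd_apply\<close>)
  then show "wp \<rho> (11 * N ^ Suc (Suc 0)) (Seq (set_elt ''U'' (var ''v'') (IConst 1)) (for_loop ''w'' ''N'' maximal_body))
    (\<lambda>\<sigma>'. unchanged ({''v'', ''w'', ''x'', ''s'', ''p'', ''U''} - {''v''}) \<sigma>1 \<sigma>' \<and>
       (\<forall>y<Suc v. \<sigma>' ''U'' y 0 = of_bool (maximal_nbhd N adj y))) \<sigma>1"
    using v(3) by - (rule wp_steps_Seq, simp_all)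
qed (use N in \<open>auto simp: upd_apply\<close>)

text \<open>Doubling the entry of \<open>U\<close> instead of writing 2 keeps vertices outside
  \<open>U\<close> at 0, so \<open>M\<close> encodes membership in \<open>U\<close> and the side of
  the split at once.\<close>

definition split_body :: "bexp \<Rightarrow> com" where
  "split_body L = Cond (BAnd L (ILess (IConst 0) (IGet ''G'' (var ''w'') (var ''x''))))
     (set_elt ''M'' (var ''w'') (IAdd (elt ''U'' (var ''w'')) (elt ''U'' (var ''w'')))) Skip"

definition split_prog :: "bexp \<Rightarrow> com" where
  "split_prog L = for_loop ''w'' ''N'' (Seq (set_elt ''M'' (var ''w'') (elt ''U'' (var ''w'')))
     (for_loop ''x'' ''N'' (split_body L)))"

definition mark :: "nat \<Rightarrow> (nat \<Rightarrow> nat \<Rightarrow> bool) \<Rightarrow> (nat \<Rightarrow> bool) \<Rightarrow> (nat \<Rightarrow> bool) \<Rightarrow> nat \<Rightarrow> nat" where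
  "mark N adj U P w = (if \<not> U w then 0 else if far N adj P w then 1 else 2)"

text \<open>\<open>L\<close> may be any test on the current x that depends on nothing else the loops
  modify; the bound 2 fits an equality test composed of two comparisons.\<close>

lemma wp_split_prog:
  assumes N: "\<sigma> ''N'' 0 0 = N" "1 \<le> N" and G: "\<And>v w. v < N \<Longrightarrow> w < N \<Longrightarrow> \<sigma> ''G'' v w = of_bool (adj v w)"
    and U: "\<And>v. v < N \<Longrightarrow> \<sigma> ''U'' v 0 = of_bool (U v)"
    and L: "\<And>\<sigma>'. unchanged {''w'', ''x'', ''M''} \<sigma> \<sigma>' \<Longrightarrow> \<sigma>' ''x'' 0 0 < N \<Longrightarrow> bval L (\<sigma>', \<rho>) \<longleftrightarrow> P (\<sigma>' ''x'' 0 0)"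
    and bops: "bops L \<le> 2"
  shows "wp \<rho> (10 * N ^ Suc (Suc 0)) (split_prog L) (\<lambda>\<sigma>'.
    unchanged {''w'', ''x'', ''M''} \<sigma> \<sigma>' \<and> (\<forall>w<N. \<sigma>' ''M'' w 0 = mark N adj U P w)) \<sigma>"
  unfolding split_prog_def
proof (rule wp_for[where N = N and X = "{''w'', ''x'', ''M''}" and C = 7
      and I = "\<lambda>k \<sigma>'. \<forall>w<k. \<sigma>' ''M'' w 0 = mark N adj U P w"])
  fix w and \<sigma>1 :: istore
  assume w: "w < N" "unchanged {''w'', ''x'', ''M''} \<sigma> \<sigma>1" "\<sigma>1 ''w'' 0 0 = w"
    "\<forall>y<w. \<sigma>1 ''M'' y 0 = mark N adj U P y"
  let ?\<sigma>1 = "upd \<sigma>1 ''M'' w 0 (\<sigma> ''U'' w 0)"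
  let ?I = "\<lambda>k \<sigma>' :: istore. (\<forall>y<w. \<sigma>' ''M'' y 0 = mark N adj U P y) \<and>
          \<sigma>' ''M'' w 0 = (if U w then if \<exists>x<k. P x \<and> adj w x then 2 else 1 else 0)"
  have "wp \<rho> (7 * N ^ Suc 0) (for_loop ''x'' ''N'' (split_body L))
    (\<lambda>\<sigma>'. unchanged ({''w'', ''x'', ''M''} - {''w''}) \<sigma>1 \<sigma>' \<and> (\<forall>y<Suc w. \<sigma>' ''M'' y 0 = mark N adj U P y)) ?\<sigma>1"
  proof (rule wp_for[where N = N and X = "{''x'', ''M''}" and C = 4 and I = ?I])
    fix x and \<sigma>2 :: istore
    assume x: "x < N" "unchanged {''x'', ''M''} ?\<sigma>1 \<sigma>2" "\<sigma>2 ''x'' 0 0 = x" "?I x \<sigma>2"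
    have "\<sigma>2 ''w'' 0 0 = w" "\<sigma>2 ''U'' = \<sigma> ''U''" "\<sigma>2 ''G'' = \<sigma> ''G''"
      using x(2) w by (simp_all add: unchanged_def upd_other)
    moreover have "unchanged {''w'', ''x'', ''M''} \<sigma> \<sigma>2"
      using x(2) w(2) by (simp add: unchanged_def upd_other)
    ultimately have "steps (split_body L) \<rho> \<sigma>2 =
      (if P x \<and> adj w x then upd \<sigma>2 ''M'' w 0 (if U w then 2 else 0) else \<sigma>2)"
      using L[of \<sigma>2] x(1,3) G[OF w(1) x(1)] U[OF w(1)] by (simp add: split_body_def numeral_2_eq_2)
    moreover have "loop_free (split_body L)" "max_ops (split_body L) \<le> 4 * N ^ 0"
      using bops by (simp_all add: split_body_def)
    ultimately show "wp \<rho> (4 * N ^ 0) (split_body L) (\<lambda>\<sigma>'. unchanged ({''x'', ''M''} - {''x''}) \<sigma>2 \<sigma>' \<and> ?I (Suc x) \<sigma>') \<sigma>2"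
      using x(4) unfolding Ex_less_Suc
      by (intro wp_steps; cases "P x \<and> adj w x") (auto simp: upd_apply upd_other unchanged_def)
  next
    fix \<sigma>' assume "unchanged {''x'', ''M''} ?\<sigma>1 \<sigma>'" "?I N \<sigma>'"
    then show "unchanged ({''w'', ''x'', ''M''} - {''w''}) \<sigma>1 \<sigma>' \<and> (\<forall>y<Suc w. \<sigma>' ''M'' y 0 = mark N adj U P y)"
      by (auto simp: unchanged_def upd_other All_less_Suc mark_def far_def)
  qed (use w N U in \<open>auto simp: unchanged_def upd_apply\<close>)
  then show "wp \<rho> (7 * N ^ Suc 0) (Seq (set_elt ''M'' (var ''w'') (elt ''U'' (var ''w''))) (for_loop ''x'' ''N'' (split_body L)))
    (\<lambda>\<sigma>'. unchanged ({''w'', ''x'', ''M''} - {''w''}) \<sigma>1 \<sigma>' \<and> (\<forall>y<Suc w. \<sigma>' ''M'' y 0 = mark N adj U P y)) \<sigma>1"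
    using w(2,3) by - (rule wp_steps_Seq, simp_all add: unchanged_def)
qed (use N in \<open>auto simp: upd_apply\<close>)

section \<open>Two-colouring by propagation\<close>

definition bipartition :: "nat \<Rightarrow> (nat \<Rightarrow> nat \<Rightarrow> bool) \<Rightarrow> (nat \<Rightarrow> bool) \<Rightarrow> (nat \<Rightarrow> bool) \<Rightarrow> bool" where
  "bipartition N adj S \<chi> \<longleftrightarrow> (\<forall>v<N. \<forall>w<N. S v \<and> S w \<and> adj v w \<longrightarrow> \<chi> v \<noteq> \<chi> w)"

text \<open>Compatibility with a two-colouring is claimed only if one exists, so propagation needs
  no failure test and inconsistencies are left to the final check. In the last clause
  \<open>s\<close> counts rounds: after N of them no vertex of \<open>S\<close> is waiting.\<close>

definition coloring_inv ::
  "nat \<Rightarrow> (nat \<Rightarrow> nat \<Rightarrow> bool) \<Rightarrow> (nat \<Rightarrow> bool) \<Rightarrow> nat \<Rightarrow> (nat \<Rightarrow> nat) \<Rightarrow> (nat \<Rightarrow> nat) \<Rightarrow> bool" where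
  "coloring_inv N adj S s k d \<longleftrightarrow>
     (\<forall>v<N. k v \<le> 2 \<and> (\<not> S v \<longrightarrow> k v = 0)) \<and>
     ((\<exists>\<chi>. bipartition N adj S \<chi>) \<longrightarrow>
        (\<exists>\<chi>. bipartition N adj S \<chi> \<and> (\<forall>v<N. S v \<and> k v \<noteq> 0 \<longrightarrow> (k v = 1 \<longleftrightarrow> \<chi> v)))) \<and>
     (\<forall>v<N. S v \<and> d v \<noteq> 0 \<longrightarrow> k v \<noteq> 0 \<and> (\<forall>w<N. S w \<and> adj v w \<longrightarrow> k w \<noteq> 0)) \<and>
     card {v. v < N \<and> S v \<and> d v = 0} + s \<le> N"

text \<open>A fresh vertex is taken only if no coloured vertex is waiting, so that the colours of different
  components never meet.\<close>

definition pickable :: "nat \<Rightarrow> (nat \<Rightarrow> bool) \<Rightarrow> (nat \<Rightarrow> nat) \<Rightarrow> (nat \<Rightarrow> nat) \<Rightarrow> nat \<Rightarrow> bool" where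
  "pickable n S k d p \<longleftrightarrow> p < n \<and> S p \<and> d p = 0 \<and> (k p = 0 \<longrightarrow> (\<forall>u<n. S u \<and> d u = 0 \<longrightarrow> k u = 0))"

definition start :: "(nat \<Rightarrow> nat) \<Rightarrow> nat \<Rightarrow> nat \<Rightarrow> nat" where
  "start k p = (if k p = 0 then k(p := 1) else k)"

text \<open>With \<open>n\<close> as the number of vertices visited so far, the same function also
  serves as loop invariant.\<close>

definition spread :: "nat \<Rightarrow> (nat \<Rightarrow> nat \<Rightarrow> bool) \<Rightarrow> (nat \<Rightarrow> bool) \<Rightarrow> nat \<Rightarrow> (nat \<Rightarrow> nat) \<Rightarrow> nat \<Rightarrow> nat" where
  "spread n adj S p k w = (if w < n \<and> S w \<and> adj p w \<and> k w = 0 then 3 - k p else k w)"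

lemma coloring_invI:
  assumes "\<forall>v<N. k v \<le> 2 \<and> (\<not> S v \<longrightarrow> k v = 0)"
    and "(\<exists>\<chi>. bipartition N adj S \<chi>) \<longrightarrow>
    (\<exists>\<chi>. bipartition N adj S \<chi> \<and> (\<forall>v<N. S v \<and> k v \<noteq> 0 \<longrightarrow> (k v = 1 \<longleftrightarrow> \<chi> v)))"
    and "\<forall>v<N. S v \<and> d v \<noteq> 0 \<longrightarrow> k v \<noteq> 0 \<and> (\<forall>w<N. S w \<and> adj v w \<longrightarrow> k w \<noteq> 0)"
    and "card {v. v < N \<and> S v \<and> d v = 0} + s \<le> N"
  shows "coloring_inv N adj S s k d"
  unfolding coloring_inv_def by (intro conjI assms)

lemmas coloring_invD =
  coloring_inv_def[THEN iffD1, THEN conjunct1]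
  coloring_inv_def[THEN iffD1, THEN conjunct2, THEN conjunct1]
  coloring_inv_def[THEN iffD1, THEN conjunct2, THEN conjunct2, THEN conjunct1]
  coloring_inv_def[THEN iffD1, THEN conjunct2, THEN conjunct2, THEN conjunct2]

lemma coloring_inv_0: "coloring_inv N adj S 0 (\<lambda>_. 0) (\<lambda>_. 0)"
proof -
  have "card {v. v < N \<and> S v} \<le> card {..<N}" by (intro card_mono) auto
  then show ?thesis by (auto simp: coloring_inv_def)
qed

lemma coloring_inv_done:
  assumes "coloring_inv N adj S s k d" "\<forall>u<N. \<not> (S u \<and> d u = 0)" "s < N"
  shows "coloring_inv N adj S (Suc s) k d"
proof -
  have "{v. v < N \<and> S v \<and> d v = 0} = {}" using assms(2) by blast
  then have "card {v. v < N \<and> S v \<and> d v = 0} + Suc s \<le> N" using assms(3) by (simp only: card.empty)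
  then show ?thesis by (rule coloring_invI[OF coloring_invD(1-3)[OF assms(1)]])
qed

text \<open>When a fresh vertex is picked, no coloured vertex waits, so no edge joins coloured to
  uncoloured vertices. A compatible two-colouring can thus be flipped on the uncoloured part to suit
  the colour 1 of p.\<close>

lemma coloring_inv_start:
  assumes inv: "coloring_inv N adj S s k d" and pick: "pickable N S k d p"
    and sym: "\<And>v w. v < N \<Longrightarrow> w < N \<Longrightarrow> adj v w \<longleftrightarrow> adj w v"
  shows "coloring_inv N adj S s (start k p) d"
proof (cases "k p = 0")
  case True
  have p: "p < N" "S p" "d p = 0" and fresh: "\<And>u. u < N \<Longrightarrow> S u \<Longrightarrow> d u = 0 \<Longrightarrow> k u = 0"
    using pick True by (auto simp: pickable_def)
  have closed: "k w \<noteq> 0" if "v < N" "S v" "k v \<noteq> 0" "w < N" "S w" "adj v w" for v w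
  proof -
    have "d v \<noteq> 0" using fresh[of v] that by blast
    moreover have "\<forall>v<N. S v \<and> d v \<noteq> 0 \<longrightarrow> k v \<noteq> 0 \<and> (\<forall>w<N. S w \<and> adj v w \<longrightarrow> k w \<noteq> 0)"
      using coloring_invD(3)[OF inv] .
    ultimately show ?thesis using that by blast
  qed
  have "\<exists>\<chi>. bipartition N adj S \<chi> \<and> (\<forall>v<N. S v \<and> start k p v \<noteq> 0 \<longrightarrow> (start k p v = 1 \<longleftrightarrow> \<chi> v))"
    if ex: "\<exists>\<chi>. bipartition N adj S \<chi>"
  proof -
    obtain \<chi> where \<chi>: "bipartition N adj S \<chi>" "\<And>v. v < N \<Longrightarrow> S v \<Longrightarrow> k v \<noteq> 0 \<Longrightarrow> k v = 1 \<longleftrightarrow> \<chi> v"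
    proof -
      have "\<exists>\<chi>. bipartition N adj S \<chi> \<and> (\<forall>v<N. S v \<and> k v \<noteq> 0 \<longrightarrow> (k v = 1 \<longleftrightarrow> \<chi> v))"
        using coloring_invD(2)[OF inv] ex by (rule mp)
      then show ?thesis using that by blast
    qed
    define \<chi>' where "\<chi>' v \<longleftrightarrow> (if k v = 0 then \<chi> v = \<chi> p else \<chi> v)" for v
    have "\<chi>' v \<noteq> \<chi>' w" if vw: "v < N" "w < N" "S v" "S w" "adj v w" for v w
    proof -
      have "k v = 0 \<longleftrightarrow> k w = 0" using closed[of v w] closed[of w v] vw sym by blast
      moreover have "\<chi> v \<noteq> \<chi> w" using \<chi>(1) vw by (auto simp: bipartition_def)
      ultimately show ?thesis by (auto simp: \<chi>'_def)
    qed
    then have "bipartition N adj S \<chi>'" by (simp add: bipartition_def)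
    moreover have "start k p v = 1 \<longleftrightarrow> \<chi>' v" if "v < N" "S v" "start k p v \<noteq> 0" for v
      using \<chi>(2)[of v] that True by (auto simp: \<chi>'_def start_def split: if_splits)
    ultimately show ?thesis by blast
  qed
  moreover have "\<forall>v<N. start k p v \<le> 2 \<and> (\<not> S v \<longrightarrow> start k p v = 0)"
    using inv p by (auto simp: coloring_inv_def start_def)
  moreover have "\<forall>v<N. S v \<and> d v \<noteq> 0 \<longrightarrow> start k p v \<noteq> 0 \<and> (\<forall>w<N. S w \<and> adj v w \<longrightarrow> start k p w \<noteq> 0)"
    using inv by (auto simp: coloring_inv_def start_def)
  moreover have "card {v. v < N \<and> S v \<and> d v = 0} + s \<le> N" using coloring_invD(4)[OF inv] .
  ultimately show ?thesis by (intro coloring_invI impI)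
qed (use inv in \<open>simp add: start_def\<close>)

text \<open>In every two-colouring the colour of p forces those of its neighbours, so the compatible
  one is kept. Since p stops waiting, the round is paid for.\<close>

lemma coloring_inv_spread:
  assumes inv: "coloring_inv N adj S s k d" and p: "p < N" "S p" "d p = 0" "k p \<noteq> 0"
  shows "coloring_inv N adj S (Suc s) (spread N adj S p k) (d(p := 1))"
proof -
  have kp: "k p = 1 \<or> k p = 2" using inv p by (auto simp: coloring_inv_def le_Suc_eq numeral_2_eq_2)
  have "\<exists>\<chi>. bipartition N adj S \<chi> \<and>
      (\<forall>v<N. S v \<and> spread N adj S p k v \<noteq> 0 \<longrightarrow> (spread N adj S p k v = 1 \<longleftrightarrow> \<chi> v))"
    if ex: "\<exists>\<chi>. bipartition N adj S \<chi>"
  proof -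
    obtain \<chi> where \<chi>: "bipartition N adj S \<chi>" "\<And>v. v < N \<Longrightarrow> S v \<Longrightarrow> k v \<noteq> 0 \<Longrightarrow> k v = 1 \<longleftrightarrow> \<chi> v"
    proof -
      have "\<exists>\<chi>. bipartition N adj S \<chi> \<and> (\<forall>v<N. S v \<and> k v \<noteq> 0 \<longrightarrow> (k v = 1 \<longleftrightarrow> \<chi> v))"
        using coloring_invD(2)[OF inv] ex by (rule mp)
      then show ?thesis using that by blast
    qed
    have "spread N adj S p k v = 1 \<longleftrightarrow> \<chi> v" if v: "v < N" "S v" "spread N adj S p k v \<noteq> 0" for v
    proof (cases "adj p v \<and> k v = 0")
      case True
      then have "\<chi> p \<noteq> \<chi> v" using \<chi>(1) v p by (auto simp: bipartition_def)
      then show ?thesis using True v kp \<chi>(2)[OF p(1,2,4)] by (auto simp: spread_def)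
    next
      case False
      then have "spread N adj S p k v = k v" by (auto simp: spread_def)
      then show ?thesis using \<chi>(2) v by simp
    qed
    then show ?thesis using \<chi>(1) by blast
  qed
  moreover have "\<forall>v<N. spread N adj S p k v \<le> 2 \<and> (\<not> S v \<longrightarrow> spread N adj S p k v = 0)"
    using inv kp by (auto simp: coloring_inv_def spread_def)
  moreover have "\<forall>v<N. S v \<and> (d(p := 1)) v \<noteq> 0 \<longrightarrow> spread N adj S p k v \<noteq> 0 \<and>
      (\<forall>w<N. S w \<and> adj v w \<longrightarrow> spread N adj S p k w \<noteq> 0)"
    using inv p kp by (auto simp: coloring_inv_def spread_def)
  moreover have "{v. v < N \<and> S v \<and> d v = 0} = insert p {v. v < N \<and> S v \<and> (d(p := 1)) v = 0}"
    using p by auto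
  then have "card {v. v < N \<and> S v \<and> d v = 0} = Suc (card {v. v < N \<and> S v \<and> (d(p := 1)) v = 0})" by simp
  then have "card {v. v < N \<and> S v \<and> (d(p := 1)) v = 0} + Suc s \<le> N"
    using inv by (simp add: coloring_inv_def)
  ultimately show ?thesis by (intro coloring_invI impI)
qed

lemma coloring_inv_final_nonzero:
  assumes inv: "coloring_inv N adj S N k d" and v: "v < N" "S v"
  shows "k v \<noteq> 0"
proof -
  have "card {v. v < N \<and> S v \<and> d v = 0} = 0" using coloring_invD(4)[OF inv] by simp
  then have "d v \<noteq> 0" using v by simp
  then show ?thesis using coloring_invD(3)[OF inv] v by simp
qed

lemma coloring_inv_final:
  assumes inv: "coloring_inv N adj S N k d" and ex: "\<exists>\<chi>. bipartition N adj S \<chi>"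
    and vw: "v < N" "w < N" "S v" "S w" "adj v w"
  shows "k v \<noteq> k w"
proof -
  obtain \<chi> where \<chi>: "bipartition N adj S \<chi>" "\<And>v. v < N \<Longrightarrow> S v \<Longrightarrow> k v \<noteq> 0 \<Longrightarrow> k v = 1 \<longleftrightarrow> \<chi> v"
    using mp[OF coloring_invD(2)[OF inv] ex] by blast
  then have "\<chi> v \<noteq> \<chi> w" using vw by (auto simp: bipartition_def)
  then show ?thesis
    using \<chi>(2)[of v] \<chi>(2)[of w] coloring_inv_final_nonzero[OF inv] vw by auto
qed

section \<open>Programs for the propagation of colours\<close>

definition clear_prog :: com where
  "clear_prog = for_loop ''v'' ''N''
     (Seq (set_elt ''k'' (var ''v'') (IConst 0)) (set_elt ''d'' (var ''v'') (IConst 0)))"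

lemma wp_clear_prog:
  assumes N: "\<sigma> ''N'' 0 0 = N" "1 \<le> N"
  shows "wp \<rho> (3 * N ^ Suc 0) clear_prog (\<lambda>\<sigma>'. unchanged {''v'', ''k'', ''d''} \<sigma> \<sigma>' \<and>
    (\<forall>v<N. \<sigma>' ''k'' v 0 = 0 \<and> \<sigma>' ''d'' v 0 = 0)) \<sigma>"
  unfolding clear_prog_def
proof (rule wp_for[where N = N and X = "{''v'', ''k'', ''d''}" and C = 0
      and I = "\<lambda>i \<sigma>'. \<forall>v<i. \<sigma>' ''k'' v 0 = 0 \<and> \<sigma>' ''d'' v 0 = 0"])
  fix v and \<sigma>1 :: istore
  assume "\<forall>u<v. \<sigma>1 ''k'' u 0 = 0 \<and> \<sigma>1 ''d'' u 0 = 0" "\<sigma>1 ''v'' 0 0 = v"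
  then show "wp \<rho> (0 * N ^ 0) (Seq (set_elt ''k'' (var ''v'') (IConst 0)) (set_elt ''d'' (var ''v'') (IConst 0)))
      (\<lambda>\<sigma>'. unchanged ({''v'', ''k'', ''d''} - {''v''}) \<sigma>1 \<sigma>' \<and>
        (\<forall>u<Suc v. \<sigma>' ''k'' u 0 = 0 \<and> \<sigma>' ''d'' u 0 = 0)) \<sigma>1"
    by (intro wp_steps) (simp_all add: unchanged_def upd_apply upd_other All_less_Suc)
qed (use N in \<open>auto simp: upd_apply\<close>)

text \<open>The value N of \<open>p\<close> means that no candidate has been found. A found
  candidate is replaced only by a coloured vertex, so an uncoloured one survives only if no coloured
  vertex is waiting.\<close>

definition pick_body :: com where
  "pick_body = Cond (BAnd (ILess (IConst 1) (elt ''M'' (var ''v''))) (BAnd (ILess (elt ''d'' (var ''v'')) (IConst 1))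
       (BNot (BAnd (ILess (var ''p'') (var ''N'')) (ILess (elt ''k'' (var ''v'')) (IConst 1))))))
     (set_var ''p'' (var ''v'')) Skip"

definition pick_prog :: com where
  "pick_prog = Seq (set_var ''p'' (var ''N'')) (for_loop ''v'' ''N'' pick_body)"

lemma wp_pick_prog:
  assumes N: "\<sigma> ''N'' 0 0 = N" "1 \<le> N" and M: "\<And>v. v < N \<Longrightarrow> 1 < \<sigma> ''M'' v 0 \<longleftrightarrow> S v"
  shows "wp \<rho> (7 * N ^ Suc 0) pick_prog (\<lambda>\<sigma>'. unchanged {''v'', ''p''} \<sigma> \<sigma>' \<and>
    (if \<sigma>' ''p'' 0 0 < N then pickable N S (\<lambda>v. \<sigma> ''k'' v 0) (\<lambda>v. \<sigma> ''d'' v 0) (\<sigma>' ''p'' 0 0)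
     else \<forall>u<N. \<not> (S u \<and> \<sigma> ''d'' u 0 = 0))) \<sigma>"
proof -
  let ?\<sigma> = "upd \<sigma> ''p'' 0 0 N"
  define k where "k = (\<lambda>v. \<sigma> ''k'' v 0)"
  define d where "d = (\<lambda>v. \<sigma> ''d'' v 0)"
  define I where "I i \<sigma>' \<longleftrightarrow> (if \<sigma>' ''p'' 0 0 < N then pickable i S k d (\<sigma>' ''p'' 0 0)
     else \<forall>u<i. \<not> (S u \<and> d u = 0))" for i and \<sigma>' :: istore
  have "wp \<rho> (7 * N ^ Suc 0) (for_loop ''v'' ''N'' pick_body)
    (\<lambda>\<sigma>'. unchanged {''v'', ''p''} \<sigma> \<sigma>' \<and> I N \<sigma>') ?\<sigma>"
  proof (rule wp_for[where N = N and X = "{''v'', ''p''}" and C = 4 and I = I])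
    fix v and \<sigma>1 :: istore
    assume v: "v < N" "unchanged {''v'', ''p''} ?\<sigma> \<sigma>1" "I v \<sigma>1" "\<sigma>1 ''v'' 0 0 = v"
    have "\<sigma>1 ''N'' = \<sigma> ''N''" "\<sigma>1 ''M'' = \<sigma> ''M''" "\<sigma>1 ''k'' = \<sigma> ''k''" "\<sigma>1 ''d'' = \<sigma> ''d''"
      using v(2) by (simp_all add: unchanged_def upd_other)
    then have step: "steps pick_body \<rho> \<sigma>1 =
        (if S v \<and> d v = 0 \<and> \<not> (\<sigma>1 ''p'' 0 0 < N \<and> k v = 0) then upd \<sigma>1 ''p'' 0 0 v else \<sigma>1)"
      using v(4) N(1) M[OF v(1)] by (auto simp: pick_body_def k_def d_def)
    have "I (Suc v) (steps pick_body \<rho> \<sigma>1)"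
    proof (cases "S v \<and> d v = 0 \<and> \<not> (\<sigma>1 ''p'' 0 0 < N \<and> k v = 0)")
      case True
      have "k u = 0" if "k v = 0" "u < Suc v" "S u" "d u = 0" for u
      proof (cases "u = v")
        case False
        have "\<forall>u<v. \<not> (S u \<and> d u = 0)" using True v(3) that(1) by (simp add: I_def)
        then show ?thesis using that False by (auto simp: less_Suc_eq)
      qed (use that in simp)
      then have "pickable (Suc v) S k d v" using True by (simp add: pickable_def)
      then show ?thesis using True v(1) by (simp add: I_def step upd_apply)
    next
      case False
      then show ?thesis unfolding step using v(3)
        by (auto simp: I_def pickable_def less_Suc_eq)
    qed
    moreover have "unchanged ({''v'', ''p''} - {''v''}) \<sigma>1 (steps pick_body \<rho> \<sigma>1)"
      unfolding step by (simp add: unchanged_def upd_other)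
    moreover have "loop_free pick_body" "max_ops pick_body \<le> 4 * N ^ 0"
      by (simp_all add: pick_body_def)
    ultimately show "wp \<rho> (4 * N ^ 0) pick_body
        (\<lambda>\<sigma>'. unchanged ({''v'', ''p''} - {''v''}) \<sigma>1 \<sigma>' \<and> I (Suc v) \<sigma>') \<sigma>1"
      by (intro wp_steps conjI)
  qed (use N in \<open>auto simp: I_def upd_apply unchanged_def upd_other\<close>)
  then show ?thesis unfolding pick_prog_def I_def k_def d_def
    using N(1) by - (rule wp_steps_Seq, simp_all)
qed

definition spread_body :: com where
  "spread_body = Cond (BAnd (ILess (IConst 1) (elt ''M'' (var ''w'')))
       (BAnd (ILess (IConst 0) (IGet ''G'' (var ''p'') (var ''w''))) (ILess (elt ''k'' (var ''w'')) (IConst 1))))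
     (set_elt ''k'' (var ''w'') (ISub (IConst 3) (elt ''k'' (var ''p'')))) Skip"

definition start_prog :: com where
  "start_prog = Seq (Cond (ILess (elt ''k'' (var ''p'')) (IConst 1)) (set_elt ''k'' (var ''p'') (IConst 1)) Skip)
     (set_elt ''d'' (var ''p'') (IConst 1))"

lemma wp_spread:
  assumes N: "\<sigma> ''N'' 0 0 = N" "1 \<le> N" and M: "\<And>v. v < N \<Longrightarrow> 1 < \<sigma> ''M'' v 0 \<longleftrightarrow> S v"
    and G: "\<And>v w. v < N \<Longrightarrow> w < N \<Longrightarrow> \<sigma> ''G'' v w = of_bool (adj v w)"
    and p: "\<sigma> ''p'' 0 0 = p" "p < N" "\<sigma> ''k'' p 0 \<noteq> 0"
  shows "wp \<rho> (7 * N ^ Suc 0) (for_loop ''w'' ''N'' spread_body) (\<lambda>\<sigma>'. unchanged {''w'', ''k''} \<sigma> \<sigma>' \<and>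
    (\<forall>v. \<sigma>' ''k'' v 0 = spread N adj S p (\<lambda>v. \<sigma> ''k'' v 0) v)) \<sigma>"
proof -
  define k where "k = (\<lambda>v. \<sigma> ''k'' v 0)"
  let ?I = "\<lambda>i \<sigma>' :: istore. \<forall>v. \<sigma>' ''k'' v 0 = spread i adj S p k v"
  have "wp \<rho> (7 * N ^ Suc 0) (for_loop ''w'' ''N'' spread_body) (\<lambda>\<sigma>'. unchanged {''w'', ''k''} \<sigma> \<sigma>' \<and> ?I N \<sigma>') \<sigma>"
  proof (rule wp_for[where N = N and X = "{''w'', ''k''}" and C = 4 and I = ?I])
    fix w and \<sigma>1 :: istore
    assume w: "w < N" "unchanged {''w'', ''k''} \<sigma> \<sigma>1" "?I w \<sigma>1" "\<sigma>1 ''w'' 0 0 = w"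
    have eq: "\<sigma>1 ''p'' = \<sigma> ''p''" "\<sigma>1 ''M'' = \<sigma> ''M''" "\<sigma>1 ''G'' = \<sigma> ''G''"
      using w(2) by (simp_all add: unchanged_def)
    \<comment> \<open>Vertex p keeps its colour during the loop, because only uncoloured vertices
      are written.\<close>
    have kw: "\<sigma>1 ''k'' w 0 = k w" "\<sigma>1 ''k'' p 0 = k p"
      using w(3) p(3) by (simp_all add: spread_def k_def)
    have step: "steps spread_body \<rho> \<sigma>1 =
        (if S w \<and> adj p w \<and> k w = 0 then upd \<sigma>1 ''k'' w 0 (3 - k p) else \<sigma>1)"
      using w(4) p G[OF p(2) w(1)] M[OF w(1)] by (simp add: spread_body_def eq kw numeral_3_eq_3)
    have "?I (Suc w) (steps spread_body \<rho> \<sigma>1)"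
      unfolding step using w(3) by (auto simp: spread_def less_Suc_eq upd_apply)
    moreover have "unchanged ({''w'', ''k''} - {''w''}) \<sigma>1 (steps spread_body \<rho> \<sigma>1)"
      unfolding step by (simp add: unchanged_def upd_other)
    moreover have "loop_free spread_body" "max_ops spread_body \<le> 4 * N ^ 0"
      by (simp_all add: spread_body_def)
    ultimately show "wp \<rho> (4 * N ^ 0) spread_body
        (\<lambda>\<sigma>'. unchanged ({''w'', ''k''} - {''w''}) \<sigma>1 \<sigma>' \<and> ?I (Suc w) \<sigma>') \<sigma>1"
      by (intro wp_steps conjI)
  qed (use N in \<open>auto simp: upd_apply spread_def k_def\<close>)
  then show ?thesis by (simp only: k_def)
qed

definition round_prog :: com where
  "round_prog = Seq pick_prog (Cond (ILess (var ''p'') (var ''N''))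
     (Seq start_prog (for_loop ''w'' ''N'' spread_body)) Skip)"

lemma wp_round_prog:
  assumes N: "\<sigma> ''N'' 0 0 = N" "1 \<le> N" and M: "\<And>v. v < N \<Longrightarrow> 1 < \<sigma> ''M'' v 0 \<longleftrightarrow> S v"
    and G: "\<And>v w. v < N \<Longrightarrow> w < N \<Longrightarrow> \<sigma> ''G'' v w = of_bool (adj v w)"
    and sym: "\<And>v w. v < N \<Longrightarrow> w < N \<Longrightarrow> adj v w \<longleftrightarrow> adj w v"
    and inv: "coloring_inv N adj S s (\<lambda>v. \<sigma> ''k'' v 0) (\<lambda>v. \<sigma> ''d'' v 0)" "s < N"
  shows "wp \<rho> (16 * N ^ Suc 0) round_prog (\<lambda>\<sigma>'. unchanged {''v'', ''w'', ''p'', ''k'', ''d''} \<sigma> \<sigma>' \<and>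
    coloring_inv N adj S (Suc s) (\<lambda>v. \<sigma>' ''k'' v 0) (\<lambda>v. \<sigma>' ''d'' v 0)) \<sigma>"
  unfolding round_prog_def
proof (rule wp_Seq[where U = "9 * N ^ Suc 0", OF wp_mono[OF wp_pick_prog[where N = N and S = S] order_refl]])
  fix \<sigma>1 :: istore
  let ?k = "\<lambda>v. \<sigma> ''k'' v 0" and ?d = "\<lambda>v. \<sigma> ''d'' v 0" and ?p = "\<sigma>1 ''p'' 0 0"
  let ?Q = "\<lambda>\<sigma>' :: istore. unchanged {''v'', ''w'', ''p'', ''k'', ''d''} \<sigma> \<sigma>' \<and>
    coloring_inv N adj S (Suc s) (\<lambda>v. \<sigma>' ''k'' v 0) (\<lambda>v. \<sigma>' ''d'' v 0)"
  assume *: "unchanged {''v'', ''p''} \<sigma> \<sigma>1 \<and> (if ?p < N then pickable N S ?k ?d ?p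
     else \<forall>u<N. \<not> (S u \<and> \<sigma> ''d'' u 0 = 0))"
  have eq: "\<sigma>1 ''N'' = \<sigma> ''N''" "\<sigma>1 ''k'' = \<sigma> ''k''" "\<sigma>1 ''d'' = \<sigma> ''d''" "\<sigma>1 ''M'' = \<sigma> ''M''" "\<sigma>1 ''G'' = \<sigma> ''G''"
    using * by (simp_all add: unchanged_def)
  show "wp \<rho> (9 * N ^ Suc 0) (Cond (ILess (var ''p'') (var ''N''))
     (Seq start_prog (for_loop ''w'' ''N'' spread_body)) Skip) ?Q \<sigma>1"
  proof (rule wp_Cond[where T = "8 * N ^ Suc 0"])
    assume "bval (ILess (var ''p'') (var ''N'')) (\<sigma>1, \<rho>)"
    then have p: "?p < N" using N eq by simp
    with * have pick: "pickable N S ?k ?d ?p" by simp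
    define \<sigma>2 where "\<sigma>2 = steps start_prog \<rho> \<sigma>1"
    have step: "unchanged {''k'', ''d''} \<sigma>1 \<sigma>2" "(\<lambda>v. \<sigma>2 ''k'' v 0) = start ?k ?p" "(\<lambda>v. \<sigma>2 ''d'' v 0) = ?d(?p := 1)"
      by (auto simp: \<sigma>2_def start_prog_def start_def unchanged_def upd_def eq fun_eq_iff)
    have start: "coloring_inv N adj S s (start ?k ?p) ?d"
      by (rule coloring_inv_start[OF inv(1) pick sym])
    have "wp \<rho> (7 * N ^ Suc 0) (for_loop ''w'' ''N'' spread_body) ?Q \<sigma>2"
    proof (rule wp_mono[OF wp_spread[where N = N and S = S and adj = adj and p = ?p] order_refl])
      fix \<sigma>3 :: istore
      assume 3: "unchanged {''w'', ''k''} \<sigma>2 \<sigma>3 \<and> (\<forall>v. \<sigma>3 ''k'' v 0 = spread N adj S ?p (\<lambda>v. \<sigma>2 ''k'' v 0) v)"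
      have "coloring_inv N adj S (Suc s) (spread N adj S ?p (start ?k ?p)) (?d(?p := 1))"
        by (rule coloring_inv_spread[OF start]) (use pick in \<open>auto simp: pickable_def start_def\<close>)
      moreover have "(\<lambda>v. \<sigma>3 ''k'' v 0) = spread N adj S ?p (start ?k ?p)"
        using 3 step(2) by auto
      moreover have "(\<lambda>v. \<sigma>3 ''d'' v 0) = ?d(?p := 1)"
        using 3 step(3) by (simp add: unchanged_def)
      moreover have "unchanged {''v'', ''w'', ''p'', ''k'', ''d''} \<sigma> \<sigma>3"
        using 3 step(1) * by (simp add: unchanged_def)
      ultimately show "?Q \<sigma>3" by simp
    next
      have "start ?k ?p ?p \<noteq> 0" by (simp add: start_def)
      then show "\<sigma>2 ''k'' ?p 0 \<noteq> 0" by (metis step(2))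
    qed (use step(1) N M G p in \<open>simp_all add: unchanged_def eq\<close>)
    then show "wp \<rho> (8 * N ^ Suc 0) (Seq start_prog (for_loop ''w'' ''N'' spread_body)) ?Q \<sigma>1"
      unfolding \<sigma>2_def using N(2)
      by (intro wp_Seq[where T = 1 and U = "7 * N ^ Suc 0", OF wp_steps]) (simp_all add: start_prog_def)
  next
    assume "\<not> bval (ILess (var ''p'') (var ''N'')) (\<sigma>1, \<rho>)"
    then have "\<not> ?p < N" using N eq by simp
    with * have "\<forall>u<N. \<not> (S u \<and> \<sigma> ''d'' u 0 = 0)" by simp
    from coloring_inv_done[OF inv(1) this inv(2)]
    have "coloring_inv N adj S (Suc s) (\<lambda>v. \<sigma>1 ''k'' v 0) (\<lambda>v. \<sigma>1 ''d'' v 0)" by (simp add: eq)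
    then show "wp \<rho> (8 * N ^ Suc 0) Skip ?Q \<sigma>1"
      using * by (intro wp_steps) (simp_all add: unchanged_def)
  qed (use N in simp)
qed (use N M in auto)

text \<open>Colour 0 is both the class of the vertices marked 1 and the initial value. The final check thus
  also rejects vertices that have been left uncoloured but would need a colour.\<close>

definition check_body :: com where
  "check_body = Cond (BAnd (ILess (IConst 0) (elt ''M'' (var ''v''))) (BAnd (ILess (IConst 0) (elt ''M'' (var ''w'')))
       (BAnd (ILess (IConst 0) (IGet ''G'' (var ''v'') (var ''w'')))
       (BAnd (BNot (ILess (elt ''k'' (var ''v'')) (elt ''k'' (var ''w''))))
             (BNot (ILess (elt ''k'' (var ''w'')) (elt ''k'' (var ''v''))))))))
     (set_var ''o'' (IConst 0)) Skip"

definition check_prog :: com where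
  "check_prog = Seq (set_var ''o'' (IConst 1)) (for_loop ''v'' ''N'' (for_loop ''w'' ''N'' check_body))"

lemma wp_check_prog:
  assumes N: "\<sigma> ''N'' 0 0 = N" "1 \<le> N" and M: "\<And>v. v < N \<Longrightarrow> 0 < \<sigma> ''M'' v 0 \<longleftrightarrow> U v"
    and G: "\<And>v w. v < N \<Longrightarrow> w < N \<Longrightarrow> \<sigma> ''G'' v w = of_bool (adj v w)"
  shows "wp \<rho> (11 * N ^ Suc (Suc 0)) check_prog (\<lambda>\<sigma>'. unchanged {''v'', ''w'', ''o''} \<sigma> \<sigma>' \<and>
    (0 < \<sigma>' ''o'' 0 0 \<longleftrightarrow> (\<forall>v<N. \<forall>w<N. U v \<and> U w \<and> adj v w \<longrightarrow> \<sigma> ''k'' v 0 \<noteq> \<sigma> ''k'' w 0))) \<sigma>"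
proof -
  let ?\<sigma> = "upd \<sigma> ''o'' 0 0 1"
  define R where "R v w \<longleftrightarrow> (U v \<and> U w \<and> adj v w \<longrightarrow> \<sigma> ''k'' v 0 \<noteq> \<sigma> ''k'' w 0)" for v w
  have "wp \<rho> (11 * N ^ Suc (Suc 0)) (for_loop ''v'' ''N'' (for_loop ''w'' ''N'' check_body))
    (\<lambda>\<sigma>'. unchanged {''v'', ''w'', ''o''} \<sigma> \<sigma>' \<and> (0 < \<sigma>' ''o'' 0 0 \<longleftrightarrow> (\<forall>v<N. \<forall>w<N. R v w))) ?\<sigma>"
  proof (rule wp_for[where N = N and X = "{''v'', ''w'', ''o''}" and C = 8
        and I = "\<lambda>i \<sigma>'. 0 < \<sigma>' ''o'' 0 0 \<longleftrightarrow> (\<forall>v<i. \<forall>w<N. R v w)"])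
    fix v and \<sigma>1 :: istore
    assume v: "v < N" "unchanged {''v'', ''w'', ''o''} ?\<sigma> \<sigma>1" "0 < \<sigma>1 ''o'' 0 0 \<longleftrightarrow> (\<forall>y<v. \<forall>w<N. R y w)"
      "\<sigma>1 ''v'' 0 0 = v"
    show "wp \<rho> (8 * N ^ Suc 0) (for_loop ''w'' ''N'' check_body)
      (\<lambda>\<sigma>'. unchanged ({''v'', ''w'', ''o''} - {''v''}) \<sigma>1 \<sigma>' \<and>
        (0 < \<sigma>' ''o'' 0 0 \<longleftrightarrow> (\<forall>y<Suc v. \<forall>w<N. R y w))) \<sigma>1"
    proof (rule wp_for[where N = N and X = "{''w'', ''o''}" and C = 5
        and I = "\<lambda>i \<sigma>'. 0 < \<sigma>' ''o'' 0 0 \<longleftrightarrow> (\<forall>y<v. \<forall>w<N. R y w) \<and> (\<forall>w<i. R v w)"])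
      fix w and \<sigma>2 :: istore
      assume w: "w < N" "unchanged {''w'', ''o''} \<sigma>1 \<sigma>2" "\<sigma>2 ''w'' 0 0 = w"
        "0 < \<sigma>2 ''o'' 0 0 \<longleftrightarrow> (\<forall>y<v. \<forall>w<N. R y w) \<and> (\<forall>y<w. R v y)"
      have "\<sigma>2 ''v'' 0 0 = v" "\<sigma>2 ''M'' = \<sigma> ''M''" "\<sigma>2 ''G'' = \<sigma> ''G''" "\<sigma>2 ''k'' = \<sigma> ''k''"
        using v w(2) by (simp_all add: unchanged_def upd_other)
      then have step: "steps check_body \<rho> \<sigma>2 = (if R v w then \<sigma>2 else upd \<sigma>2 ''o'' 0 0 0)"
        using w(3) G[OF v(1) w(1)] M[OF v(1)] M[OF w(1)] by (auto simp: check_body_def R_def)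
      show "wp \<rho> (5 * N ^ 0) check_body (\<lambda>\<sigma>'. unchanged ({''w'', ''o''} - {''w''}) \<sigma>2 \<sigma>' \<and>
          (0 < \<sigma>' ''o'' 0 0 \<longleftrightarrow> (\<forall>y<v. \<forall>w<N. R y w) \<and> (\<forall>y<Suc w. R v y))) \<sigma>2"
      proof (rule wp_steps)
        show "unchanged ({''w'', ''o''} - {''w''}) \<sigma>2 (steps check_body \<rho> \<sigma>2) \<and>
          (0 < steps check_body \<rho> \<sigma>2 ''o'' 0 0 \<longleftrightarrow> (\<forall>y<v. \<forall>w<N. R y w) \<and> (\<forall>y<Suc w. R v y))"
          unfolding step All_less_Suc using w(4)
          by (cases "R v w") (simp_all add: unchanged_def upd_apply upd_other)
      qed (simp_all add: check_body_def)
    next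
      fix \<sigma>' assume "unchanged {''w'', ''o''} \<sigma>1 \<sigma>'" "0 < \<sigma>' ''o'' 0 0 \<longleftrightarrow> (\<forall>y<v. \<forall>w<N. R y w) \<and> (\<forall>w<N. R v w)"
      then show "unchanged ({''v'', ''w'', ''o''} - {''v''}) \<sigma>1 \<sigma>' \<and>
        (0 < \<sigma>' ''o'' 0 0 \<longleftrightarrow> (\<forall>y<Suc v. \<forall>w<N. R y w))"
        unfolding All_less_Suc by (auto simp: unchanged_def)
    qed (use v N in \<open>auto simp: unchanged_def upd_apply\<close>)
  qed (use N in \<open>auto simp: unchanged_def upd_apply upd_other\<close>)
  then show ?thesis unfolding check_prog_def R_def by - (rule wp_steps_Seq, simp_all)
qed

section \<open>Testing one guess of the first class\<close>

lemma cost_add: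
  fixes a b c i j d N :: nat
  assumes "a + b \<le> c" "i \<le> d" "j \<le> d" "1 \<le> N"
  shows "a * N ^ i + b * N ^ j \<le> c * N ^ d"
proof -
  have "a * N ^ i + b * N ^ j \<le> a * N ^ d + b * N ^ d"
    using assms by (intro add_mono cost_mono) auto
  also have "\<dots> = (a + b) * N ^ d" by (simp add: algebra_simps)
  also have "\<dots> \<le> c * N ^ d" using assms(1) by (rule mult_le_mono1)
  finally show ?thesis .
qed

definition color_prog :: com where
  "color_prog = Seq clear_prog (Seq (for_loop ''s'' ''N'' round_prog) (Seq check_prog
     (Cond (ILess (IConst 0) (var ''o'')) (set_var ''f'' (IConst 1)) Skip)))"

text \<open>A positive answer is right for every \<open>P\<close>, since the actual colouring has
  been checked; if \<open>P\<close> splits \<open>U\<close>, the invariant makes the check succeed.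
  The flag \<open>f\<close> is only ever raised, so successive tests accumulate as a
  disjunction.\<close>

lemma wp_color_prog:
  assumes N: "\<sigma> ''N'' 0 0 = N" "1 \<le> N"
    and G: "\<And>v w. v < N \<Longrightarrow> w < N \<Longrightarrow> \<sigma> ''G'' v w = of_bool (adj v w)"
    and sym: "\<And>v w. v < N \<Longrightarrow> w < N \<Longrightarrow> adj v w \<longleftrightarrow> adj w v"
    and M: "\<And>w. w < N \<Longrightarrow> \<sigma> ''M'' w 0 = mark N adj U P w"
  shows "wp \<rho> (34 * N ^ Suc (Suc 0)) color_prog (\<lambda>\<sigma>'.
    unchanged {''v'', ''w'', ''s'', ''p'', ''k'', ''d'', ''o'', ''f''} \<sigma> \<sigma>' \<and>
    (\<exists>ok. \<sigma>' ''f'' 0 0 = (if ok then 1 else \<sigma> ''f'' 0 0) \<and>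
      (ok \<longrightarrow> colorable3 N adj U) \<and> (splits N adj U P \<longrightarrow> ok))) \<sigma>"
proof -
  let ?Q = "\<lambda>\<sigma>' :: istore. unchanged {''v'', ''w'', ''s'', ''p'', ''k'', ''d'', ''o'', ''f''} \<sigma> \<sigma>' \<and>
    (\<exists>ok. \<sigma>' ''f'' 0 0 = (if ok then 1 else \<sigma> ''f'' 0 0) \<and>
      (ok \<longrightarrow> colorable3 N adj U) \<and> (splits N adj U P \<longrightarrow> ok))"
  define S where "S v \<longleftrightarrow> U v \<and> \<not> far N adj P v" for v
  have MS: "1 < \<sigma> ''M'' v 0 \<longleftrightarrow> S v" "0 < \<sigma> ''M'' v 0 \<longleftrightarrow> U v" if "v < N" for v
    using M[OF that] by (auto simp: mark_def S_def)
  have fin: "wp \<rho> (12 * N ^ Suc (Suc 0)) (Seq check_prog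
      (Cond (ILess (IConst 0) (var ''o'')) (set_var ''f'' (IConst 1)) Skip)) ?Q \<sigma>2"
    if un2: "unchanged {''v'', ''w'', ''s'', ''p'', ''k'', ''d''} \<sigma> \<sigma>2"
      and inv: "coloring_inv N adj S N (\<lambda>v. \<sigma>2 ''k'' v 0) (\<lambda>v. \<sigma>2 ''d'' v 0)" for \<sigma>2
  proof (rule wp_Seq[where U = "1 * N ^ 0", OF wp_mono[OF wp_check_prog[where N = N and U = U and adj = adj] order_refl]])
    fix \<sigma>3 :: istore
    let ?proper = "\<forall>v<N. \<forall>w<N. U v \<and> U w \<and> adj v w \<longrightarrow> \<sigma>2 ''k'' v 0 \<noteq> \<sigma>2 ''k'' w 0"
    assume 3: "unchanged {''v'', ''w'', ''o''} \<sigma>2 \<sigma>3 \<and> (0 < \<sigma>3 ''o'' 0 0 \<longleftrightarrow> ?proper)"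
    have un3: "unchanged {''v'', ''w'', ''s'', ''p'', ''k'', ''d'', ''o'', ''f''} \<sigma> \<sigma>3"
      using 3 un2 by (simp add: unchanged_def)
    have "\<sigma>3 ''f'' = \<sigma> ''f''" using 3 un2 by (simp add: unchanged_def)
    have colorable: "colorable3 N adj U" if ?proper
    proof -
      have "\<sigma>2 ''k'' v 0 < 3" if "v < N" for v
        using coloring_invD(1)[OF inv] that by (simp add: less_Suc_eq_le numeral_3_eq_3 numeral_2_eq_2)
      then show ?thesis unfolding colorable3_def using \<open>?proper\<close>
        by (intro exI[of _ "\<lambda>v. \<sigma>2 ''k'' v 0"]) blast
    qed
    have proper: ?proper if "splits N adj U P"
    proof (intro allI impI, elim conjE)
      fix v w assume vw: "v < N" "w < N" "U v" "U w" "adj v w"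
      have "\<exists>\<chi>. bipartition N adj S \<chi>"
        using conjunct2[OF that[unfolded splits_def]] unfolding bipartition_def S_def by blast
      note final = coloring_inv_final[OF inv this vw(1,2) _ _ vw(5)]
      have zero: "\<And>u. u < N \<Longrightarrow> \<not> S u \<Longrightarrow> \<sigma>2 ''k'' u 0 = 0"
        using coloring_invD(1)[OF inv] by blast
      \<comment> \<open>Adjacent vertices of \<open>U\<close> are not both far. If exactly one is,
        it still has the initial colour 0, while the other has been coloured 1 or 2.\<close>
      have "S v \<or> S w" using conjunct1[OF that[unfolded splits_def]] vw unfolding S_def by blast
      then show "\<sigma>2 ''k'' v 0 \<noteq> \<sigma>2 ''k'' w 0"
        using final zero[OF vw(1)] zero[OF vw(2)]
          coloring_inv_final_nonzero[OF inv vw(1)] coloring_inv_final_nonzero[OF inv vw(2)] by metis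
    qed
    have colorable': "0 < \<sigma>3 ''o'' 0 0 \<Longrightarrow> colorable3 N adj U" using colorable 3 by blast
    have proper': "splits N adj U P \<Longrightarrow> 0 < \<sigma>3 ''o'' 0 0" using proper 3 by blast
    show "wp \<rho> (1 * N ^ 0) (Cond (ILess (IConst 0) (var ''o'')) (set_var ''f'' (IConst 1)) Skip) ?Q \<sigma>3"
    proof (rule wp_steps)
      show "?Q (steps (Cond (ILess (IConst 0) (var ''o'')) (set_var ''f'' (IConst 1)) Skip) \<rho> \<sigma>3)"
      proof
        show "unchanged {''v'', ''w'', ''s'', ''p'', ''k'', ''d'', ''o'', ''f''} \<sigma>
          (steps (Cond (ILess (IConst 0) (var ''o'')) (set_var ''f'' (IConst 1)) Skip) \<rho> \<sigma>3)"
          using un3 by (simp add: unchanged_def upd_other)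
        show "\<exists>ok. steps (Cond (ILess (IConst 0) (var ''o'')) (set_var ''f'' (IConst 1)) Skip) \<rho> \<sigma>3 ''f'' 0 0 =
            (if ok then 1 else \<sigma> ''f'' 0 0) \<and> (ok \<longrightarrow> colorable3 N adj U) \<and> (splits N adj U P \<longrightarrow> ok)"
          using colorable' proper' \<open>\<sigma>3 ''f'' = \<sigma> ''f''\<close>
          by (intro exI[of _ "0 < \<sigma>3 ''o'' 0 0"]) (simp add: upd_apply)
      qed
    qed simp_all
  qed (use un2 N G MS in \<open>simp_all add: unchanged_def cost_add\<close>)
  have rounds: "wp \<rho> (31 * N ^ Suc (Suc 0)) (Seq (for_loop ''s'' ''N'' round_prog) (Seq check_prog
      (Cond (ILess (IConst 0) (var ''o'')) (set_var ''f'' (IConst 1)) Skip))) ?Q \<sigma>1"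
    if 1: "unchanged {''v'', ''k'', ''d''} \<sigma> \<sigma>1 \<and> (\<forall>v<N. \<sigma>1 ''k'' v 0 = 0 \<and> \<sigma>1 ''d'' v 0 = 0)" for \<sigma>1
  proof (rule wp_Seq[where T = "19 * N ^ Suc (Suc 0)" and U = "12 * N ^ Suc (Suc 0)"])
    let ?I = "\<lambda>i \<sigma>'. coloring_inv N adj S i (\<lambda>v. \<sigma>' ''k'' v 0) (\<lambda>v. \<sigma>' ''d'' v 0)"
    let ?X = "{''v'', ''w'', ''s'', ''p'', ''k'', ''d''}"
    show "wp \<rho> (19 * N ^ Suc (Suc 0)) (for_loop ''s'' ''N'' round_prog)
      (wp \<rho> (12 * N ^ Suc (Suc 0)) (Seq check_prog
        (Cond (ILess (IConst 0) (var ''o'')) (set_var ''f'' (IConst 1)) Skip)) ?Q) \<sigma>1"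
    proof (rule wp_for[where N = N and X = ?X and C = 16 and I = ?I])
      show "?I 0 \<sigma>1"
      proof (rule coloring_invI)
        show "card {v. v < N \<and> S v \<and> \<sigma>1 ''d'' v 0 = 0} + 0 \<le> N"
          using coloring_invD(4)[OF coloring_inv_0, of N S]
            card_mono[of "{..<N}" "{v. v < N \<and> S v \<and> \<sigma>1 ''d'' v 0 = 0}"] by auto
      qed (use 1 in auto)
      fix s and \<sigma>2 :: istore
      assume 2: "s < N" "unchanged ?X \<sigma>1 \<sigma>2" "?I s \<sigma>2" "\<sigma>2 ''s'' 0 0 = s"
      have eq: "\<sigma>2 ''N'' = \<sigma> ''N''" "\<sigma>2 ''M'' = \<sigma> ''M''" "\<sigma>2 ''G'' = \<sigma> ''G''"
        using 2(2) 1 by (simp_all add: unchanged_def)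
      show "wp \<rho> (16 * N ^ Suc 0) round_prog (\<lambda>\<sigma>'. unchanged (?X - {''s''}) \<sigma>2 \<sigma>' \<and> ?I (Suc s) \<sigma>') \<sigma>2"
        by (rule wp_mono[OF wp_round_prog[where N = N and S = S and adj = adj and s = s] order_refl])
          (use 2 N MS G sym in \<open>simp_all add: eq unchanged_def\<close>)
    next
      fix \<sigma>2 :: istore
      assume 2: "unchanged ?X \<sigma>1 \<sigma>2" "?I N \<sigma>2"
      then have "unchanged {''v'', ''w'', ''s'', ''p'', ''k'', ''d''} \<sigma> \<sigma>2"
        using 1 by (simp add: unchanged_def)
      then show "wp \<rho> (12 * N ^ Suc (Suc 0)) (Seq check_prog
          (Cond (ILess (IConst 0) (var ''o'')) (set_var ''f'' (IConst 1)) Skip)) ?Q \<sigma>2"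
        using 2(2) by (rule fin)
    qed (use 1 N in \<open>auto simp: unchanged_def upd_apply\<close>)
  qed (use N in simp)
  show ?thesis unfolding color_prog_def
    by (rule wp_Seq[OF wp_mono[OF wp_clear_prog[where \<sigma> = \<sigma> and N = N, OF N] order_refl rounds]], assumption)
      (use N in \<open>intro cost_add; simp\<close>)
qed

definition test_prog :: "bexp \<Rightarrow> com" where
  "test_prog L = Seq (split_prog L) color_prog"

lemma wp_test_prog:
  assumes N: "\<sigma> ''N'' 0 0 = N" "1 \<le> N"
    and G: "\<And>v w. v < N \<Longrightarrow> w < N \<Longrightarrow> \<sigma> ''G'' v w = of_bool (adj v w)"
    and sym: "\<And>v w. v < N \<Longrightarrow> w < N \<Longrightarrow> adj v w \<longleftrightarrow> adj w v"
    and U: "\<And>v. v < N \<Longrightarrow> \<sigma> ''U'' v 0 = of_bool (U v)"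
    and L: "\<And>\<sigma>'. unchanged {''w'', ''x'', ''M''} \<sigma> \<sigma>' \<Longrightarrow> \<sigma>' ''x'' 0 0 < N \<Longrightarrow> bval L (\<sigma>', \<rho>) \<longleftrightarrow> P (\<sigma>' ''x'' 0 0)"
    and bops: "bops L \<le> 2"
  shows "wp \<rho> (44 * N ^ Suc (Suc 0)) (test_prog L) (\<lambda>\<sigma>'.
    unchanged {''x'', ''M'', ''v'', ''w'', ''s'', ''p'', ''k'', ''d'', ''o'', ''f''} \<sigma> \<sigma>' \<and>
    (\<exists>ok. \<sigma>' ''f'' 0 0 = (if ok then 1 else \<sigma> ''f'' 0 0) \<and>
      (ok \<longrightarrow> colorable3 N adj U) \<and> (splits N adj U P \<longrightarrow> ok))) \<sigma>"
  unfolding test_prog_def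
proof (rule wp_Seq[where U = "34 * N ^ Suc (Suc 0)",
      OF wp_mono[OF wp_split_prog[where N = N and adj = adj and U = U and P = P] order_refl]])
  fix \<sigma>1 :: istore
  assume 1: "unchanged {''w'', ''x'', ''M''} \<sigma> \<sigma>1 \<and> (\<forall>w<N. \<sigma>1 ''M'' w 0 = mark N adj U P w)"
  have eq: "\<sigma>1 ''N'' = \<sigma> ''N''" "\<sigma>1 ''G'' = \<sigma> ''G''" "\<sigma>1 ''f'' = \<sigma> ''f''"
    using 1 by (simp_all add: unchanged_def)
  show "wp \<rho> (34 * N ^ Suc (Suc 0)) color_prog (\<lambda>\<sigma>'.
    unchanged {''x'', ''M'', ''v'', ''w'', ''s'', ''p'', ''k'', ''d'', ''o'', ''f''} \<sigma> \<sigma>' \<and>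
    (\<exists>ok. \<sigma>' ''f'' 0 0 = (if ok then 1 else \<sigma> ''f'' 0 0) \<and>
      (ok \<longrightarrow> colorable3 N adj U) \<and> (splits N adj U P \<longrightarrow> ok))) \<sigma>1"
  proof (rule wp_mono[OF wp_color_prog[where N = N and adj = adj and U = U and P = P] order_refl])
    fix \<sigma>2
    assume 2: "unchanged {''v'', ''w'', ''s'', ''p'', ''k'', ''d'', ''o'', ''f''} \<sigma>1 \<sigma>2 \<and>
      (\<exists>ok. \<sigma>2 ''f'' 0 0 = (if ok then 1 else \<sigma>1 ''f'' 0 0) \<and>
        (ok \<longrightarrow> colorable3 N adj U) \<and> (splits N adj U P \<longrightarrow> ok))"
    show "unchanged {''x'', ''M'', ''v'', ''w'', ''s'', ''p'', ''k'', ''d'', ''o'', ''f''} \<sigma> \<sigma>2 \<and>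
      (\<exists>ok. \<sigma>2 ''f'' 0 0 = (if ok then 1 else \<sigma> ''f'' 0 0) \<and>
        (ok \<longrightarrow> colorable3 N adj U) \<and> (splits N adj U P \<longrightarrow> ok))"
    proof
      show "unchanged {''x'', ''M'', ''v'', ''w'', ''s'', ''p'', ''k'', ''d'', ''o'', ''f''} \<sigma> \<sigma>2"
        using 1 2 by (simp add: unchanged_def)
    qed (use 2 in \<open>simp only: eq\<close>)
  qed (use 1 N G sym in \<open>simp_all add: eq\<close>)
qed (use N G U L bops in \<open>auto intro: cost_add\<close>)

section \<open>The decision program\<close>

definition eq_iexp :: "iexp \<Rightarrow> iexp \<Rightarrow> bexp" where
  "eq_iexp e f = BAnd (BNot (ILess e f)) (BNot (ILess f e))"

text \<open>Vertex e stands for its column, its row and itself, so one loop over all vertices covers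
  the three kinds of guesses. Repeating a column or row does not exceed the 3 N tests needed
  anyway.\<close>

definition search_body :: com where
  "search_body = Seq (test_prog (eq_iexp (elt ''c'' (var ''x'')) (elt ''c'' (var ''e''))))
     (Seq (test_prog (eq_iexp (elt ''r'' (var ''x'')) (elt ''r'' (var ''e''))))
       (test_prog (eq_iexp (var ''x'') (var ''e''))))"

definition search_prog :: com where
  "search_prog = Seq (set_var ''f'' (IConst 0)) (for_loop ''e'' ''N'' search_body)"

abbreviation test_vars :: "vname set" where
  "test_vars \<equiv> {''x'', ''M'', ''v'', ''w'', ''s'', ''p'', ''k'', ''d'', ''o'', ''f''}"

lemma wp_search_body:
  assumes N: "\<sigma> ''N'' 0 0 = N" "1 \<le> N"
    and G: "\<And>v w. v < N \<Longrightarrow> w < N \<Longrightarrow> \<sigma> ''G'' v w = of_bool (adj v w)"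
    and sym: "\<And>v w. v < N \<Longrightarrow> w < N \<Longrightarrow> adj v w \<longleftrightarrow> adj w v"
    and U: "\<And>v. v < N \<Longrightarrow> \<sigma> ''U'' v 0 = of_bool (U v)"
    and rc: "\<And>v. v < N \<Longrightarrow> \<sigma> ''r'' v 0 = r v \<and> \<sigma> ''c'' v 0 = c v"
    and e: "\<sigma> ''e'' 0 0 = e" "e < N"
  shows "wp \<rho> (132 * N ^ Suc (Suc 0)) search_body (\<lambda>\<sigma>'. unchanged test_vars \<sigma> \<sigma>' \<and>
    (\<exists>ok. \<sigma>' ''f'' 0 0 = (if ok then 1 else \<sigma> ''f'' 0 0) \<and> (ok \<longrightarrow> colorable3 N adj U) \<and>
      (splits N adj U (\<lambda>x. c x = c e) \<or> splits N adj U (\<lambda>x. r x = r e) \<or> splits N adj U (\<lambda>x. x = e) \<longrightarrow> ok))) \<sigma>"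
proof -
  \<comment> \<open>The frame refers to the common initial store \<sigma>, the flag to the current
    store \<sigma>'; this lets the three tests be chained.\<close>
  have test: "wp \<rho> (44 * N ^ Suc (Suc 0)) (test_prog (eq_iexp a b))
      (\<lambda>\<sigma>''. unchanged test_vars \<sigma> \<sigma>'' \<and> (\<exists>ok. \<sigma>'' ''f'' 0 0 = (if ok then 1 else \<sigma>' ''f'' 0 0) \<and>
        (ok \<longrightarrow> colorable3 N adj U) \<and> (splits N adj U P \<longrightarrow> ok))) \<sigma>'"
    if un: "unchanged test_vars \<sigma> \<sigma>'" and "iops a = 0" "iops b = 0"
      and P: "\<And>\<tau>. unchanged test_vars \<sigma> \<tau> \<Longrightarrow> \<tau> ''x'' 0 0 < N \<Longrightarrow>
        ival a (\<tau>, \<rho>) = ival b (\<tau>, \<rho>) \<longleftrightarrow> P (\<tau> ''x'' 0 0)" for a b P \<sigma>'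
  proof (rule wp_mono[OF wp_test_prog[where N = N and adj = adj and U = U and P = P] order_refl])
    have eq: "\<sigma>' ''N'' = \<sigma> ''N''" "\<sigma>' ''G'' = \<sigma> ''G''" "\<sigma>' ''U'' = \<sigma> ''U''"
      using un by (simp_all add: unchanged_def)
    show "\<sigma>' ''N'' 0 0 = N" "\<And>v w. v < N \<Longrightarrow> w < N \<Longrightarrow> \<sigma>' ''G'' v w = of_bool (adj v w)"
      "\<And>v. v < N \<Longrightarrow> \<sigma>' ''U'' v 0 = of_bool (U v)"
      using N G U by (simp_all add: eq)
    fix \<tau> assume \<tau>: "unchanged {''w'', ''x'', ''M''} \<sigma>' \<tau>" "\<tau> ''x'' 0 0 < N"
    then have "unchanged test_vars \<sigma> \<tau>" using un by (simp add: unchanged_def)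
    then have "ival a (\<tau>, \<rho>) = ival b (\<tau>, \<rho>) \<longleftrightarrow> P (\<tau> ''x'' 0 0)" using P \<tau>(2) by blast
    then show "bval (eq_iexp a b) (\<tau>, \<rho>) \<longleftrightarrow> P (\<tau> ''x'' 0 0)" by (auto simp: eq_iexp_def)
  next
    fix \<sigma>''
    assume *: "unchanged test_vars \<sigma>' \<sigma>'' \<and> (\<exists>ok. \<sigma>'' ''f'' 0 0 = (if ok then 1 else \<sigma>' ''f'' 0 0) \<and>
        (ok \<longrightarrow> colorable3 N adj U) \<and> (splits N adj U P \<longrightarrow> ok))"
    then show "unchanged test_vars \<sigma> \<sigma>'' \<and> (\<exists>ok. \<sigma>'' ''f'' 0 0 = (if ok then 1 else \<sigma>' ''f'' 0 0) \<and>
        (ok \<longrightarrow> colorable3 N adj U) \<and> (splits N adj U P \<longrightarrow> ok))"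
      using unchanged_trans[OF un, of test_vars \<sigma>''] by blast
  qed (use that N sym in \<open>simp_all add: eq_iexp_def\<close>)
  have frame: "\<tau> ''c'' = \<sigma> ''c''" "\<tau> ''r'' = \<sigma> ''r''" "\<tau> ''e'' = \<sigma> ''e''" if "unchanged test_vars \<sigma> \<tau>" for \<tau>
    using that by (simp_all add: unchanged_def)
  let ?Q = "\<lambda>\<sigma>'. unchanged test_vars \<sigma> \<sigma>' \<and>
    (\<exists>ok. \<sigma>' ''f'' 0 0 = (if ok then 1 else \<sigma> ''f'' 0 0) \<and> (ok \<longrightarrow> colorable3 N adj U) \<and>
      (splits N adj U (\<lambda>x. c x = c e) \<or> splits N adj U (\<lambda>x. r x = r e) \<or> splits N adj U (\<lambda>x. x = e) \<longrightarrow> ok))"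
  show ?thesis unfolding search_body_def
  proof (rule wp_Seq[where U = "88 * N ^ Suc (Suc 0)", OF wp_mono[OF test[where P = "\<lambda>x. c x = c e"] order_refl]])
    fix \<sigma>1
    assume 1: "unchanged test_vars \<sigma> \<sigma>1 \<and> (\<exists>ok. \<sigma>1 ''f'' 0 0 = (if ok then 1 else \<sigma> ''f'' 0 0) \<and>
        (ok \<longrightarrow> colorable3 N adj U) \<and> (splits N adj U (\<lambda>x. c x = c e) \<longrightarrow> ok))"
    show "wp \<rho> (88 * N ^ Suc (Suc 0)) (Seq (test_prog (eq_iexp (elt ''r'' (var ''x'')) (elt ''r'' (var ''e''))))
       (test_prog (eq_iexp (var ''x'') (var ''e'')))) ?Q \<sigma>1"
    proof (rule wp_Seq[where U = "44 * N ^ Suc (Suc 0)", OF wp_mono[OF test[where P = "\<lambda>x. r x = r e"] order_refl]])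
      fix \<sigma>2
      assume 2: "unchanged test_vars \<sigma> \<sigma>2 \<and> (\<exists>ok. \<sigma>2 ''f'' 0 0 = (if ok then 1 else \<sigma>1 ''f'' 0 0) \<and>
        (ok \<longrightarrow> colorable3 N adj U) \<and> (splits N adj U (\<lambda>x. r x = r e) \<longrightarrow> ok))"
      show "wp \<rho> (44 * N ^ Suc (Suc 0)) (test_prog (eq_iexp (var ''x'') (var ''e''))) ?Q \<sigma>2"
      proof (rule wp_mono[OF test[where P = "\<lambda>x. x = e"] order_refl])
        fix \<sigma>3
        assume 3: "unchanged test_vars \<sigma> \<sigma>3 \<and> (\<exists>ok. \<sigma>3 ''f'' 0 0 = (if ok then 1 else \<sigma>2 ''f'' 0 0) \<and>
          (ok \<longrightarrow> colorable3 N adj U) \<and> (splits N adj U (\<lambda>x. x = e) \<longrightarrow> ok))"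
        obtain ok1 where ok1: "\<sigma>1 ''f'' 0 0 = (if ok1 then 1 else \<sigma> ''f'' 0 0)"
          "ok1 \<longrightarrow> colorable3 N adj U" "splits N adj U (\<lambda>x. c x = c e) \<longrightarrow> ok1" using 1 by blast
        obtain ok2 where ok2: "\<sigma>2 ''f'' 0 0 = (if ok2 then 1 else \<sigma>1 ''f'' 0 0)"
          "ok2 \<longrightarrow> colorable3 N adj U" "splits N adj U (\<lambda>x. r x = r e) \<longrightarrow> ok2" using 2 by blast
        obtain ok3 where ok3: "\<sigma>3 ''f'' 0 0 = (if ok3 then 1 else \<sigma>2 ''f'' 0 0)"
          "ok3 \<longrightarrow> colorable3 N adj U" "splits N adj U (\<lambda>x. x = e) \<longrightarrow> ok3" using 3 by blast
        show "?Q \<sigma>3"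
        proof
          show "\<exists>ok. \<sigma>3 ''f'' 0 0 = (if ok then 1 else \<sigma> ''f'' 0 0) \<and> (ok \<longrightarrow> colorable3 N adj U) \<and>
            (splits N adj U (\<lambda>x. c x = c e) \<or> splits N adj U (\<lambda>x. r x = r e) \<or> splits N adj U (\<lambda>x. x = e) \<longrightarrow> ok)"
            using ok1 ok2 ok3 by (intro exI[of _ "ok1 \<or> ok2 \<or> ok3"]) auto
        qed (use 3 in blast)
      qed (use conjunct1[OF 2] e in \<open>simp_all add: frame\<close>)
    qed (use conjunct1[OF 1] e rc in \<open>simp_all add: frame\<close>)
  next
    show "unchanged test_vars \<sigma> \<sigma>" by (rule unchanged_refl)
  qed (use e rc in \<open>simp_all add: frame\<close>)
qed

lemma wp_search_prog:
  assumes N: "\<sigma> ''N'' 0 0 = N" "1 \<le> N"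
    and G: "\<And>v w. v < N \<Longrightarrow> w < N \<Longrightarrow> \<sigma> ''G'' v w = of_bool (adj v w)"
    and sym: "\<And>v w. v < N \<Longrightarrow> w < N \<Longrightarrow> adj v w \<longleftrightarrow> adj w v"
    and U: "\<And>v. v < N \<Longrightarrow> \<sigma> ''U'' v 0 = of_bool (U v)"
    and rc: "\<And>v. v < N \<Longrightarrow> \<sigma> ''r'' v 0 = r v \<and> \<sigma> ''c'' v 0 = c v"
  shows "wp \<rho> (135 * N ^ Suc (Suc (Suc 0))) search_prog (\<lambda>\<sigma>'.
    (0 < \<sigma>' ''f'' 0 0 \<longrightarrow> colorable3 N adj U) \<and>
    ((\<exists>e<N. splits N adj U (\<lambda>x. c x = c e) \<or> splits N adj U (\<lambda>x. r x = r e) \<or> splits N adj U (\<lambda>x. x = e))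
       \<longrightarrow> 0 < \<sigma>' ''f'' 0 0)) \<sigma>"
proof -
  let ?ok = "\<lambda>e. splits N adj U (\<lambda>x. c x = c e) \<or> splits N adj U (\<lambda>x. r x = r e) \<or> splits N adj U (\<lambda>x. x = e)"
  let ?I = "\<lambda>i \<sigma>' :: istore. (0 < \<sigma>' ''f'' 0 0 \<longrightarrow> colorable3 N adj U) \<and> ((\<exists>e<i. ?ok e) \<longrightarrow> 0 < \<sigma>' ''f'' 0 0)"
  let ?X = "insert ''e'' test_vars"
  have "wp \<rho> (135 * N ^ Suc (Suc (Suc 0))) (for_loop ''e'' ''N'' search_body) (?I N) (upd \<sigma> ''f'' 0 0 0)"
  proof (rule wp_for[where N = N and X = ?X and C = 132 and I = ?I])
    fix e and \<sigma>1 :: istore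
    assume e: "e < N" "unchanged ?X (upd \<sigma> ''f'' 0 0 0) \<sigma>1" "?I e \<sigma>1" "\<sigma>1 ''e'' 0 0 = e"
    have eq: "\<sigma>1 ''N'' = \<sigma> ''N''" "\<sigma>1 ''G'' = \<sigma> ''G''" "\<sigma>1 ''U'' = \<sigma> ''U''" "\<sigma>1 ''r'' = \<sigma> ''r''" "\<sigma>1 ''c'' = \<sigma> ''c''"
      using e(2) by (simp_all add: unchanged_def upd_other)
    show "wp \<rho> (132 * N ^ Suc (Suc 0)) search_body
        (\<lambda>\<sigma>'. unchanged (?X - {''e''}) \<sigma>1 \<sigma>' \<and> ?I (Suc e) \<sigma>') \<sigma>1"
    proof (rule wp_mono[OF wp_search_body[where N = N and adj = adj and U = U and r = r and c = c and e = e] order_refl])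
      fix \<sigma>2
      assume 2: "unchanged test_vars \<sigma>1 \<sigma>2 \<and> (\<exists>ok. \<sigma>2 ''f'' 0 0 = (if ok then 1 else \<sigma>1 ''f'' 0 0) \<and>
        (ok \<longrightarrow> colorable3 N adj U) \<and> (?ok e \<longrightarrow> ok))"
      then obtain ok where ok: "\<sigma>2 ''f'' 0 0 = (if ok then 1 else \<sigma>1 ''f'' 0 0)"
        "ok \<longrightarrow> colorable3 N adj U" "?ok e \<longrightarrow> ok" by blast
      have col: "0 < \<sigma>2 ''f'' 0 0 \<longrightarrow> colorable3 N adj U"
        using conjunct1[OF e(3)] ok(1,2) by (cases ok) simp_all
      have "(\<exists>e'<Suc e. ?ok e') \<longrightarrow> 0 < \<sigma>2 ''f'' 0 0"
      proof
        assume "\<exists>e'<Suc e. ?ok e'"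
        then have "?ok e \<or> (\<exists>e'<e. ?ok e')" by (rule Ex_less_Suc[THEN iffD1])
        then show "0 < \<sigma>2 ''f'' 0 0"
        proof
          assume "?ok e"
          with ok(3) have ok by (rule mp)
          with ok(1) show ?thesis by simp
        next
          assume "\<exists>e'<e. ?ok e'"
          with conjunct2[OF e(3)] have "0 < \<sigma>1 ''f'' 0 0" by (rule mp)
          with ok(1) show ?thesis by simp
        qed
      qed
      with col have "?I (Suc e) \<sigma>2" by (rule conjI)
      moreover have "unchanged (?X - {''e''}) \<sigma>1 \<sigma>2" using 2 by (simp add: unchanged_def)
      ultimately show "unchanged (?X - {''e''}) \<sigma>1 \<sigma>2 \<and> ?I (Suc e) \<sigma>2" by blast
    qed (use e N G U rc sym in \<open>simp_all add: eq\<close>)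
  qed (use N in \<open>simp_all add: upd_apply upd_other\<close>)
  then show ?thesis unfolding search_prog_def by - (rule wp_steps_Seq, simp_all)
qed

text \<open>The last assignment negates the flag: truncated subtraction yields 0 for every positive
  \<open>f\<close>, and acceptance has to mean that no three-term factorization exists.\<close>

definition main_prog :: com where
  "main_prog = Seq index_prog (Seq adjacency_prog (Seq maximal_prog (Seq search_prog
     (set_var ''out'' (ISub (IConst 1) (var ''f''))))))"

text \<open>166 = 7 + 9 + 14 + 135 + 1 collects the constants of the five stages, with all their
  powers of N raised to the cube.\<close>

lemma wp_main_prog:
  assumes mn: "1 \<le> m" "1 \<le> n" and \<sigma>: "\<sigma> ''m'' 0 0 = m" "\<sigma> ''n'' 0 0 = n"
  shows "wp \<rho> (166 * (m * n) ^ 3) main_prog (\<lambda>\<sigma>'. \<sigma>' ''out'' 0 0 \<noteq> 0 \<longleftrightarrow> \<not> rank3 (\<rho> ''A'') m n) \<sigma>"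
proof -
  define N where "N = m * n"
  have N: "1 \<le> N" using mn by (simp add: N_def)
  define r where "r v = v div n" for v
  define c where "c v = v mod n" for v
  interpret indexed_matrix "\<rho> ''A''" m n N r c
  proof
    show "r v < m \<and> c v < n" if "v < N" for v
      using that mn by (simp add: r_def c_def N_def less_mult_imp_div_less)
    show "\<exists>v<N. r v = i \<and> c v = j" if "i < m" "j < n" for i j
    proof (intro exI[of _ "i * n + j"] conjI)
      have "i * n + j < Suc i * n" using that by simp
      also have "\<dots> \<le> m * n" using that by (intro mult_le_mono1) simp
      finally show "i * n + j < N" by (simp add: N_def)
    qed (use that in \<open>simp_all add: r_def c_def\<close>)
  qed (use mn in auto)
  let ?U = "maximal_nbhd N adj"
  let ?out = "set_var ''out'' (ISub (IConst 1) (var ''f''))"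
  let ?Q = "\<lambda>\<sigma>' :: istore. \<sigma>' ''out'' 0 0 \<noteq> 0 \<longleftrightarrow> \<not> rank3 (\<rho> ''A'') m n"
  have adj: "adj v w = conflict (\<rho> ''A'') (r v) (c v) (r w) (c w)" for v w by (simp add: adj_def)
  have "wp \<rho> (166 * N ^ Suc (Suc (Suc 0))) main_prog ?Q \<sigma>"
    unfolding main_prog_def
  proof (rule wp_Seq[where U = "159 * N ^ Suc (Suc (Suc 0))", OF wp_mono[OF wp_index_prog[where m = m and n = n] order_refl]])
    fix \<sigma>1 :: istore
    assume 1: "unchanged {''N'', ''i'', ''j'', ''r'', ''c''} \<sigma> \<sigma>1 \<and> \<sigma>1 ''N'' 0 0 = m * n \<and>
      (\<forall>v < m * n. \<sigma>1 ''r'' v 0 = v div n \<and> \<sigma>1 ''c'' v 0 = v mod n)"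
    have N1: "\<sigma>1 ''N'' 0 0 = N" and rc1: "\<And>v. v < N \<Longrightarrow> \<sigma>1 ''r'' v 0 = r v \<and> \<sigma>1 ''c'' v 0 = c v"
      using 1 by (simp_all add: N_def r_def c_def)
    show "wp \<rho> (159 * N ^ Suc (Suc (Suc 0))) (Seq adjacency_prog (Seq maximal_prog (Seq search_prog ?out))) ?Q \<sigma>1"
    proof (rule wp_Seq[where U = "150 * N ^ Suc (Suc (Suc 0))",
          OF wp_mono[OF wp_adjacency_prog[where N = N and r = r and c = c] order_refl]])
      fix \<sigma>2 :: istore
      assume 2: "unchanged {''v'', ''w'', ''G''} \<sigma>1 \<sigma>2 \<and>
        (\<forall>v<N. \<forall>w<N. \<sigma>2 ''G'' v w = of_bool (conflict (\<rho> ''A'') (r v) (c v) (r w) (c w)))"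
      then have eq2: "\<sigma>2 ''N'' = \<sigma>1 ''N''" "\<sigma>2 ''r'' = \<sigma>1 ''r''" "\<sigma>2 ''c'' = \<sigma>1 ''c''"
        by (simp_all add: unchanged_def)
      have G2: "\<And>v w. v < N \<Longrightarrow> w < N \<Longrightarrow> \<sigma>2 ''G'' v w = of_bool (adj v w)" using 2 by (simp add: adj)
      show "wp \<rho> (150 * N ^ Suc (Suc (Suc 0))) (Seq maximal_prog (Seq search_prog ?out)) ?Q \<sigma>2"
      proof (rule wp_Seq[where U = "136 * N ^ Suc (Suc (Suc 0))",
            OF wp_mono[OF wp_maximal_prog[where N = N and adj = adj] order_refl]])
        fix \<sigma>3 :: istore
        assume 3: "unchanged {''v'', ''w'', ''x'', ''s'', ''p'', ''U''} \<sigma>2 \<sigma>3 \<and>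
          (\<forall>v<N. \<sigma>3 ''U'' v 0 = of_bool (?U v))"
        then have eq3: "\<sigma>3 ''N'' = \<sigma>2 ''N''" "\<sigma>3 ''r'' = \<sigma>2 ''r''" "\<sigma>3 ''c'' = \<sigma>2 ''c''" "\<sigma>3 ''G'' = \<sigma>2 ''G''"
          by (simp_all add: unchanged_def)
        show "wp \<rho> (136 * N ^ Suc (Suc (Suc 0))) (Seq search_prog ?out) ?Q \<sigma>3"
        proof (rule wp_Seq[where U = "1 * N ^ 0",
              OF wp_mono[OF wp_search_prog[where N = N and adj = adj and U = ?U and r = r and c = c] order_refl]])
          fix \<sigma>4 :: istore
          assume 4: "(0 < \<sigma>4 ''f'' 0 0 \<longrightarrow> colorable3 N adj ?U) \<and>
            ((\<exists>e<N. splits N adj ?U (\<lambda>x. c x = c e) \<or> splits N adj ?U (\<lambda>x. r x = r e) \<or> splits N adj ?U (\<lambda>x. x = e))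
               \<longrightarrow> 0 < \<sigma>4 ''f'' 0 0)"
          have "0 < \<sigma>4 ''f'' 0 0 \<longleftrightarrow> rank3 (\<rho> ''A'') m n"
            using 4 colorable3_imp_rank3 rank3_imp_splits by blast
          then show "wp \<rho> (1 * N ^ 0) ?out ?Q \<sigma>4"
            by (intro wp_steps) (auto simp: upd_apply)
        qed (use 3 N1 rc1 G2 N adj_sym in \<open>simp_all add: eq2 eq3 cost_add\<close>)
      qed (use N1 G2 N in \<open>simp_all add: eq2\<close>)
    next
      show "9 * N ^ Suc (Suc 0) + 150 * N ^ Suc (Suc (Suc 0)) \<le> 159 * N ^ Suc (Suc (Suc 0))"
        using N by (intro cost_add) simp_all
    qed (use N1 rc1 N in simp_all)
  next
    have "7 * N ^ 1 + 159 * N ^ Suc (Suc (Suc 0)) \<le> 166 * N ^ Suc (Suc (Suc 0))"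
      using N by (intro cost_add) simp_all
    then show "7 * (m * n) + 159 * N ^ Suc (Suc (Suc 0)) \<le> 166 * N ^ Suc (Suc (Suc 0))"
      by (simp add: N_def)
  qed (use mn \<sigma> in simp_all)
  then show ?thesis by (simp add: N_def numeral_3_eq_3)
qed

section \<open>Factor rank\<close>

lemma trop_mult_iff:
  assumes "A \<in> carrier_mat m n" "B \<in> carrier_mat m k" "C \<in> carrier_mat k n" "k > 0"
  shows "A = trop_mult B C \<longleftrightarrow> (\<forall>i<m. \<forall>j<n.
    (\<forall>t<k. A $$ (i, j) \<le> B $$ (i, t) + C $$ (t, j)) \<and> (\<exists>t<k. A $$ (i, j) = B $$ (i, t) + C $$ (t, j)))"
proof -
  have min: "x = Min (f ` {0..<k}) \<longleftrightarrow> (\<forall>t<k. x \<le> f t) \<and> (\<exists>t<k. x = f t)" for x :: real and f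
  proof -
    have "f ` {0..<k} \<noteq> {}" using assms(4) by auto
    then have "x = Min (f ` {0..<k}) \<longleftrightarrow> x \<in> f ` {0..<k} \<and> (\<forall>y \<in> f ` {0..<k}. x \<le> y)"
      using Min_eq_iff[of "f ` {0..<k}" x] by auto
    then show ?thesis by auto
  qed
  have "A = trop_mult B C \<longleftrightarrow>
      (\<forall>i<m. \<forall>j<n. A $$ (i, j) = Min ((\<lambda>t. B $$ (i, t) + C $$ (t, j)) ` {0..<k}))"
    using assms by (auto simp: trop_mult_def intro!: eq_matI)
  then show ?thesis by (simp only: min)
qed

section \<open>Factorizations of matrices and the least inner dimension\<close>

definition factors :: "real mat \<Rightarrow> nat \<Rightarrow> bool" where
  "factors A k \<longleftrightarrow> k > 0 \<and>
     (\<exists>B \<in> carrier_mat (dim_row A) k. \<exists>C \<in> carrier_mat k (dim_col A). A = trop_mult B C)"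

lemma factors_3_if_rank3:
  assumes A: "A \<in> carrier_mat m n" and "rank3 (\<lambda>i j. A $$ (i, j)) m n"
  shows "factors A 3"
proof -
  obtain b c :: "nat \<Rightarrow> nat \<Rightarrow> real" where bc: "\<forall>i<m. \<forall>j<n. (\<forall>t<3. A $$ (i, j) \<le> b i t + c t j) \<and>
      (\<exists>t<3. A $$ (i, j) = b i t + c t j)"
    using assms(2) unfolding rank3_def by blast
  define B where "B = mat m 3 (\<lambda>(i, t). b i t)"
  define C where "C = mat 3 n (\<lambda>(t, j). c t j)"
  have BC: "B \<in> carrier_mat m 3" "C \<in> carrier_mat 3 n" by (simp_all add: B_def C_def)
  have entry: "B $$ (i, t) + C $$ (t, j) = b i t + c t j" if "i < m" "j < n" "t < 3" for i j t
    using that by (simp add: B_def C_def)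
  have "A = trop_mult B C"
    unfolding trop_mult_iff[OF A BC zero_less_numeral]
  proof (intro allI impI conjI)
    fix i j assume ij: "i < m" "j < n"
    show "A $$ (i, j) \<le> B $$ (i, t) + C $$ (t, j)" if "t < 3" for t
      using bc ij that by (simp add: entry)
    obtain t where "t < 3" "A $$ (i, j) = b i t + c t j" using bc ij by blast
    then show "\<exists>t<3. A $$ (i, j) = B $$ (i, t) + C $$ (t, j)"
      using ij by (intro exI[of _ t]) (simp add: entry)
  qed
  with BC show ?thesis using A unfolding factors_def by auto
qed

text \<open>Missing terms are filled up with copies of the last one, which leaves the minimum
  unchanged.\<close>

lemma rank3_if_factors:
  assumes A: "A \<in> carrier_mat m n" and "factors A k" "k \<le> 3"
  shows "rank3 (\<lambda>i j. A $$ (i, j)) m n"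
proof -
  obtain B C where k: "k > 0" and BC: "B \<in> carrier_mat m k" "C \<in> carrier_mat k n" "A = trop_mult B C"
    using assms unfolding factors_def by auto
  have eq: "\<forall>i<m. \<forall>j<n. (\<forall>t<k. A $$ (i, j) \<le> B $$ (i, t) + C $$ (t, j)) \<and>
      (\<exists>t<k. A $$ (i, j) = B $$ (i, t) + C $$ (t, j))"
    using trop_mult_iff[OF A BC(1,2) k] BC(3) by blast
  define b where "b i t = B $$ (i, min t (k - 1))" for i t
  define c where "c t j = C $$ (min t (k - 1), j)" for t j
  have "A $$ (i, j) \<le> b i t + c t j" if "i < m" "j < n" for i j t
    using eq that k by (simp add: b_def c_def)
  moreover have "\<exists>t<3. A $$ (i, j) = b i t + c t j" if ij: "i < m" "j < n" for i j
  proof -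
    obtain t where t: "t < k" "A $$ (i, j) = B $$ (i, t) + C $$ (t, j)" using eq ij by blast
    then have "min t (k - 1) = t" by simp
    then show ?thesis using t assms(3) by (intro exI[of _ t]) (simp add: b_def c_def)
  qed
  ultimately show ?thesis unfolding rank3_def by blast
qed

text \<open>Guarantees that the \<open>LEAST\<close> in \<open>factor_rank\<close> ranges over a
  nonempty set. The second factor is a finite substitute for the tropical unit matrix.\<close>

lemma factors_dim_col:
  assumes A: "A \<in> carrier_mat m n" and "n > 0"
  shows "factors A n"
proof -
  \<comment> \<open>The bound K dominates all differences within a row, so an off-diagonal sum never
    falls below the entry to be represented.\<close>
  have "bdd_above ((\<lambda>(i, t, j). A $$ (i, j) - A $$ (i, t)) ` ({..<m} \<times> {..<n} \<times> {..<n}))"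
    by (intro bdd_above_finite) auto
  then obtain K where "\<forall>x \<in> (\<lambda>(i, t, j). A $$ (i, j) - A $$ (i, t)) ` ({..<m} \<times> {..<n} \<times> {..<n}). x \<le> K"
    unfolding bdd_above_def by blast
  then have K: "A $$ (i, j) - A $$ (i, t) \<le> K" if "i < m" "t < n" "j < n" for i t j
    using that by force
  define C where "C = mat n n (\<lambda>(t, j). if t = j then 0 else K)"
  have C: "C \<in> carrier_mat n n" by (simp add: C_def)
  have "A $$ (i, j) \<le> A $$ (i, t) + C $$ (t, j)" if "i < m" "t < n" "j < n" for i t j
    using K[OF that] that by (auto simp: C_def)
  moreover have "\<exists>t<n. A $$ (i, j) = A $$ (i, t) + C $$ (t, j)" if "i < m" "j < n" for i j
    using that by (intro exI[of _ j]) (simp add: C_def)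
  ultimately have "A = trop_mult A C" using trop_mult_iff[OF A A C \<open>n > 0\<close>] by blast
  then show ?thesis using A C \<open>n > 0\<close> unfolding factors_def by auto
qed

lemma factor_rank_gt_3_iff:
  assumes A: "A \<in> carrier_mat m n" and "n > 0"
  shows "factor_rank A > 3 \<longleftrightarrow> \<not> rank3 (\<lambda>i j. A $$ (i, j)) m n"
proof -
  have rank: "factor_rank A = (LEAST k. factors A k)"
    by (simp add: factor_rank_def factors_def)
  have "factors A (factor_rank A)"
    unfolding rank using factors_dim_col[OF assms] by (rule LeastI)
  moreover have "factor_rank A \<le> 3" if "factors A 3"
    unfolding rank using that by (rule Least_le)
  ultimately show ?thesis
    using factors_3_if_rank3[OF A] rank3_if_factors[OF A] by (meson not_le)
qed

lemma rank3_cong: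
  assumes "\<And>i j. i < m \<Longrightarrow> j < n \<Longrightarrow> a i j = a' i j"
  shows "rank3 a m n \<longleftrightarrow> rank3 a' m n"
  unfolding rank3_def using assms by simp

theorem theorem4p4:
  "\<exists>(c :: com) (K :: real). \<forall>(m :: nat) (n :: nat) (A :: real mat).
     m \<ge> 1 \<and> n \<ge> 1 \<and> A \<in> carrier_mat m n \<longrightarrow>
     (\<exists>t s. exec c (input A) t s \<and>
        (accepting s \<longleftrightarrow> factor_rank A > 3) \<and>
        real t \<le> K * ((real m + real n) ^ 3 * real m * real n * log 2 (real m * real n)
                      + real m ^ 3 * real n ^ 3))"
proof (rule exI[of _ main_prog], rule exI[of _ 166], intro allI impI, elim conjE)
  fix m n :: nat and A :: "real mat"
  assume mn: "m \<ge> 1" "n \<ge> 1" and A: "A \<in> carrier_mat m n"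
  define \<sigma> where "\<sigma> = fst (input A)"
  define \<rho> where "\<rho> = snd (input A)"
  have in_eq: "input A = (\<sigma>, \<rho>)" by (simp add: \<sigma>_def \<rho>_def)
  have "\<sigma> ''m'' 0 0 = m" "\<sigma> ''n'' 0 0 = n" using A by (simp_all add: \<sigma>_def input_def)
  from wp_main_prog[where \<sigma> = \<sigma> and \<rho> = \<rho>, OF mn this]
  obtain t \<sigma>' where t: "exec main_prog (\<sigma>, \<rho>) t (\<sigma>', \<rho>)" "t \<le> 166 * (m * n) ^ 3"
    "\<sigma>' ''out'' 0 0 \<noteq> 0 \<longleftrightarrow> \<not> rank3 (\<rho> ''A'') m n"
    unfolding wp_def by blast
  have "rank3 (\<rho> ''A'') m n \<longleftrightarrow> rank3 (\<lambda>i j. A $$ (i, j)) m n"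
    using A by (intro rank3_cong) (simp add: \<rho>_def input_def)
  then have "accepting (\<sigma>', \<rho>) \<longleftrightarrow> factor_rank A > 3"
    using t(3) factor_rank_gt_3_iff[OF A] mn by (simp add: accepting_def)
  moreover have "real t \<le> 166 * ((real m + real n) ^ 3 * real m * real n * log 2 (real m * real n)
                      + real m ^ 3 * real n ^ 3)"
  proof -
    \<comment> \<open>The operation count is at most 166 times the second summand; this inequality
      makes the logarithm, and with it the first summand, nonnegative.\<close>
    have "1 \<le> real m * real n" using mn by (metis mult_mono' mult_1 of_nat_0_le_iff of_nat_1 of_nat_le_iff zero_le_one)
    then have "0 \<le> (real m + real n) ^ 3 * real m * real n * log 2 (real m * real n)"
      by (intro mult_nonneg_nonneg) (auto simp: zero_le_log_cancel_iff)
    moreover have "real t \<le> real (166 * (m * n) ^ 3)" using t(2) by (rule of_nat_mono)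
    ultimately show ?thesis by (simp add: power_mult_distrib)
  qed
  ultimately show "\<exists>t s. exec main_prog (input A) t s \<and> (accepting s \<longleftrightarrow> factor_rank A > 3) \<and>
      real t \<le> 166 * ((real m + real n) ^ 3 * real m * real n * log 2 (real m * real n)
                      + real m ^ 3 * real n ^ 3)"
    using t(1) unfolding in_eq by blast
qed

end
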